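(* For every $\varepsilon>0$, there exists a unique minimizer $(u_\infty,v_\infty)\in \mathbf{X}\cap(W^{1,2}\times W^{1,2})$ of the functional $\mathcal{E}$ on $\mathbf{X}$. The pair $(u_\infty,v_\infty)$ is a stationary solution of the system $$\partial_t u=\mathrm{div}\big(u\,\mathrm{D}(2u+U+\varepsilon\psi)\big),\qquad \partial_t v=\mathrm{div}\big(v\,\mathrm{D}(2v+V-\varepsilon\psi)\big),\qquad -\Delta\psi=u-v\qquad\text{on }\mathbb{R}^3,$$ and satisfies $$u_\infty=\tfrac12[C_u-U-\varepsilon\psi_\infty]_+,\qquad v_\infty=\tfrac12[C_v-V+\varepsilon\psi_\infty]_+,\qquad \psi_\infty:=\mathbf{G}\ast(u_\infty-v_\infty),$$ where $C_u,C_v\in\mathbb{R}$ are such that $\|u_\infty\|_{L^1}=1=\|v_\infty\|_{L^1}$ and $[\cdot]_+$ denotes the positive part. For every $\alpha\in(0,1)$, one has $u_\infty,v_\infty\in C^{0,\alpha}$ with compact support, and $\psi_\infty\in L^\infty\cap C^{2,\alpha}$.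
   Context: All function spaces are over $\mathbb{R}^3$; $\mathrm{D}$ and $\mathrm{D}^2$ denote the spatial gradient and Hessian. The potentials $U,V\in C^2(\mathbb{R}^3)$ satisfy $\|\mathrm{D}^2U\|_{L^\infty}<\infty$, $\|\mathrm{D}^2V\|_{L^\infty}<\infty$ and $\mathrm{D}^2U\ge\lambda_0\mathbf 1$, $\mathrm{D}^2V\ge\lambda_0\mathbf 1$ in the sense of symmetric matrices, for some $\lambda_0>0$. Newton's potential is $\mathbf{G}(x)=\frac{1}{4\pi|x|}$ for $x\ne0$. In the system, $\psi=\mathbf{G}\ast(u-v)$. $\mathscr{P}_2$ is the space of absolutely continuous probability measures on $\mathbb{R}^3$ with finite second moment (identified with their Lebesgue densities), and $\mathbf{X}=\mathscr{P}_2\times\mathscr{P}_2$. The energy $\mathcal{E}:\mathbf{X}\to\mathbb{R}\cup\{+\infty\}$ is $$\mathcal{E}(u,v)=\int_{\mathbb{R}^3}\Big(u^2+v^2+uU+vV+\tfrac{\varepsilon}{2}|\mathrm{D}\psi|^2\Big)\,\mathrm{d}x\quad\text{if }(u,v)\in L^2\times L^2,\ \text{with }\psi=\mathbf{G}\ast(u-v),$$ and $\mathcal{E}(u,v)=+\infty$ otherwise. *)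

theory Defs
  imports "HOL-Analysis.Analysis"
begin

type_synonym R3 = "real^3"

section \<open>Classical derivatives, \<open>C\<^sup>k\<close> and Hoelder spaces\<close>

definition pd :: "3 \<Rightarrow> (R3 \<Rightarrow> real) \<Rightarrow> R3 \<Rightarrow> real" where
  "pd i f x = frechet_derivative f (at x) (axis i 1)"

definition grad :: "(R3 \<Rightarrow> real) \<Rightarrow> R3 \<Rightarrow> R3" where
  "grad f x = (\<chi> i. pd i f x)"

definition hess :: "(R3 \<Rightarrow> real) \<Rightarrow> R3 \<Rightarrow> real^3^3" where
  "hess f x = (\<chi> i j. pd i (pd j f) x)"

fun Ck :: "nat \<Rightarrow> (R3 \<Rightarrow> real) \<Rightarrow> bool" where
  "Ck 0 f \<longleftrightarrow> continuous_on UNIV f"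
| "Ck (Suc k) f \<longleftrightarrow> (\<forall>x. f differentiable (at x)) \<and> (\<forall>i. Ck k (pd i f))"

text \<open>Finiteness of the full Hoelder norm: all partial derivatives of order at most \<open>k\<close> are
  bounded, and those of order \<open>k\<close> are globally Hoelder continuous with exponent \<open>\<alpha>\<close>.\<close>

fun Holder :: "nat \<Rightarrow> real \<Rightarrow> (R3 \<Rightarrow> real) \<Rightarrow> bool" where
  "Holder 0 \<alpha> f \<longleftrightarrow> bounded (range f) \<and> (\<exists>C. \<forall>x y. \<bar>f x - f y\<bar> \<le> C * dist x y powr \<alpha>)"
| "Holder (Suc k) \<alpha> f \<longleftrightarrow>
     bounded (range f) \<and> (\<forall>x. f differentiable (at x)) \<and> (\<forall>i. Holder k \<alpha> (pd i f))"

definition compact_support :: "(R3 \<Rightarrow> real) \<Rightarrow> bool" where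
  "compact_support f \<longleftrightarrow> compact (closure {x. f x \<noteq> 0})"

definition test_function :: "(R3 \<Rightarrow> real) \<Rightarrow> bool" where
  "test_function \<phi> \<longleftrightarrow> (\<forall>k. Ck k \<phi>) \<and> compact_support \<phi>"

text \<open>The order on symmetric matrices.\<close>

definition matrix_le :: "real^3^3 \<Rightarrow> real^3^3 \<Rightarrow> bool" where
  "matrix_le A B \<longleftrightarrow> (\<forall>\<xi>. 0 \<le> \<xi> \<bullet> ((B - A) *v \<xi>))"

section \<open>Lebesgue and Sobolev spaces\<close>

text \<open>Elements of Lebesgue spaces are represented by Borel functions; equality in these spaces
  is equality almost everywhere with respect to \<^const>\<open>lborel\<close>.\<close>

definition L2 :: "(R3 \<Rightarrow> 'b::euclidean_space) set" where
  "L2 = {f \<in> borel_measurable lborel. integrable lborel (\<lambda>x. (norm (f x))\<^sup>2)}"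

definition Linf :: "(R3 \<Rightarrow> 'b::euclidean_space) set" where
  "Linf = {f \<in> borel_measurable lborel. \<exists>B. AE x in lborel. norm (f x) \<le> B}"

definition locally_integrable :: "(R3 \<Rightarrow> 'b::euclidean_space) \<Rightarrow> bool" where
  "locally_integrable f \<longleftrightarrow> (\<forall>K. compact K \<longrightarrow> set_integrable lborel K f)"

definition has_weak_grad :: "(R3 \<Rightarrow> real) \<Rightarrow> (R3 \<Rightarrow> R3) \<Rightarrow> bool" where
  "has_weak_grad f w \<longleftrightarrow> locally_integrable f \<and> locally_integrable w \<and>
     (\<forall>\<phi>. test_function \<phi> \<longrightarrow>
       (LINT x|lborel. f x *\<^sub>R grad \<phi> x) = - (LINT x|lborel. \<phi> x *\<^sub>R w x))"

text \<open>Weak gradients are unique almost everywhere, so the choice below is immaterial inside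
  integrals.\<close>

definition weak_grad :: "(R3 \<Rightarrow> real) \<Rightarrow> R3 \<Rightarrow> R3" where
  "weak_grad f = (SOME w. has_weak_grad f w)"

definition has_weak_div :: "(R3 \<Rightarrow> R3) \<Rightarrow> (R3 \<Rightarrow> real) \<Rightarrow> bool" where
  "has_weak_div F g \<longleftrightarrow> locally_integrable F \<and> locally_integrable g \<and>
     (\<forall>\<phi>. test_function \<phi> \<longrightarrow>
       (LINT x|lborel. F x \<bullet> grad \<phi> x) = - (LINT x|lborel. g x * \<phi> x))"

definition W12 :: "(R3 \<Rightarrow> real) set" where
  "W12 = {f \<in> L2. \<exists>w \<in> L2. has_weak_grad f w}"

section \<open>The energy and the stationary system\<close>

text \<open>The value at the origin (here 0, by the convention for division by 0) is irrelevant.\<close>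

definition newton :: "R3 \<Rightarrow> real" where
  "newton x = 1 / (4 * pi * norm x)"

definition convolution :: "(R3 \<Rightarrow> real) \<Rightarrow> (R3 \<Rightarrow> real) \<Rightarrow> R3 \<Rightarrow> real" where
  "convolution f g x = (LINT y|lborel. f (x - y) * g y)"

definition potential :: "(R3 \<Rightarrow> real) \<Rightarrow> (R3 \<Rightarrow> real) \<Rightarrow> R3 \<Rightarrow> real" where
  "potential u v = convolution newton (\<lambda>x. u x - v x)"

text \<open>Lebesgue densities of the absolutely continuous probability measures with finite second
  moment.\<close>

definition P2 :: "(R3 \<Rightarrow> real) set" where
  "P2 = {u. has_bochner_integral lborel u 1 \<and> (AE x in lborel. 0 \<le> u x) \<and>
            integrable lborel (\<lambda>x. (norm x)\<^sup>2 * u x)}"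

definition X :: "((R3 \<Rightarrow> real) \<times> (R3 \<Rightarrow> real)) set" where
  "X = P2 \<times> P2"

text \<open>For \<open>(u, v) \<in> X\<close> with \<open>u, v \<in> L2\<close> and potentials with bounded Hessian the integrand is
  integrable: the potentials grow at most quadratically, and \<open>u - v\<close> lies in \<open>L\<^sup>1 \<inter> L\<^sup>2\<close>, so
  the weak gradient of the Newtonian potential exists and is square integrable (but it
  need not be a classical gradient).\<close>

definition energy ::
  "(R3 \<Rightarrow> real) \<Rightarrow> (R3 \<Rightarrow> real) \<Rightarrow> real \<Rightarrow> (R3 \<Rightarrow> real) \<times> (R3 \<Rightarrow> real) \<Rightarrow> ereal" where
  "energy U V \<epsilon> = (\<lambda>(u, v).
     if u \<in> L2 \<and> v \<in> L2 then
       ereal (LINT x|lborel. (u x)\<^sup>2 + (v x)\<^sup>2 + u x * U x + v x * V x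
                + \<epsilon> / 2 * (norm (weak_grad (potential u v) x))\<^sup>2)
     else \<infinity>)"

text \<open>Time-independent solutions, in the sense of distributions, of
  \<open>\<partial>\<^sub>t u = div (u D(2u + U + \<epsilon>\<psi>))\<close>, \<open>\<partial>\<^sub>t v = div (v D(2v + V - \<epsilon>\<psi>))\<close>, \<open>- \<Delta>\<psi> = u - v\<close>.\<close>

definition stationary_solution ::
  "(R3 \<Rightarrow> real) \<Rightarrow> (R3 \<Rightarrow> real) \<Rightarrow> real \<Rightarrow> (R3 \<Rightarrow> real) \<Rightarrow> (R3 \<Rightarrow> real) \<Rightarrow> (R3 \<Rightarrow> real) \<Rightarrow> bool"
where
  "stationary_solution U V \<epsilon> u v \<psi> \<longleftrightarrow>
     (\<exists>w. has_weak_grad (\<lambda>x. 2 * u x + U x + \<epsilon> * \<psi> x) w \<and>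
          has_weak_div (\<lambda>x. u x *\<^sub>R w x) (\<lambda>x. 0)) \<and>
     (\<exists>w. has_weak_grad (\<lambda>x. 2 * v x + V x - \<epsilon> * \<psi> x) w \<and>
          has_weak_div (\<lambda>x. v x *\<^sub>R w x) (\<lambda>x. 0)) \<and>
     (\<exists>w. has_weak_grad \<psi> w \<and> has_weak_div w (\<lambda>x. - (u x - v x)))"

end

theory Submission
  imports Defs
begin

text \<open>
  The energy is a strictly convex quadratic functional, and everything follows from making its
  quadratic part explicit. For \<open>f = u - v\<close> in \<open>L\<^sup>1 \<inter> L\<^sup>2\<close> the potential \<open>\<psi> = G * f\<close> has the weak gradient
  \<open>\<nabla>G * f\<close>, and the Dirichlet energy equals the Coulomb energy \<open>\<integral> f (G * f)\<close>
  (\<open>newton_field_energy\<close>). By Fubini this is the identity \<open>\<integral> \<nabla>G(z - x) \<cdot> \<nabla>G(z - y) dz = G(x - y)\<close>. Both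
  this identity and Poisson's equation are cases of \<open>newton_flux\<close>: the integral of
  \<open>\<nabla>G \<cdot> \<nabla>\<phi>\<close> is \<open>\<phi>(0)\<close>, even for a function \<open>\<phi>\<close> with a singularity away from the origin. The energy thus has an
  exact second-order expansion whose second-order part controls the \<open>L\<^sup>2\<close> norm (\<open>J_expansion\<close>).

  Existence needs no weak compactness. By the parallelogram identity a minimizing sequence whose
  energies converge fast is Cauchy in \<open>L\<^sup>2\<close>, hence converges strongly and almost everywhere. The
  confinement bounds the second moments, so no mass escapes to infinity, and the limit is a pair
  of probability densities. The expansion around the limit reduces lower semicontinuity to that of a linear
  functional with a weight bounded below, which is Fatou's lemma (\<open>minimizer_exists\<close>). Uniqueness
  is strict convexity.

  At a minimizer \<open>(u, v)\<close> the first variation towards every other admissible pair is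
  nonnegative, so \<open>u\<close> minimizes the linear functional with weight \<open>2u + U + \<epsilon>\<psi>\<close> among probability
  densities. Hence this weight is constant on \<open>u > 0\<close> and not smaller elsewhere, which
  is the formula \<open>u = [C - U - \<epsilon>\<psi>]\<^sub>+ / 2\<close> (\<open>minimizer_Euler_Lagrange\<close>). The potential \<open>\<psi>\<close> is bounded and
  \<open>U\<close> grows quadratically, so \<open>u\<close> is bounded with compact support; and stationarity is immediate, as
  the flux \<open>u D(2u + U + \<epsilon>\<psi>)\<close> vanishes identically.

  Regularity is a bootstrap in two steps. With bounded \<open>u\<close> and \<open>v\<close> the potential is continuously
  differentiable, so \<open>u\<close> and \<open>v\<close> are positive parts of such functions and therefore Lipschitz. Then
  the second derivatives of \<open>\<psi>\<close> are convolutions of \<open>\<nabla>G\<close> with the bounded gradient of \<open>u - v\<close>, and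
  the convolution of \<open>\<nabla>G\<close> with a bounded function of compact support is Hoelder continuous with
  every exponent below 1 (\<open>newton_field_Holder\<close>); no singular integral is needed.

  The tool that carries both the weak and the classical differentiation is the notion of a gradient along
  lines (\<open>line_gradient\<close>): increments are integrals of the gradient over segments. It passes to positive parts and to
  convolutions by Fubini, it yields weak gradients, and classical ones when the gradient is continuous.
\<close>

section \<open>Integration on space: Fubini, affine changes of variables, radial integrals\<close>

lemma integrable_pairI:
  fixes f :: "'a::euclidean_space \<Rightarrow> 'b::euclidean_space \<Rightarrow> 'c::{banach, second_countable_topology}"
  assumes "case_prod f \<in> borel_measurable (lborel \<Otimes>\<^sub>M lborel)"
    and "(\<integral>\<^sup>+x. (\<integral>\<^sup>+y. ennreal (norm (f x y)) \<partial>lborel) \<partial>lborel) < \<infinity>"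
  shows "integrable (lborel \<Otimes>\<^sub>M lborel) (case_prod f)"
proof (rule integrableI_bounded)
  note [measurable] = assms(1)
  have "(\<integral>\<^sup>+p. ennreal (norm (case_prod f p)) \<partial>(lborel \<Otimes>\<^sub>M lborel))
      = (\<integral>\<^sup>+x. (\<integral>\<^sup>+y. ennreal (norm (case_prod f (x, y))) \<partial>lborel) \<partial>lborel)"
    by (intro lborel.nn_integral_fst[symmetric]) measurable
  then show "(\<integral>\<^sup>+p. ennreal (norm (case_prod f p)) \<partial>(lborel \<Otimes>\<^sub>M lborel)) < \<infinity>"
    using assms(2) by simp
qed fact

lemma integrable_indicator_compact:
  fixes K :: "'a::euclidean_space set"
  assumes "compact K" shows "integrable lborel (indicator K :: 'a \<Rightarrow> real)"
  using assms emeasure_compact_finite[OF assms]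
  by (intro integrable_real_indicator) (auto simp: compact_imp_closed borel_closed)

lemma nn_integral_lborel_affine:
  fixes f :: "R3 \<Rightarrow> ennreal"
  assumes [measurable]: "f \<in> borel_measurable borel" and "c \<noteq> 0"
  shows "(\<integral>\<^sup>+x. f x \<partial>lborel) = ennreal (\<bar>c\<bar>^3) * (\<integral>\<^sup>+x. f (a + c *\<^sub>R x) \<partial>lborel)"
  by (subst lborel_affine[OF assms(2), of a])
     (simp add: nn_integral_density nn_integral_distr nn_integral_cmult)

lemma nn_integral_translate:
  fixes f :: "R3 \<Rightarrow> ennreal"
  assumes "f \<in> borel_measurable borel"
  shows "(\<integral>\<^sup>+x. f (x + a) \<partial>lborel) = (\<integral>\<^sup>+x. f x \<partial>lborel)"
    and "(\<integral>\<^sup>+x. f (x - a) \<partial>lborel) = (\<integral>\<^sup>+x. f x \<partial>lborel)"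
    and "(\<integral>\<^sup>+x. f (a - x) \<partial>lborel) = (\<integral>\<^sup>+x. f x \<partial>lborel)"
  using nn_integral_lborel_affine[OF assms, of 1 a] nn_integral_lborel_affine[OF assms, of 1 "-a"]
    nn_integral_lborel_affine[OF assms, of "-1" a] by (simp_all add: add.commute)

lemma lborel_reflect: "distr lborel borel (\<lambda>x. a - x) = (lborel :: R3 measure)"
  using lborel_affine[of "-1" a] by (simp add: density_1)

lemma lborel_translate: "distr lborel borel (\<lambda>x. x + a) = (lborel :: R3 measure)"
  using lborel_affine[of "1" a] by (simp add: density_1 add.commute)

lemma integral_translate:
  fixes f :: "R3 \<Rightarrow> 'b::{banach, second_countable_topology}"
  assumes [measurable]: "f \<in> borel_measurable borel"
  shows "(LINT x|lborel. f (x + a)) = (LINT x|lborel. f x)"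
    and "(LINT x|lborel. f (a - x)) = (LINT x|lborel. f x)"
    and "integrable lborel (\<lambda>x. f (x + a)) \<longleftrightarrow> integrable lborel f"
    and "integrable lborel (\<lambda>x. f (a - x)) \<longleftrightarrow> integrable lborel f"
  using integral_distr[of "\<lambda>x. x + a" lborel borel f] integral_distr[of "\<lambda>x. a - x" lborel borel f]
    integrable_distr_eq[of "\<lambda>x. x + a" lborel borel f] integrable_distr_eq[of "\<lambda>x. a - x" lborel borel f]
  by (simp_all add: lborel_reflect lborel_translate)

text \<open>Polar coordinates for radial integrands: the distribution of the norm is determined by the
  volumes of balls.\<close>

lemma distr_norm_lborel:
  "distr lborel borel (norm :: R3 \<Rightarrow> real)
     = density lborel (\<lambda>r. ennreal (4 * pi * r\<^sup>2) * indicator {0..} r)"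
proof (rule measure_eqI_generator_eq[where E = "range atMost" and \<Omega> = UNIV and A = "\<lambda>n. {..real n}"])
  show "Int_stable (range (atMost :: real \<Rightarrow> _))"
    by (auto simp: Int_stable_def)
  have *: "(\<integral>\<^sup>+ x. ennreal (4 * pi * x\<^sup>2) * indicator {0..a} x \<partial>lborel) = ennreal (4/3 * pi * a^3 - 4/3 * pi * 0^3)"
    if "0 \<le> a" for a :: real
    by (rule nn_integral_FTC_Icc[OF _ _ _ that]) (auto intro!: derivative_eq_intros simp: power2_eq_square)
  have ball: "emeasure lborel (cball (0::R3) a) = ennreal (4/3 * pi * a^3)" if "0 \<le> a" for a :: real
    using that by (subst emeasure_cball) (auto simp: eval_unit_ball_vol field_simps power3_eq_cube)
  show "emeasure (distr lborel borel (norm :: R3 \<Rightarrow> real)) X = emeasure (density lborel (\<lambda>r. ennreal (4 * pi * r\<^sup>2) * indicator {0..} r)) X"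
    if X: "X \<in> range atMost" for X
  proof -
    obtain a where a: "X = {..a}" using X by auto
    have l: "emeasure (distr lborel borel (norm :: R3 \<Rightarrow> real)) X = emeasure lborel (cball (0::R3) a)"
      unfolding a by (subst emeasure_distr) (auto intro!: arg_cong[where f="emeasure lborel"])
    have r: "emeasure (density lborel (\<lambda>r. ennreal (4 * pi * r\<^sup>2) * indicator {0..} r)) X
        = (\<integral>\<^sup>+ x. ennreal (4 * pi * x\<^sup>2) * indicator {0..a} x \<partial>lborel)"
      unfolding a by (subst emeasure_density) (auto intro!: nn_integral_cong split: split_indicator)
    show ?thesis
    proof (cases "0 \<le> a")
      case True
      then show ?thesis using l r *[OF True] ball[OF True] by simp
    next
      case False
      then show ?thesis using l r by simp
    qed
  qed
  show "\<And>i. emeasure (distr lborel borel (norm :: R3 \<Rightarrow> real)) {..real i} \<noteq> \<infinity>"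
  proof -
    fix i
    have "emeasure (distr lborel borel (norm :: R3 \<Rightarrow> real)) {..real i} = emeasure lborel (cball (0::R3) (real i))"
      by (subst emeasure_distr) (auto intro!: arg_cong[where f="emeasure lborel"])
    then show "emeasure (distr lborel borel (norm :: R3 \<Rightarrow> real)) {..real i} \<noteq> \<infinity>"
      using ball[of "real i"] by simp
  qed
  show "(\<Union>i. {..real i}) = UNIV" by (auto simp: real_arch_simple)
qed (auto simp: borel_eq_atMost)

lemma nn_integral_radial:
  fixes h :: "real \<Rightarrow> ennreal"
  assumes [measurable]: "h \<in> borel_measurable borel"
  shows "(\<integral>\<^sup>+x. h (norm (x::R3)) \<partial>lborel)
       = (\<integral>\<^sup>+r. ennreal (4 * pi * r\<^sup>2) * indicator {0..} r * h r \<partial>lborel)"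
proof -
  have "(\<integral>\<^sup>+x. h (norm (x::R3)) \<partial>lborel) = (\<integral>\<^sup>+r. h r \<partial>distr lborel borel (norm :: R3 \<Rightarrow> real))"
    by (subst nn_integral_distr) auto
  then show ?thesis unfolding distr_norm_lborel
    by (simp add: nn_integral_density)
qed

text \<open>The convention \<open>0 powr x = 0\<close> gives the value 0 at the origin, as for \<open>newton\<close>, so that
  comparisons of kernels hold at every point.\<close>

definition riesz :: "real \<Rightarrow> R3 \<Rightarrow> real" where
  "riesz p z = norm z powr (- p)"

lemma borel_measurable_riesz [measurable]: "riesz p \<in> borel_measurable borel"
  unfolding riesz_def by measurable

lemma riesz_nonneg [simp]: "0 \<le> riesz p z"
  by (simp add: riesz_def)

lemma riesz_minus_commute: "riesz p (x - y) = riesz p (y - x)"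
  by (simp add: riesz_def norm_minus_commute)

lemma riesz_power:
  "riesz 1 z = 1 / norm z" "riesz 2 z = 1 / (norm z)\<^sup>2" "riesz 4 z = 1 / (norm z)^4"
  by (cases "z = 0"; simp add: riesz_def powr_minus divide_inverse)+

lemma nn_integral_riesz_ball:
  assumes "p < 3" "0 \<le> \<rho>"
  shows "(\<integral>\<^sup>+x. ennreal (riesz p x) * indicator (cball 0 \<rho>) x \<partial>lborel)
       = ennreal (4 * pi * \<rho> powr (3 - p) / (3 - p))"
proof -
  have "((\<lambda>r. 4 * pi * r powr (2 - p)) has_integral (4 * pi * (\<rho> powr (2 - p + 1) / (2 - p + 1)))) {0..\<rho>}"
    by (intro has_integral_mult_right has_integral_powr_from_0) (use assms in auto)
  from nn_integral_has_integral_lebesgue'[OF _ this]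
  have *: "(\<integral>\<^sup>+r. ennreal (4 * pi * r powr (2 - p)) * indicator {0..\<rho>} r \<partial>lborel)
      = ennreal (4 * pi * \<rho> powr (3 - p) / (3 - p))"
    by (simp add: add.commute)
  have "(\<integral>\<^sup>+x. ennreal (riesz p x) * indicator (cball 0 \<rho>) x \<partial>lborel)
      = (\<integral>\<^sup>+x. ennreal (norm (x::R3) powr - p) * indicator {..\<rho>} (norm x) \<partial>lborel)"
    by (intro nn_integral_cong) (auto simp: riesz_def split: split_indicator)
  also have "\<dots> = (\<integral>\<^sup>+r. ennreal (4 * pi * r\<^sup>2) * indicator {0..} r * (ennreal (r powr - p) * indicator {..\<rho>} r) \<partial>lborel)"
    by (rule nn_integral_radial) measurable
  also have "\<dots> = (\<integral>\<^sup>+r. ennreal (4 * pi * r powr (2 - p)) * indicator {0..\<rho>} r \<partial>lborel)"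
  proof (intro nn_integral_cong)
    fix r :: real
    have "r\<^sup>2 * r powr - p = r powr (2 - p)" if "0 < r"
      using that powr_add[of r 2 "-p"] by (simp add: powr_numeral)
    then have "4 * pi * r\<^sup>2 * r powr - p = 4 * pi * r powr (2 - p)" if "0 \<le> r"
      using that by (cases "r = 0") auto
    then show "ennreal (4 * pi * r\<^sup>2) * indicator {0..} r * (ennreal (r powr - p) * indicator {..\<rho>} r) =
         ennreal (4 * pi * r powr (2 - p)) * indicator {0..\<rho>} r"
      by (auto split: split_indicator simp: ennreal_mult'[symmetric])
  qed
  finally show ?thesis using * by simp
qed

lemma nn_integral_riesz_4_outside:
  assumes "0 < \<rho>"
  shows "(\<integral>\<^sup>+x. ennreal (riesz 4 x) * indicator (- ball 0 \<rho>) x \<partial>lborel) = ennreal (4 * pi / \<rho>)"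
proof -
  have "((\<lambda>r. 4 * pi * r powr (- 2)) has_integral (4 * pi * (- (\<rho> powr (- 2 + 1)) / (- 2 + 1)))) {\<rho>..}"
    by (intro has_integral_mult_right has_integral_powr_to_inf) (use assms in auto)
  from nn_integral_has_integral_lebesgue'[OF _ this]
  have *: "(\<integral>\<^sup>+r. ennreal (4 * pi * r powr (- 2)) * indicator {\<rho>..} r \<partial>lborel) = ennreal (4 * pi / \<rho>)"
    using assms by (simp add: powr_minus divide_inverse)
  have "(\<integral>\<^sup>+x. ennreal (riesz 4 x) * indicator (- ball 0 \<rho>) x \<partial>lborel)
      = (\<integral>\<^sup>+x. ennreal (norm (x::R3) powr - 4) * indicator {\<rho>..} (norm x) \<partial>lborel)"
    by (intro nn_integral_cong) (auto simp: riesz_def split: split_indicator)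
  also have "\<dots> = (\<integral>\<^sup>+r. ennreal (4 * pi * r\<^sup>2) * indicator {0..} r * (ennreal (r powr - 4) * indicator {\<rho>..} r) \<partial>lborel)"
    by (rule nn_integral_radial) measurable
  also have "\<dots> = (\<integral>\<^sup>+r. ennreal (4 * pi * r powr (- 2)) * indicator {\<rho>..} r \<partial>lborel)"
  proof (intro nn_integral_cong)
    fix r :: real
    have "r\<^sup>2 * r powr - 4 = r powr (- 2)" if "\<rho> \<le> r"
      using that assms powr_add[of r 2 "-4"] by (simp add: powr_numeral)
    then have "4 * pi * r\<^sup>2 * r powr - 4 = 4 * pi * r powr (- 2)" if "\<rho> \<le> r"
      using that by auto
    then show "ennreal (4 * pi * r\<^sup>2) * indicator {0..} r * (ennreal (r powr - 4) * indicator {\<rho>..} r) =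
         ennreal (4 * pi * r powr (- 2)) * indicator {\<rho>..} r"
      using assms by (auto split: split_indicator simp: ennreal_mult'[symmetric])
  qed
  finally show ?thesis using * by simp
qed

lemma riesz_le_1:
  assumes "0 \<le> p" "1 \<le> norm z" shows "riesz p z \<le> 1"
  using assms powr_mono[of "-p" 0 "norm z"] by (cases "z = 0") (auto simp: riesz_def)

text \<open>The bounds below hold uniformly in the translation parameter: near the singularity the
  kernel is integrable and the density bounded (or both are square integrable), away from it the
  kernel is bounded and the density integrable.\<close>

lemma nn_integral_riesz_bounded:
  fixes g :: "R3 \<Rightarrow> real"
  assumes "0 \<le> p" "p < 3" and [measurable]: "g \<in> borel_measurable borel"
    and g: "\<And>y. \<bar>g y\<bar> \<le> B" "integrable lborel g"
  shows "(\<integral>\<^sup>+y. ennreal (riesz p (x - y) * \<bar>g y\<bar>) \<partial>lborel)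
       \<le> ennreal (4 * pi / (3 - p) * B + (LINT y|lborel. \<bar>g y\<bar>))"
proof -
  have B: "0 \<le> B" using g(1)[of 0] by simp
  define h where "h z = ennreal (riesz p z) * indicator (cball 0 1) z" for z
  have [measurable]: "h \<in> borel_measurable borel" unfolding h_def by (auto intro!: borel_measurable_times_ennreal borel_measurable_indicator)
  have "(\<integral>\<^sup>+y. ennreal (riesz p (x - y) * \<bar>g y\<bar>) \<partial>lborel)
     \<le> (\<integral>\<^sup>+y. ennreal B * h (x - y) + ennreal \<bar>g y\<bar> \<partial>lborel)"
  proof (intro nn_integral_mono)
    fix y
    show "ennreal (riesz p (x - y) * \<bar>g y\<bar>)
      \<le> ennreal B * h (x - y) + ennreal \<bar>g y\<bar>"
    proof (cases "norm (x - y) \<le> 1")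
      case True
      have "riesz p (x - y) * \<bar>g y\<bar> \<le> B * riesz p (x - y)"
        using g(1)[of y] by (simp add: mult.commute mult_right_mono)
      then have "ennreal (riesz p (x - y) * \<bar>g y\<bar>) \<le> ennreal B * ennreal (riesz p (x - y))"
        using B by (simp add: ennreal_mult[symmetric] ennreal_leI)
      with True show ?thesis by (simp add: h_def add_increasing2)
    next
      case False
      have "riesz p (x - y) * \<bar>g y\<bar> \<le> \<bar>g y\<bar>"
        using riesz_le_1[of p "x - y"] assms(1) False by (simp add: mult_left_le_one_le)
      then show ?thesis using B False by (intro add_increasing) (auto intro!: ennreal_leI)
    qed
  qed
  also have "\<dots> = ennreal B * (\<integral>\<^sup>+y. h (x - y) \<partial>lborel)
      + (\<integral>\<^sup>+y. ennreal \<bar>g y\<bar> \<partial>lborel)"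
    by (simp add: nn_integral_add nn_integral_cmult)
  also have "(\<integral>\<^sup>+y. h (x - y) \<partial>lborel) = ennreal (4 * pi / (3 - p))"
    using nn_integral_translate(3)[of h x]
      nn_integral_riesz_ball[of p 1] assms by (simp add: h_def)
  also have "(\<integral>\<^sup>+y. ennreal \<bar>g y\<bar> \<partial>lborel) = ennreal (LINT y|lborel. \<bar>g y\<bar>)"
    using g(2) by (intro nn_integral_eq_integral) auto
  finally show ?thesis
    using B assms by (simp add: ennreal_mult[symmetric] ennreal_plus[symmetric] integral_nonneg_AE mult.commute
        del: ennreal_plus)
qed

lemma nn_integral_riesz_1_L2:
  fixes g :: "R3 \<Rightarrow> real"
  assumes [measurable]: "g \<in> borel_measurable borel"
    and g: "integrable lborel g" "integrable lborel (\<lambda>y. (g y)\<^sup>2)"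
  shows "(\<integral>\<^sup>+y. ennreal (riesz 1 (x - y) * \<bar>g y\<bar>) \<partial>lborel)
       \<le> ennreal (4 * pi + (LINT y|lborel. (g y)\<^sup>2) + (LINT y|lborel. \<bar>g y\<bar>))"
proof -
  define h where "h z = ennreal (riesz 2 z) * indicator (cball 0 1) z" for z
  have [measurable]: "h \<in> borel_measurable borel" unfolding h_def by (auto intro!: borel_measurable_times_ennreal borel_measurable_indicator)
  have "(\<integral>\<^sup>+y. ennreal (riesz 1 (x - y) * \<bar>g y\<bar>) \<partial>lborel)
     \<le> (\<integral>\<^sup>+y. h (x - y) + ennreal ((g y)\<^sup>2) + ennreal \<bar>g y\<bar> \<partial>lborel)"
  proof (intro nn_integral_mono)
    fix y
    show "ennreal (riesz 1 (x - y) * \<bar>g y\<bar>)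
      \<le> h (x - y) + ennreal ((g y)\<^sup>2) + ennreal \<bar>g y\<bar>"
    proof (cases "norm (x - y) \<le> 1")
      case True
      have "0 \<le> (riesz 1 (x - y) - \<bar>g y\<bar>)\<^sup>2 + (riesz 1 (x-y))\<^sup>2 + \<bar>g y\<bar>\<^sup>2" by simp
      moreover have "(riesz 1 (x - y))\<^sup>2 = riesz 2 (x - y)"
        by (simp add: riesz_power power_divide)
      ultimately have "riesz 1 (x - y) * \<bar>g y\<bar> \<le> riesz 2 (x - y) + (g y)\<^sup>2"
        by (simp add: power2_diff)
      then have "ennreal (riesz 1 (x - y) * \<bar>g y\<bar>) \<le> ennreal (riesz 2 (x - y) + (g y)\<^sup>2)"
        by (rule ennreal_leI)
      also have "\<dots> = h (x - y) + ennreal ((g y)\<^sup>2)"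
        using True by (simp add: h_def ennreal_plus)
      also have "\<dots> \<le> \<dots> + ennreal \<bar>g y\<bar>" by simp
      finally show ?thesis .
    next
      case False
      have "riesz 1 (x - y) * \<bar>g y\<bar> \<le> \<bar>g y\<bar>"
        using riesz_le_1[of 1 "x - y"] False by (simp add: mult_left_le_one_le)
      then show ?thesis using False by (simp add: ennreal_leI add_increasing)
    qed
  qed
  also have "\<dots> = (\<integral>\<^sup>+y. h (x - y) \<partial>lborel)
      + (\<integral>\<^sup>+y. ennreal ((g y)\<^sup>2) \<partial>lborel) + (\<integral>\<^sup>+y. ennreal \<bar>g y\<bar> \<partial>lborel)"
    by (simp add: nn_integral_add)
  also have "(\<integral>\<^sup>+y. h (x - y) \<partial>lborel) = ennreal (4 * pi)"
    using nn_integral_translate(3)[of h x]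
      nn_integral_riesz_ball[of 2 1] by (simp add: h_def)
  also have "(\<integral>\<^sup>+y. ennreal \<bar>g y\<bar> \<partial>lborel) = ennreal (LINT y|lborel. \<bar>g y\<bar>)"
    using g(1) by (intro nn_integral_eq_integral) auto
  also have "(\<integral>\<^sup>+y. ennreal ((g y)\<^sup>2) \<partial>lborel) = ennreal (LINT y|lborel. (g y)\<^sup>2)"
    using g(2) by (intro nn_integral_eq_integral) auto
  finally show ?thesis
    by (simp add: ennreal_plus[symmetric] integral_nonneg_AE del: ennreal_plus)
qed

text \<open>Around either pole the other factor is bounded by its value at half the distance of the poles,
  and the remaining singularity is integrable; far from both poles the product is dominated by the
  sum of the two fourth powers. All three contributions scale like the inverse distance.\<close>

lemma nn_integral_riesz_composition:
  fixes a b :: R3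
  assumes "a \<noteq> b"
  shows "(\<integral>\<^sup>+z. ennreal (riesz 2 (z - a) * riesz 2 (z - b)) \<partial>lborel) \<le> ennreal (48 * pi * riesz 1 (a - b))"
proof -
  define \<rho> where "\<rho> = norm (a - b) / 2"
  have \<rho>: "\<rho> > 0" using assms by (simp add: \<rho>_def)
  define hn hf where "hn z = ennreal (riesz 2 z) * indicator (cball 0 \<rho>) z"
    and "hf z = ennreal (riesz 4 z) * indicator (- ball 0 \<rho>) z" for z
  have [measurable]: "hn \<in> borel_measurable borel" "hf \<in> borel_measurable borel"
    unfolding hn_def hf_def by (auto intro!: borel_measurable_times_ennreal borel_measurable_indicator)
  let ?near = "\<lambda>c z. ennreal (1 / \<rho>\<^sup>2) * hn (z - c)"
  let ?far = "\<lambda>c z. hf (z - c)"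
  have far_le: "riesz 2 u \<le> 1 / \<rho>\<^sup>2" if "\<rho> \<le> norm u" for u
    using that \<rho> by (auto simp: riesz_power intro!: divide_left_mono power_mono mult_pos_pos)
  have "(\<integral>\<^sup>+z. ennreal (riesz 2 (z - a) * riesz 2 (z - b)) \<partial>lborel)
      \<le> (\<integral>\<^sup>+z. ?near a z + ?near b z + (?far a z + ?far b z) \<partial>lborel)"
  proof (intro nn_integral_mono)
    fix z
    have tri: "2 * \<rho> \<le> norm (z - a) + norm (z - b)"
      using norm_triangle_ineq4[of "z - b" "z - a"] by (simp add: \<rho>_def)
    show "ennreal (riesz 2 (z - a) * riesz 2 (z - b)) \<le> ?near a z + ?near b z + (?far a z + ?far b z)"
    proof (cases "norm (z - a) \<le> \<rho>")
      case True
      then have "riesz 2 (z - b) \<le> 1 / \<rho>\<^sup>2" using tri by (intro far_le) auto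
      then have "riesz 2 (z - a) * riesz 2 (z - b) \<le> 1 / \<rho>\<^sup>2 * riesz 2 (z - a)"
        by (metis mult.commute mult_left_mono riesz_nonneg)
      then have "ennreal (riesz 2 (z - a) * riesz 2 (z - b)) \<le> ?near a z"
        using True by (simp add: hn_def ennreal_mult'[symmetric] ennreal_leI)
      then show ?thesis by (simp add: add_increasing2 add.assoc)
    next
      case a: False
      show ?thesis
      proof (cases "norm (z - b) \<le> \<rho>")
        case True
        have "riesz 2 (z - a) \<le> 1 / \<rho>\<^sup>2" using a by (intro far_le) auto
        then have "riesz 2 (z - a) * riesz 2 (z - b) \<le> 1 / \<rho>\<^sup>2 * riesz 2 (z - b)"
          by (metis mult_right_mono riesz_nonneg)
        then have "ennreal (riesz 2 (z - a) * riesz 2 (z - b)) \<le> ?near b z"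
          using True by (simp add: hn_def ennreal_mult'[symmetric] ennreal_leI)
        then show ?thesis by (simp add: add_increasing add_increasing2 add.assoc)
      next
        case False
        have "0 \<le> (riesz 2 (z - a) - riesz 2 (z - b))\<^sup>2 + (riesz 2 (z - a))\<^sup>2 + (riesz 2 (z - b))\<^sup>2" by simp
        moreover have "(riesz 2 u)\<^sup>2 = riesz 4 u" for u
          by (simp add: riesz_power power_divide flip: power_mult)
        ultimately have "riesz 2 (z - a) * riesz 2 (z - b) \<le> riesz 4 (z - a) + riesz 4 (z - b)"
          by (simp add: power2_diff)
        then have "ennreal (riesz 2 (z - a) * riesz 2 (z - b)) \<le> ?far a z + ?far b z"
          using a False by (simp add: hf_def ennreal_leI ennreal_plus[symmetric] del: ennreal_plus)
        then show ?thesis by (simp add: add_increasing)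
      qed
    qed
  qed
  also have "\<dots> = (\<integral>\<^sup>+z. ?near a z \<partial>lborel) + (\<integral>\<^sup>+z. ?near b z \<partial>lborel)
      + ((\<integral>\<^sup>+z. ?far a z \<partial>lborel) + (\<integral>\<^sup>+z. ?far b z \<partial>lborel))"
    by (simp add: nn_integral_add)
  also have "\<dots> = ennreal (1 / \<rho>\<^sup>2) * ennreal (4 * pi * \<rho>) + ennreal (1 / \<rho>\<^sup>2) * ennreal (4 * pi * \<rho>)
      + (ennreal (4 * pi / \<rho>) + ennreal (4 * pi / \<rho>))"
  proof -
    have near: "(\<integral>\<^sup>+z. hn (z - c) \<partial>lborel) = ennreal (4 * pi * \<rho>)" for c
      using nn_integral_translate(2)[of hn c]
        nn_integral_riesz_ball[of 2 \<rho>] \<rho> by (simp add: hn_def)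
    have far: "(\<integral>\<^sup>+z. hf (z - c) \<partial>lborel) = ennreal (4 * pi / \<rho>)" for c
      using nn_integral_translate(2)[of hf c]
        nn_integral_riesz_4_outside[of \<rho>] \<rho> by (simp add: hf_def)
    show ?thesis by (simp add: nn_integral_cmult near far)
  qed
  also have "\<dots> = ennreal (16 * pi / \<rho>)"
    using \<rho> by (simp add: ennreal_mult'[symmetric] ennreal_plus[symmetric] power2_eq_square field_simps del: ennreal_plus)
  also have "\<dots> \<le> ennreal (48 * pi * riesz 1 (a - b))"
    using assms by (auto simp: riesz_power \<rho>_def field_simps intro!: ennreal_leI)
  finally show ?thesis .
qed

section \<open>Gradients along lines\<close>

text \<open>Weaker than differentiability everywhere, stronger than weak differentiability: \<open>W\<close> may jump, as
  it does for the positive part of a smooth function.\<close>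

definition line_gradient :: "(R3 \<Rightarrow> real) \<Rightarrow> (R3 \<Rightarrow> R3) \<Rightarrow> bool" where
  "line_gradient F W \<longleftrightarrow>
     (\<forall>x h. F (x + h) - F x = (LINT t|lborel. indicator {0..1} t *\<^sub>R (h \<bullet> W (x + t *\<^sub>R h))))"

text \<open>A non-integrable \<open>f\<close> is covered because its integral is 0 by convention.\<close>

lemma abs_integral_unit_interval_le:
  fixes f :: "real \<Rightarrow> real"
  assumes "\<And>t. t \<in> {0..1} \<Longrightarrow> \<bar>f t\<bar> \<le> B"
  shows "\<bar>LINT t|lborel. indicator {0..1} t *\<^sub>R f t\<bar> \<le> B"
proof (cases "integrable lborel (\<lambda>t. indicator {0..1} t *\<^sub>R f t)")
  case True
  have "\<bar>LINT t|lborel. indicator {0..1} t *\<^sub>R f t\<bar> \<le> (LINT t|lborel. \<bar>indicator {0..1} t *\<^sub>R f t\<bar>)"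
    by (rule integral_abs_bound)
  also have "\<dots> \<le> (LINT t|lborel. indicator {0..1::real} t * B)"
    using True assms by (intro integral_mono) (auto split: split_indicator)
  also have "\<dots> = B" by simp
  finally show ?thesis .
next
  case False
  then show ?thesis using assms[of 0] by (simp add: not_integrable_integral_eq)
qed

lemma integral_along_segment:
  fixes F :: "R3 \<Rightarrow> real" and W :: "R3 \<Rightarrow> R3"
  assumes "\<And>t. t \<in> {0..1} \<Longrightarrow> (F has_derivative (\<lambda>k. k \<bullet> W (x + t *\<^sub>R h))) (at (x + t *\<^sub>R h))"
    and "continuous_on {0..1} (\<lambda>t. W (x + t *\<^sub>R h))"
  shows "(LINT t|lborel. indicator {0..1} t *\<^sub>R (h \<bullet> W (x + t *\<^sub>R h))) = F (x + h) - F x"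
proof -
  have "((\<lambda>t. F (x + t *\<^sub>R h)) has_vector_derivative h \<bullet> W (x + t *\<^sub>R h)) (at t within {0..1})"
    if "t \<in> {0..1}" for t
  proof -
    have "((\<lambda>t. x + t *\<^sub>R h) has_derivative (\<lambda>s. s *\<^sub>R h)) (at t within {0..1})"
      by (auto intro!: derivative_eq_intros)
    from has_derivative_compose[OF this assms(1)[OF that]]
    show ?thesis by (simp add: has_vector_derivative_def)
  qed
  moreover have "continuous_on {0..1} (\<lambda>t. h \<bullet> W (x + t *\<^sub>R h))"
    by (intro continuous_intros assms(2))
  ultimately have "(LINT t|lborel. indicator {0..1} t *\<^sub>R (h \<bullet> W (x + t *\<^sub>R h)))
      = F (x + 1 *\<^sub>R h) - F (x + 0 *\<^sub>R h)"
    by (intro integral_FTC_atLeastAtMost) auto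
  then show ?thesis by simp
qed

lemma line_gradientI:
  assumes "\<And>x. (F has_derivative (\<lambda>k. k \<bullet> W x)) (at x)" and "continuous_on UNIV W"
  shows "line_gradient F W"
  unfolding line_gradient_def
  by (intro allI integral_along_segment[symmetric] assms(1) continuous_on_compose2[OF assms(2)])
    (auto intro!: continuous_intros)

lemma line_gradient_has_derivative:
  assumes "line_gradient F W" and "continuous_on UNIV W"
  shows "(F has_derivative (\<lambda>k. k \<bullet> W x)) (at x)"
  unfolding has_derivative_at_alt
proof (intro conjI allI impI)
  show "bounded_linear (\<lambda>k. k \<bullet> W x)" by (rule bounded_linear_inner_left)
  fix e :: real assume "e > 0"
  moreover have "isCont W x" using assms(2) by (simp add: continuous_on_eq_continuous_at)
  ultimately obtain d where d: "d > 0" "\<And>y. norm (y - x) < d \<Longrightarrow> norm (W y - W x) < e"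
    unfolding continuous_at_eps_delta by (metis dist_norm)
  have "norm (F y - F x - (y - x) \<bullet> W x) \<le> e * norm (y - x)" if y: "norm (y - x) < d" for y
  proof -
    define h where "h = y - x"
    have int: "integrable lborel (\<lambda>t. indicator {0..1} t *\<^sub>R (h \<bullet> W (x + t *\<^sub>R h)))"
    proof -
      have "continuous_on {0..1} (\<lambda>t. h \<bullet> W (x + t *\<^sub>R h))"
        by (intro continuous_intros continuous_on_compose2[OF assms(2)]) auto
      from borel_integrable_atLeastAtMost'[OF this] show ?thesis
        unfolding set_integrable_def .
    qed
    have "F y - F x - h \<bullet> W x = (LINT t|lborel. indicator {0..1} t *\<^sub>R (h \<bullet> W (x + t *\<^sub>R h)))
        - (LINT t|lborel. indicator {0..1::real} t *\<^sub>R (h \<bullet> W x))"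
      using assms(1)[unfolded line_gradient_def, rule_format, of x h] by (simp add: h_def)
    also have "\<dots> = (LINT t|lborel. indicator {0..1} t *\<^sub>R (h \<bullet> (W (x + t *\<^sub>R h) - W x)))"
      by (subst Bochner_Integration.integral_diff[symmetric, OF int])
        (simp_all add: inner_diff_right right_diff_distrib)
    finally have "\<bar>F y - F x - h \<bullet> W x\<bar> = \<bar>LINT t|lborel. indicator {0..1} t *\<^sub>R (h \<bullet> (W (x + t *\<^sub>R h) - W x))\<bar>"
      by simp
    also have "\<dots> \<le> e * norm h"
    proof (rule abs_integral_unit_interval_le)
      fix t :: real assume t: "t \<in> {0..1}"
      have "norm (t *\<^sub>R h) \<le> norm h" using t by (simp add: mult_left_le_one_le)
      then have "norm (W (x + t *\<^sub>R h) - W x) \<le> e"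
        using d(2)[of "x + t *\<^sub>R h"] y by (simp add: h_def)
      then have "norm h * norm (W (x + t *\<^sub>R h) - W x) \<le> e * norm h"
        by (subst mult.commute) (simp add: mult_right_mono)
      then show "\<bar>h \<bullet> (W (x + t *\<^sub>R h) - W x)\<bar> \<le> e * norm h"
        using Cauchy_Schwarz_ineq2[of h "W (x + t *\<^sub>R h) - W x"] by linarith
    qed
    finally show ?thesis by (simp add: h_def)
  qed
  then show "\<exists>d>0. \<forall>y. norm (y - x) < d \<longrightarrow> norm (F y - F x - (y - x) \<bullet> W x) \<le> e * norm (y - x)"
    using d(1) by blast
qed

lemma line_gradient_Lipschitz:
  assumes "line_gradient F W" "\<And>x. norm (W x) \<le> L"
  shows "\<bar>F y - F x\<bar> \<le> L * norm (y - x)"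
proof -
  have "\<bar>LINT t|lborel. indicator {0..1} t *\<^sub>R ((y - x) \<bullet> W (x + t *\<^sub>R (y - x)))\<bar> \<le> L * norm (y - x)"
  proof (rule abs_integral_unit_interval_le)
    fix t :: real
    have "norm (y - x) * norm (W (x + t *\<^sub>R (y - x))) \<le> L * norm (y - x)"
      using assms(2)[of "x + t *\<^sub>R (y - x)"] by (subst mult.commute) (simp add: mult_right_mono)
    then show "\<bar>(y - x) \<bullet> W (x + t *\<^sub>R (y - x))\<bar> \<le> L * norm (y - x)"
      using Cauchy_Schwarz_ineq2[of "y - x" "W (x + t *\<^sub>R (y - x))"] by linarith
  qed
  then show ?thesis
    using assms(1)[unfolded line_gradient_def, rule_format, of x "y - x"] by simp
qed

subsection \<open>The positive part\<close>

text \<open>For \<open>s > 0\<close> this is \<open>s\<^sup>2 / (s + \<delta>)\<close>. The one-sided choice matters: the slope is 0 on the whole zero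
  set of the argument, which is the value that the positive part needs there.\<close>

definition soft_pos :: "real \<Rightarrow> real \<Rightarrow> real" where
  "soft_pos \<delta> s = (if s \<le> 0 then 0 else s - \<delta> + \<delta>\<^sup>2 / (s + \<delta>))"

definition soft_pos' :: "real \<Rightarrow> real \<Rightarrow> real" where
  "soft_pos' \<delta> s = (if s \<le> 0 then 0 else 1 - \<delta>\<^sup>2 / (s + \<delta>)\<^sup>2)"

lemma soft_pos_deriv:
  assumes "\<delta> > 0"
  shows "(soft_pos \<delta> has_real_derivative soft_pos' \<delta> s) (at s)"
proof -
  consider "s < 0" | "s > 0" | "s = 0" by linarith
  then show ?thesis
  proof cases
    case 1
    have "((\<lambda>_. 0::real) has_real_derivative 0) (at s)" by simp
    then have "(soft_pos \<delta> has_real_derivative 0) (at s)"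
      by (rule has_field_derivative_transform_within_open[of _ _ _ "{..<0}"])
        (use 1 in \<open>auto simp: soft_pos_def\<close>)
    with 1 show ?thesis by (simp add: soft_pos'_def)
  next
    case 2
    have "((\<lambda>s. s - \<delta> + \<delta>\<^sup>2 / (s + \<delta>)) has_real_derivative (1 - \<delta>\<^sup>2 / (s + \<delta>)\<^sup>2)) (at s)"
      using 2 assms by (auto intro!: derivative_eq_intros simp: power2_eq_square)
    then have "(soft_pos \<delta> has_real_derivative (1 - \<delta>\<^sup>2 / (s + \<delta>)\<^sup>2)) (at s)"
      by (rule has_field_derivative_transform_within_open[of _ _ _ "{0<..}"])
        (use 2 in \<open>auto simp: soft_pos_def\<close>)
    with 2 show ?thesis by (simp add: soft_pos'_def)
  next
    case 3
    have bound: "\<bar>soft_pos \<delta> h / h\<bar> \<le> \<bar>h\<bar> / \<delta>" for h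
    proof (cases "h > 0")
      case True
      have "soft_pos \<delta> h = h\<^sup>2 / (h + \<delta>)"
        using True assms by (simp add: soft_pos_def field_simps power2_eq_square)
      then have "soft_pos \<delta> h / h = h / (h + \<delta>)" using True by (simp add: power2_eq_square)
      moreover have "h / (h + \<delta>) \<le> h / \<delta>" using True assms by (intro divide_left_mono) auto
      ultimately show ?thesis using True assms by (simp add: abs_of_pos)
    next
      case False
      then show ?thesis using assms by (simp add: soft_pos_def divide_le_0_iff)
    qed
    have lim: "((\<lambda>h::real. \<bar>h\<bar> / \<delta>) \<longlongrightarrow> 0) (at 0)"
      using assms by (auto intro!: tendsto_eq_intros)
    have "((\<lambda>h. soft_pos \<delta> h / h) \<longlongrightarrow> 0) (at 0)"
      by (rule Lim_null_comparison[OF _ lim]) (use bound in auto)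
    then show ?thesis using 3 by (simp add: DERIV_def soft_pos_def soft_pos'_def)
  qed
qed

lemma continuous_on_soft_pos':
  assumes "\<delta> > 0" shows "continuous_on UNIV (soft_pos' \<delta>)"
proof -
  have "soft_pos' \<delta> = (\<lambda>s. 1 - \<delta>\<^sup>2 / (max 0 s + \<delta>)\<^sup>2)"
    using assms by (auto simp: soft_pos'_def fun_eq_iff)
  then show ?thesis
    using assms by (auto intro!: continuous_intros )
qed

lemma soft_pos'_range: "\<delta> > 0 \<Longrightarrow> 0 \<le> soft_pos' \<delta> s \<and> soft_pos' \<delta> s \<le> 1"
  by (auto simp: soft_pos'_def divide_le_eq_1 intro!: power_mono)

text \<open>The fundamental theorem for the smoothed positive parts of \<open>g\<close>, followed by dominated convergence as
  the smoothing is removed.\<close>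

lemma pos_part_FTC:
  fixes g g' :: "real \<Rightarrow> real"
  assumes g: "\<And>t. t \<in> {0..1} \<Longrightarrow> (g has_real_derivative g' t) (at t within {0..1})"
    and g': "continuous_on {0..1} g'"
  shows "(LINT t|lborel. indicator {0..1} t *\<^sub>R (if g t > 0 then g' t else 0)) = max 0 (g 1) - max 0 (g 0)"
proof -
  define \<delta> where "\<delta> n = 1 / real (Suc n)" for n
  have \<delta>: "\<delta> n > 0" for n by (simp add: \<delta>_def)
  have \<delta>0: "\<delta> \<longlonglongrightarrow> 0" unfolding \<delta>_def using LIMSEQ_inverse_real_of_nat by (simp add: divide_inverse)
  have contg: "continuous_on {0..1} g"
    using g by (meson DERIV_continuous continuous_on_eq_continuous_within)
  have ftc: "(LINT t|lborel. indicator {0..1} t *\<^sub>R (soft_pos' (\<delta> n) (g t) * g' t))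
      = soft_pos (\<delta> n) (g 1) - soft_pos (\<delta> n) (g 0)" for n
  proof (rule integral_FTC_atLeastAtMost)
    fix t :: real assume "0 \<le> t" "t \<le> 1"
    then show "((\<lambda>t. soft_pos (\<delta> n) (g t)) has_vector_derivative soft_pos' (\<delta> n) (g t) * g' t) (at t within {0..1})"
      using DERIV_chain2[OF soft_pos_deriv[OF \<delta>] g[of t]]
      by (simp add: has_real_derivative_iff_has_vector_derivative)
  next
    show "continuous_on {0..1} (\<lambda>t. soft_pos' (\<delta> n) (g t) * g' t)"
      by (intro continuous_intros g' continuous_on_compose2[OF continuous_on_soft_pos'[OF \<delta>] contg]) auto
  qed simp
  have lim_pos: "(\<lambda>n. soft_pos (\<delta> n) s) \<longlonglongrightarrow> max 0 s" for s
  proof (cases "s > 0")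
    case True
    have "(\<lambda>n. s - \<delta> n + (\<delta> n)\<^sup>2 / (s + \<delta> n)) \<longlonglongrightarrow> s - 0 + 0\<^sup>2 / (s + 0)"
      using True by (intro tendsto_intros \<delta>0) auto
    with True show ?thesis by (simp add: soft_pos_def)
  qed (simp add: soft_pos_def max_def)
  have lim_pos': "(\<lambda>n. soft_pos' (\<delta> n) s) \<longlonglongrightarrow> (if s > 0 then 1 else 0)" for s
  proof (cases "s > 0")
    case True
    have "(\<lambda>n. 1 - (\<delta> n)\<^sup>2 / (s + \<delta> n)\<^sup>2) \<longlonglongrightarrow> 1 - 0\<^sup>2 / (s + 0)\<^sup>2"
      using True by (intro tendsto_intros \<delta>0) auto
    with True show ?thesis by (simp add: soft_pos'_def)
  qed (simp add: soft_pos'_def)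
  have "bounded (g' ` {0..1})"
    using compact_continuous_image[OF g'] compact_imp_bounded by blast
  then obtain B where B: "\<And>t. t \<in> {0..1} \<Longrightarrow> \<bar>g' t\<bar> \<le> B"
    unfolding bounded_iff by (metis imageI real_norm_def)
  have mg': "(\<lambda>t. indicator {0..1} t *\<^sub>R g' t) \<in> borel_measurable lborel"
    using borel_measurable_continuous_on_indicator[OF _ g'] by simp
  have mg: "(\<lambda>t. indicator {0..1} t *\<^sub>R g t) \<in> borel_measurable lborel"
    using borel_measurable_continuous_on_indicator[OF _ contg] by simp
  have mlim: "(\<lambda>t. indicator {0..1} t *\<^sub>R (if g t > 0 then g' t else 0)) \<in> borel_measurable lborel"
  proof -
    have "(\<lambda>t. indicator {0..1} t *\<^sub>R (if g t > 0 then g' t else 0))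
        = (\<lambda>t. if indicator {0..1} t *\<^sub>R g t > 0 then indicator {0..1} t *\<^sub>R g' t else 0)"
      by (auto simp: fun_eq_iff split: split_indicator)
    also have "\<dots> \<in> borel_measurable lborel"
      using mg mg' by (intro measurable_If) (simp_all add: borel_measurable_less)
    finally show ?thesis .
  qed
  have "(\<lambda>n. LINT t|lborel. indicator {0..1} t *\<^sub>R (soft_pos' (\<delta> n) (g t) * g' t))
     \<longlonglongrightarrow> (LINT t|lborel. indicator {0..1} t *\<^sub>R (if g t > 0 then g' t else 0))"
  proof (rule integral_dominated_convergence[where w = "\<lambda>t. indicator {0..1} t * B"])
    show "integrable lborel (\<lambda>t::real. indicator {0..1} t * B :: real)" by (intro integrable_mult_left integrable_real_indicator) auto
    show "(\<lambda>t. indicator {0..1} t *\<^sub>R (soft_pos' (\<delta> n) (g t) * g' t)) \<in> borel_measurable lborel" for n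
    proof -
      have "continuous_on {0..1} (\<lambda>t. soft_pos' (\<delta> n) (g t) * g' t)"
        by (intro continuous_intros g' continuous_on_compose2[OF continuous_on_soft_pos'[OF \<delta>] contg]) auto
      from borel_measurable_continuous_on_indicator[OF _ this] show ?thesis by simp
    qed
    show "AE t in lborel. norm (indicator {0..1} t *\<^sub>R (soft_pos' (\<delta> n) (g t) * g' t)) \<le> indicator {0..1} t * B" for n
    proof (intro always_eventually allI)
      fix t
      have "\<bar>soft_pos' (\<delta> n) (g t)\<bar> * \<bar>g' t\<bar> \<le> 1 * B" if "t \<in> {0..1}"
        using soft_pos'_range[OF \<delta>, of n "g t"] B[OF that] by (intro mult_mono) auto
      then show "norm (indicator {0..1} t *\<^sub>R (soft_pos' (\<delta> n) (g t) * g' t)) \<le> indicator {0..1} t * B"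
        by (auto split: split_indicator simp: abs_mult)
    qed
    show "AE t in lborel. (\<lambda>n. indicator {0..1} t *\<^sub>R (soft_pos' (\<delta> n) (g t) * g' t))
        \<longlonglongrightarrow> indicator {0..1} t *\<^sub>R (if g t > 0 then g' t else 0)"
    proof (intro always_eventually allI)
      fix t
      have "(\<lambda>n. soft_pos' (\<delta> n) (g t) * g' t) \<longlonglongrightarrow> (if g t > 0 then 1 else 0) * g' t"
        by (intro tendsto_mult lim_pos' tendsto_const)
      then show "(\<lambda>n. indicator {0..1} t *\<^sub>R (soft_pos' (\<delta> n) (g t) * g' t))
        \<longlonglongrightarrow> indicator {0..1} t *\<^sub>R (if g t > 0 then g' t else 0)"
        by (auto split: split_indicator if_splits intro!: tendsto_scaleR)
    qed
  qed (use mlim in simp_all)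
  moreover have "(\<lambda>n. LINT t|lborel. indicator {0..1} t *\<^sub>R (soft_pos' (\<delta> n) (g t) * g' t)) \<longlonglongrightarrow> max 0 (g 1) - max 0 (g 0)"
    unfolding ftc by (intro tendsto_intros lim_pos)
  ultimately show ?thesis by (rule LIMSEQ_unique)
qed

lemma line_gradient_pos_part:
  assumes w: "\<And>x. (w has_derivative (\<lambda>k. k \<bullet> W x)) (at x)" and W: "continuous_on UNIV W"
  shows "line_gradient (\<lambda>x. max 0 (w x)) (\<lambda>x. if w x > 0 then W x else 0)"
  unfolding line_gradient_def
proof (intro allI)
  fix x h :: R3
  have "((\<lambda>t. w (x + t *\<^sub>R h)) has_real_derivative h \<bullet> W (x + t *\<^sub>R h)) (at t within {0..1})" for t
  proof -
    have "((\<lambda>t. x + t *\<^sub>R h) has_derivative (\<lambda>s. s *\<^sub>R h)) (at t within {0..1})"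
      by (auto intro!: derivative_eq_intros)
    from has_derivative_compose[OF this w]
    show ?thesis by (simp add: has_field_derivative_def mult_commute_abs)
  qed
  moreover have "continuous_on {0..1} (\<lambda>t. h \<bullet> W (x + t *\<^sub>R h))"
    by (auto intro!: continuous_intros continuous_on_compose2[OF W])
  ultimately have "(LINT t|lborel. indicator {0..1} t *\<^sub>R (if w (x + t *\<^sub>R h) > 0 then h \<bullet> W (x + t *\<^sub>R h) else 0))
      = max 0 (w (x + 1 *\<^sub>R h)) - max 0 (w (x + 0 *\<^sub>R h))"
    by (rule pos_part_FTC)
  then show "max 0 (w (x + h)) - max 0 (w x)
      = (LINT t|lborel. indicator {0..1} t *\<^sub>R (h \<bullet> (if w (x + t *\<^sub>R h) > 0 then W (x + t *\<^sub>R h) else 0)))"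
    by (simp add: if_distrib cong: if_cong)
qed

section \<open>The Newtonian kernel\<close>

text \<open>The gradient of \<open>newton\<close> away from the origin.\<close>

definition newton_grad :: "R3 \<Rightarrow> R3" where
  "newton_grad z = (- 1 / (4 * pi * norm z ^ 3)) *\<^sub>R z"

lemma borel_measurable_newton [measurable]: "newton \<in> borel_measurable borel"
  unfolding newton_def by measurable

lemma borel_measurable_newton_grad [measurable]: "newton_grad \<in> borel_measurable borel"
  unfolding newton_grad_def by measurable

lemma newton_riesz: "newton z = riesz 1 z / (4 * pi)"
  by (simp add: newton_def riesz_power)

lemma norm_newton_grad: "norm (newton_grad z) = riesz 2 z / (4 * pi)"
  by (cases "z = 0") (simp_all add: newton_grad_def riesz_power power3_eq_cube power2_eq_square)

lemma newton_minus_commute: "newton (x - y) = newton (y - x)"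
  by (simp add: newton_def norm_minus_commute)

lemma newton_has_derivative:
  assumes "z \<noteq> 0"
  shows "(newton has_derivative (\<lambda>k. k \<bullet> newton_grad z)) (at z)"
proof -
  have "((\<lambda>z. inverse (norm z)) has_derivative (\<lambda>k. - (inverse (norm z) * (k \<bullet> sgn z) * inverse (norm z)))) (at z)"
    using assms by (intro Deriv.has_derivative_inverse has_derivative_norm) auto
  then have "((\<lambda>z. (1 / (4 * pi)) * inverse (norm z)) has_derivative
      (\<lambda>k. (1 / (4 * pi)) * - (inverse (norm z) * (k \<bullet> sgn z) * inverse (norm z)))) (at z)"
    by (rule has_derivative_mult_right)
  moreover have "(\<lambda>z. (1 / (4 * pi)) * inverse (norm z)) = newton"
    by (auto simp: newton_def fun_eq_iff field_simps)
  moreover have "(1 / (4 * pi)) * - (inverse (norm z) * (k \<bullet> sgn z) * inverse (norm z)) = k \<bullet> newton_grad z" for k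
    using assms by (simp add: newton_grad_def sgn_div_norm field_simps power3_eq_cube)
  ultimately show ?thesis by simp
qed

lemma continuous_on_newton_grad: "continuous_on (- {0}) newton_grad"
  unfolding newton_grad_def by (intro continuous_intros) auto

lemma newton_along_segment:
  assumes "\<And>t. t \<in> {0..1} \<Longrightarrow> x + t *\<^sub>R h \<noteq> 0"
  shows "(LINT t|lborel. indicator {0..1} t *\<^sub>R (h \<bullet> newton_grad (x + t *\<^sub>R h))) = newton (x + h) - newton x"
  by (intro integral_along_segment newton_has_derivative assms
      continuous_on_compose2[OF continuous_on_newton_grad]) (use assms in \<open>auto intro!: continuous_intros\<close>)

lemma AE_not_on_affine_line: "AE x::R3 in lborel. \<forall>t. x \<noteq> y + t *\<^sub>R h"
proof -
  have "dim {h} \<le> card {h}" by (rule dim_le_card') simp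
  then have "dim (span {h}) < DIM(R3)" by simp
  then have "negligible ((+) y ` span {h})" by (intro negligible_translation negligible_lowdim)
  then have "(+) y ` span {h} \<in> null_sets lborel"
    by (simp add: negligible_iff_null_sets null_sets_completion_iff closed_span borel_closed closed_translation)
  then have "AE x in lborel. x \<notin> (+) y ` span {h}" by (rule AE_not_in)
  then show ?thesis
    by eventually_elim (auto simp: span_singleton)
qed

section \<open>Test functions and weak gradients\<close>

lemma has_derivative_grad:
  assumes "f differentiable (at x)"
  shows "(f has_derivative (\<lambda>h. h \<bullet> grad f x)) (at x)"
proof -
  let ?D = "frechet_derivative f (at x)"
  have D: "(f has_derivative ?D) (at x)" using assms by (simp add: frechet_derivative_works)
  then have lin: "linear ?D" by (rule has_derivative_linear)
  have "?D h = h \<bullet> grad f x" for h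
  proof -
    have "?D h = ?D (\<Sum>i\<in>UNIV. (h $ i) *\<^sub>R axis i 1)"
      using basis_expansion[of h] by (simp add: scalar_mult_eq_scaleR)
    also have "\<dots> = (\<Sum>i\<in>UNIV. h $ i * ?D (axis i 1))"
      by (simp add: linear_sum[OF lin] linear_scale[OF lin])
    also have "\<dots> = h \<bullet> grad f x" by (simp add: inner_vec_def grad_def pd_def)
    finally show ?thesis .
  qed
  then have "?D = (\<lambda>h. h \<bullet> grad f x)" by auto
  with D show ?thesis by simp
qed

lemma pd_eqI:
  assumes "(f has_derivative (\<lambda>h. h \<bullet> w)) (at x)"
  shows "pd i f x = w $ i"
  using frechet_derivative_at[OF assms, symmetric]
  by (simp add: pd_def inner_axis' )

lemma grad_eqI:
  assumes "(f has_derivative (\<lambda>h. h \<bullet> w)) (at x)"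
  shows "grad f x = w"
  by (simp add: grad_def pd_eqI[OF assms] vec_eq_iff)

lemma Ck_Suc_imp: "Ck (Suc k) f \<Longrightarrow> Ck k f"
proof (induction k arbitrary: f)
  case 0
  then show ?case
    by (auto simp: continuous_on_eq_continuous_at differentiable_imp_continuous_within)
next
  case (Suc k)
  then show ?case by (metis Ck.simps(2))
qed

lemma Ck_Suc_continuous_grad:
  assumes "Ck (Suc k) f" shows "continuous_on UNIV (grad f)"
proof -
  have "Ck 0 g" if "Ck k g" for g
    using that
  proof (induction k)
    case (Suc k)
    from Ck_Suc_imp[OF Suc.prems] show ?case by (rule Suc.IH)
  qed
  with assms have "continuous_on UNIV (pd i f)" for i by auto
  then show ?thesis unfolding grad_def
    by (intro continuous_on_vec_lambda)
qed

lemma pd_const [simp]: "pd i (\<lambda>_. c) = (\<lambda>_. 0)"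
  by (simp add: pd_def fun_eq_iff frechet_derivative_const)

lemma Ck_const [simp]: "Ck k (\<lambda>_. c)"
  by (induction k arbitrary: c) auto

lemma Ck_add: "Ck k f \<Longrightarrow> Ck k g \<Longrightarrow> Ck k (\<lambda>x. f x + g x)"
proof (induction k arbitrary: f g)
  case 0 then show ?case by (auto intro: continuous_on_add)
next
  case (Suc k)
  have "pd i (\<lambda>x. f x + g x) = (\<lambda>x. pd i f x + pd i g x)" for i
  proof
    fix x
    have "((\<lambda>x. f x + g x) has_derivative (\<lambda>h. h \<bullet> (grad f x + grad g x))) (at x)"
      using Suc.prems by (auto intro!: derivative_eq_intros has_derivative_grad simp: inner_add_right)
    from pd_eqI[OF this] show "pd i (\<lambda>x. f x + g x) x = pd i f x + pd i g x"
      by (simp add: grad_def)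
  qed
  with Suc show ?case by (auto intro: derivative_intros)
qed

lemma Ck_mult: "Ck k f \<Longrightarrow> Ck k g \<Longrightarrow> Ck k (\<lambda>x. f x * g x)"
proof (induction k arbitrary: f g)
  case 0 then show ?case by (auto intro: continuous_on_mult)
next
  case (Suc k)
  have "pd i (\<lambda>x. f x * g x) = (\<lambda>x. f x * pd i g x + pd i f x * g x)" for i
  proof
    fix x
    have "((\<lambda>x. f x * g x) has_derivative (\<lambda>h. h \<bullet> (f x *\<^sub>R grad g x + g x *\<^sub>R grad f x))) (at x)"
      using Suc.prems by (auto intro!: derivative_eq_intros has_derivative_grad simp: inner_add_right)
    from pd_eqI[OF this] show "pd i (\<lambda>x. f x * g x) x = f x * pd i g x + pd i f x * g x"
      by (simp add: grad_def)
  qed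
  moreover have "Ck k f" "Ck k g" using Suc.prems Ck_Suc_imp by blast+
  ultimately show ?case using Suc by (auto intro!: derivative_intros Ck_add)
qed

lemma Ck_diff: "Ck k f \<Longrightarrow> Ck k g \<Longrightarrow> Ck k (\<lambda>x. f x - g x)"
  using Ck_add[OF _ Ck_mult[OF Ck_const[of k "-1"]], of f g] by simp

lemma Ck_power: "Ck k f \<Longrightarrow> Ck k (\<lambda>x. f x ^ n)"
  by (induction n) (auto intro: Ck_mult)

lemma Ck_prod: "finite I \<Longrightarrow> (\<And>i. i \<in> I \<Longrightarrow> Ck k (f i)) \<Longrightarrow> Ck k (\<lambda>x. \<Prod>i\<in>I. f i x)"
  by (induction I rule: finite_induct) (auto intro: Ck_mult)

subsection \<open>Smooth bumps on boxes\<close>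

text \<open>The family is closed under differentiation, so all its members are smooth.\<close>

definition flat_exp :: "real poly \<Rightarrow> real \<Rightarrow> real" where
  "flat_exp p t = (if t > 0 then poly p (1 / t) * exp (- (1 / t)) else 0)"

text \<open>Flatness at the origin, in the variable \<open>s = 1/t\<close>.\<close>

lemma poly_div_exp_tendsto_0: "((\<lambda>s. poly p s * exp (- s)) \<longlongrightarrow> (0::real)) at_top"
proof -
  have "((\<lambda>s. \<Sum>i\<le>degree p. coeff p i * (s ^ i / exp s)) \<longlongrightarrow> (\<Sum>i\<le>degree p. coeff p i * 0)) at_top"
    by (intro tendsto_intros tendsto_power_div_exp_0)
  then show ?thesis
    by (simp add: poly_altdef sum_distrib_right exp_minus divide_inverse mult.assoc)
qed

lemma flat_exp_deriv:
  "(flat_exp p has_real_derivative flat_exp ([:0, 0, 1:] * (p - pderiv p)) t) (at t)"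
proof -
  consider "t < 0" | "t > 0" | "t = 0" by linarith
  then show ?thesis
  proof cases
    case 1
    have "((\<lambda>_. 0::real) has_real_derivative 0) (at t)" by simp
    then have "(flat_exp p has_real_derivative 0) (at t)"
      by (rule has_field_derivative_transform_within_open[of _ _ _ "{..<0}"])
        (use 1 in \<open>auto simp: flat_exp_def\<close>)
    with 1 show ?thesis by (simp add: flat_exp_def)
  next
    case 2
    have "((\<lambda>t. poly p (1 / t) * exp (- (1 / t))) has_real_derivative
        flat_exp ([:0, 0, 1:] * (p - pderiv p)) t) (at t)"
      using 2 by (auto intro!: derivative_eq_intros DERIV_chain2[OF poly_DERIV]
          simp: flat_exp_def field_simps power2_eq_square)
    then show ?thesis
      by (rule has_field_derivative_transform_within_open[of _ _ _ "{0<..}"])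
        (use 2 in \<open>auto simp: flat_exp_def\<close>)
  next
    case 3
    have "((\<lambda>h. poly (pCons 0 p) (inverse h) * exp (- inverse h)) \<longlongrightarrow> 0) (at_right 0)"
      by (rule filterlim_compose[OF poly_div_exp_tendsto_0 filterlim_inverse_at_top_right])
    then have "((\<lambda>h. flat_exp p h / h) \<longlongrightarrow> 0) (at_right 0)"
      by (rule Lim_transform_eventually)
        (auto simp: eventually_at_right_less flat_exp_def field_simps intro!: eventually_at_rightI[of 0 1])
    moreover have "((\<lambda>h. flat_exp p h / h) \<longlongrightarrow> 0) (at_left 0)"
      by (rule Lim_transform_eventually[OF tendsto_const])
        (auto simp: flat_exp_def intro!: eventually_at_leftI[of "-1"])
    ultimately have "((\<lambda>h. flat_exp p h / h) \<longlongrightarrow> 0) (at 0)"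
      by (simp add: filterlim_split_at)
    then show ?thesis using 3 by (simp add: DERIV_def flat_exp_def)
  qed
qed

lemma Ck_flat_exp: "Ck k (\<lambda>x. c * flat_exp p (s * x $ i + d))"
proof (induction k arbitrary: c p)
  case 0
  have "continuous_on UNIV (flat_exp p)"
    using flat_exp_deriv DERIV_isCont continuous_at_imp_continuous_on by blast
  then show ?case
    by (auto intro!: continuous_intros continuous_on_compose2[of UNIV "flat_exp p"])
next
  case (Suc k)
  let ?q = "[:0, 0, 1:] * (p - pderiv p)"
  have der: "((\<lambda>x. c * flat_exp p (s * x $ i + d)) has_derivative
      (\<lambda>h. h \<bullet> ((c * s * flat_exp ?q (s * x $ i + d)) *\<^sub>R axis i 1))) (at x)" for x
  proof -
    have "((\<lambda>x::R3. s * x $ i + d) has_derivative (\<lambda>h. s * h $ i)) (at x)"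
      by (intro has_derivative_add_const has_derivative_mult_right
          bounded_linear_imp_has_derivative[OF bounded_linear_vec_nth])
    from has_derivative_compose[OF this flat_exp_deriv[unfolded has_field_derivative_def]]
    have "((\<lambda>x. c * flat_exp p (s * x $ i + d)) has_derivative
        (\<lambda>h. c * (flat_exp ?q (s * x $ i + d) * (s * h $ i)))) (at x)"
      by (rule has_derivative_mult_right)
    then show ?thesis by (simp add: inner_axis mult_ac)
  qed
  have "pd j (\<lambda>x. c * flat_exp p (s * x $ i + d))
      = (\<lambda>x. (if i = j then c * s else 0) * flat_exp ?q (s * x $ i + d))" for j
    by (rule ext, subst pd_eqI[OF der]) (auto simp: axis_def)
  then show ?case
    using Suc differentiableI[OF der] by simp
qed

definition box_bump :: "R3 \<Rightarrow> R3 \<Rightarrow> R3 \<Rightarrow> real" where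
  "box_bump a b x = (\<Prod>i\<in>UNIV. flat_exp 1 (1 * x $ i + - a $ i) * flat_exp 1 (- 1 * x $ i + b $ i))"

lemma flat_exp_1: "0 \<le> flat_exp 1 t" "flat_exp 1 t \<le> 1" "flat_exp 1 t > 0 \<longleftrightarrow> t > 0"
  by (auto simp: flat_exp_def)

lemma box_bump_range: "0 \<le> box_bump a b x" "box_bump a b x \<le> 1"
  unfolding box_bump_def by (auto intro!: prod_nonneg prod_le_1 mult_nonneg_nonneg mult_le_one flat_exp_1)

lemma box_bump_pos: "box_bump a b x > 0 \<longleftrightarrow> x \<in> box a b"
proof
  assume "x \<in> box a b"
  then show "box_bump a b x > 0"
    unfolding box_bump_def by (intro prod_pos) (auto simp: mem_box_cart flat_exp_1)
next
  assume pos: "box_bump a b x > 0"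
  show "x \<in> box a b"
  proof (rule ccontr)
    assume "x \<notin> box a b"
    then obtain i where "\<not> (a $ i < x $ i \<and> x $ i < b $ i)" by (auto simp: mem_box_cart)
    then have "flat_exp 1 (1 * x $ i + - a $ i) * flat_exp 1 (- 1 * x $ i + b $ i) = 0"
      by (auto simp: flat_exp_def)
    then have "box_bump a b x = 0" unfolding box_bump_def by (intro prod_zero) auto
    with pos show False by simp
  qed
qed

lemma Ck_box_bump: "Ck k (box_bump a b)"
proof -
  have "Ck k (\<lambda>x. flat_exp 1 (1 * x $ i + - a $ i) * flat_exp 1 (- 1 * x $ i + b $ i))" for i
    using Ck_flat_exp[of k 1 1 1 i "- a $ i"] Ck_flat_exp[of k 1 1 "-1" i "b $ i"] by (intro Ck_mult) auto
  then show ?thesis unfolding box_bump_def by (intro Ck_prod) auto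
qed

text \<open>The powers push the bump up to the indicator of the box without enlarging its support.\<close>

definition box_approx :: "R3 \<Rightarrow> R3 \<Rightarrow> nat \<Rightarrow> R3 \<Rightarrow> real" where
  "box_approx a b n x = 1 - (1 - box_bump a b x) ^ n"

lemma box_approx_outside: "x \<notin> box a b \<Longrightarrow> box_approx a b n x = 0"
  using box_bump_pos[of a b x] box_bump_range(1)[of a b x] by (simp add: box_approx_def)

lemma abs_box_approx_le: "\<bar>box_approx a b n x\<bar> \<le> indicator (box a b) x"
proof (cases "x \<in> box a b")
  case True
  have "0 \<le> (1 - box_bump a b x) ^ n" "(1 - box_bump a b x) ^ n \<le> 1"
    using box_bump_range[of a b x] by (auto intro: power_le_one)
  with True show ?thesis by (simp add: box_approx_def)
qed (simp add: box_approx_outside)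

lemma test_function_box_approx: "test_function (box_approx a b n)"
  unfolding test_function_def
proof (intro conjI allI)
  fix k
  have "Ck k (\<lambda>x. 1 - (1 - box_bump a b x) ^ n)"
    by (intro Ck_diff Ck_power Ck_const) (rule Ck_box_bump)
  then show "Ck k (box_approx a b n)" by (simp add: box_approx_def[abs_def])
  have "{x. box_approx a b n x \<noteq> 0} \<subseteq> box a b" using box_approx_outside by blast
  then have "bounded {x. box_approx a b n x \<noteq> 0}" using bounded_box bounded_subset by blast
  then show "compact_support (box_approx a b n)" unfolding compact_support_def by (simp add: compact_closure)
qed

lemma box_approx_tendsto: "(\<lambda>n. box_approx a b n x) \<longlonglongrightarrow> indicator (box a b) x"
proof (cases "x \<in> box a b")
  case True
  have "(\<lambda>n. 1 - (1 - box_bump a b x) ^ n) \<longlonglongrightarrow> 1 - 0"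
    using box_bump_range[of a b x] box_bump_pos[of a b x] True
    by (intro tendsto_diff tendsto_const LIMSEQ_power_zero) auto
  with True show ?thesis by (simp add: box_approx_def)
qed (simp add: box_approx_outside)

subsection \<open>Local integrability\<close>

lemma locally_integrable_measurable:
  fixes f :: "R3 \<Rightarrow> 'b::euclidean_space"
  assumes "locally_integrable f"
  shows "f \<in> borel_measurable borel"
proof (rule borel_measurable_LIMSEQ_metric)
  fix n :: nat
  show "(\<lambda>x. indicator (cball 0 (real n)) x *\<^sub>R f x) \<in> borel_measurable borel"
  proof -
    have "integrable lborel (\<lambda>x. indicator (cball 0 (real n)) x *\<^sub>R f x)"
      using assms unfolding locally_integrable_def set_integrable_def by (rule allE) (erule mp, rule compact_cball)
    from borel_measurable_integrable[OF this] show ?thesis by simp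
  qed
next
  fix x :: R3
  obtain N where "norm x \<le> real N" using real_arch_simple by blast
  then have "eventually (\<lambda>n. indicator (cball 0 (real n)) x *\<^sub>R f x = f x) sequentially"
    by (intro eventually_sequentiallyI[of N]) (simp add: order_trans)
  then show "(\<lambda>n. indicator (cball 0 (real n)) x *\<^sub>R f x) \<longlonglongrightarrow> f x"
    by (rule tendsto_eventually)
qed

lemma locally_integrable_mult:
  fixes f :: "R3 \<Rightarrow> 'b::euclidean_space"
  assumes "locally_integrable f" and [measurable]: "g \<in> borel_measurable borel"
    and "\<And>x. \<bar>g x\<bar> \<le> B" "\<And>x. norm x > \<rho> \<Longrightarrow> g x = 0"
  shows "integrable lborel (\<lambda>x. g x *\<^sub>R f x)"
proof (rule Bochner_Integration.integrable_bound)
  note [measurable] = locally_integrable_measurable[OF assms(1)]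
  show "integrable lborel (\<lambda>x. B *\<^sub>R (indicator (cball 0 \<rho>) x *\<^sub>R f x))"
    using assms(1) by (intro integrable_scaleR_right) (auto simp: locally_integrable_def set_integrable_def)
  show "AE x in lborel. norm (g x *\<^sub>R f x) \<le> norm (B *\<^sub>R (indicator (cball 0 \<rho>) x *\<^sub>R f x))"
  proof (intro always_eventually allI)
    fix x
    show "norm (g x *\<^sub>R f x) \<le> norm (B *\<^sub>R (indicator (cball 0 \<rho>) x *\<^sub>R f x))"
    proof (cases "norm x \<le> \<rho>")
      case True
      have "\<bar>g x\<bar> \<le> \<bar>B\<bar>" using assms(3)[of x] by linarith
      then show ?thesis using True by (simp add: mult_right_mono)
    qed (use assms(4)[of x] in simp)
  qed
  show "(\<lambda>x. g x *\<^sub>R f x) \<in> borel_measurable lborel" by measurable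
qed

lemma locally_integrableI_bounded:
  fixes f :: "R3 \<Rightarrow> 'b::euclidean_space"
  assumes [measurable]: "f \<in> borel_measurable borel"
    and bnd: "\<And>\<rho>. \<exists>B. \<forall>x. norm x \<le> \<rho> \<longrightarrow> norm (f x) \<le> B"
  shows "locally_integrable f"
  unfolding locally_integrable_def set_integrable_def
proof (intro allI impI)
  fix K :: "R3 set" assume K: "compact K"
  then obtain \<rho> where \<rho>: "\<And>x. x \<in> K \<Longrightarrow> norm x \<le> \<rho>"
    using compact_imp_bounded[OF K] unfolding bounded_iff by blast
  obtain B where B: "\<And>x. norm x \<le> \<rho> \<Longrightarrow> norm (f x) \<le> B" using bnd by blast
  have [measurable]: "K \<in> sets borel" using K by (simp add: compact_imp_closed borel_closed)
  show "integrable lborel (\<lambda>x. indicator K x *\<^sub>R f x)"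
  proof (rule Bochner_Integration.integrable_bound)
    show "integrable lborel (\<lambda>x. indicator K x * B :: real)"
      using K emeasure_compact_finite by (intro integrable_mult_left integrable_real_indicator) auto
    show "AE x in lborel. norm (indicator K x *\<^sub>R f x) \<le> norm (indicator K x * B :: real)"
      using B \<rho> by (intro always_eventually allI) (auto split: split_indicator intro: order_trans[OF _ abs_ge_self])
  qed measurable
qed

lemma locally_integrable_integrable:
  fixes f :: "R3 \<Rightarrow> 'b::euclidean_space"
  assumes "integrable lborel f" shows "locally_integrable f"
  unfolding locally_integrable_def set_integrable_def
  by (intro allI impI, rule integrable_mult_indicator[OF _ assms]) (simp add: compact_imp_closed borel_closed)

lemma locally_integrable_continuous:
  fixes f :: "R3 \<Rightarrow> 'b::euclidean_space"
  assumes "continuous_on UNIV f" shows "locally_integrable f"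
proof (rule locally_integrableI_bounded)
  show "f \<in> borel_measurable borel" using assms by (rule borel_measurable_continuous_onI)
  fix \<rho>
  have "compact (f ` cball 0 \<rho>)"
    by (rule compact_continuous_image[OF continuous_on_subset[OF assms]]) auto
  then have "bounded (f ` cball 0 \<rho>)" by (rule compact_imp_bounded)
  then obtain B where "\<forall>y\<in>f ` cball 0 \<rho>. norm y \<le> B" unfolding bounded_iff ..
  then have "\<forall>x. norm x \<le> \<rho> \<longrightarrow> norm (f x) \<le> B" by simp
  then show "\<exists>B. \<forall>x. norm x \<le> \<rho> \<longrightarrow> norm (f x) \<le> B" ..
qed

lemma locally_integrable_add:
  fixes f g :: "R3 \<Rightarrow> 'b::euclidean_space"
  shows "locally_integrable f \<Longrightarrow> locally_integrable g \<Longrightarrow> locally_integrable (\<lambda>x. f x + g x)"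
  unfolding locally_integrable_def set_integrable_def by (simp add: scaleR_add_right)

lemma locally_integrable_scaleR:
  fixes f :: "R3 \<Rightarrow> 'b::euclidean_space"
  shows "locally_integrable f \<Longrightarrow> locally_integrable (\<lambda>x. c *\<^sub>R f x)"
  unfolding locally_integrable_def set_integrable_def
proof (intro allI impI)
  fix K :: "R3 set"
  assume "\<forall>K. compact K \<longrightarrow> integrable lborel (\<lambda>x. indicator K x *\<^sub>R f x)" "compact K"
  then have "integrable lborel (\<lambda>x. c *\<^sub>R (indicator K x *\<^sub>R f x))"
    by (intro integrable_scaleR_right) blast
  then show "integrable lborel (\<lambda>x. indicator K x *\<^sub>R (c *\<^sub>R f x))"
    by (simp only: scaleR_scaleR mult.commute)
qed

subsection \<open>The fundamental lemma and uniqueness of weak gradients\<close>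

text \<open>The measures whose densities are the positive and the negative part of \<open>g\<close>, cut off to a large
  box, agree on all boxes; these form a \<open>\<pi>\<close>-system generating the Borel sets.\<close>

lemma integral_boxes_zero_imp_AE_zero:
  fixes g :: "R3 \<Rightarrow> real"
  assumes g: "locally_integrable g"
    and z: "\<And>a b. (LINT x|lborel. indicator (box a b) x *\<^sub>R g x) = 0"
  shows "AE x in lborel. g x = 0"
proof -
  note [measurable] = locally_integrable_measurable[OF g]
  have box_int: "integrable lborel (\<lambda>x. indicator (box a b) x *\<^sub>R g x)" for a b
  proof -
    have "integrable lborel (\<lambda>x. indicator (box a b) x *\<^sub>R (indicator (cbox a b) x *\<^sub>R g x))"
    proof (rule integrable_mult_indicator)
      show "integrable lborel (\<lambda>x. indicator (cbox a b) x *\<^sub>R g x)"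
        using g compact_cbox unfolding locally_integrable_def set_integrable_def by blast
    qed simp
    moreover have "(\<lambda>x. indicator (box a b) x *\<^sub>R (indicator (cbox a b) x *\<^sub>R g x)) = (\<lambda>x. indicator (box a b) x *\<^sub>R g x)"
      using box_subset_cbox[of a b] by (auto split: split_indicator simp: fun_eq_iff)
    ultimately show ?thesis by simp
  qed
  have "AE x in lborel. x \<in> box (- (real n *\<^sub>R One)) (real n *\<^sub>R One) \<longrightarrow> g x = 0" for n
  proof -
    define B :: "R3 set" where "B = box (- (real n *\<^sub>R One)) (real n *\<^sub>R One)"
    have [measurable]: "B \<in> sets borel" by (simp add: B_def)
    define p where "p x = ennreal (indicator B x * max 0 (g x))" for x
    define m where "m x = ennreal (indicator B x * max 0 (- g x))" for x
    have [measurable]: "p \<in> borel_measurable borel" "m \<in> borel_measurable borel"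
      unfolding p_def m_def by measurable
    have eq: "emeasure (density lborel p) (box a b) = emeasure (density lborel m) (box a b)"
      and fin: "emeasure (density lborel p) (box a b) \<noteq> \<infinity>" for a b
    proof -
      have "\<exists>c d. box a b \<inter> B = box c d"
        unfolding B_def by (intro exI) (rule box_Int_box)
      then obtain c d where cd: "box a b \<inter> B = box c d" by blast
      let ?p = "\<lambda>x. max 0 (indicator (box c d) x *\<^sub>R g x)" and ?m = "\<lambda>x. max 0 (- (indicator (box c d) x *\<^sub>R g x))"
      have ip: "integrable lborel ?p" and im: "integrable lborel ?m" using box_int by auto
      have "(LINT x|lborel. ?p x) - (LINT x|lborel. ?m x) = (LINT x|lborel. indicator (box c d) x *\<^sub>R g x)"
        by (subst Bochner_Integration.integral_diff[symmetric, OF ip im]) (intro Bochner_Integration.integral_cong refl, linarith)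
      then have e: "(LINT x|lborel. ?p x) = (LINT x|lborel. ?m x)" using z by simp
      have ind: "indicator (box c d) x = (indicator (box a b) x * indicator B x :: real)" for x
        by (simp only: cd[symmetric] indicator_inter_arith)
      have "emeasure (density lborel p) (box a b) = (\<integral>\<^sup>+x. p x * indicator (box a b) x \<partial>lborel)"
        by (simp add: emeasure_density)
      also have "\<dots> = (\<integral>\<^sup>+x. ennreal (?p x) \<partial>lborel)"
        unfolding p_def ind by (intro nn_integral_cong) (simp split: split_indicator)
      also have "\<dots> = ennreal (LINT x|lborel. ?p x)" using ip by (intro nn_integral_eq_integral) auto
      finally have p: "emeasure (density lborel p) (box a b) = ennreal (LINT x|lborel. ?p x)" .
      have "emeasure (density lborel m) (box a b) = (\<integral>\<^sup>+x. m x * indicator (box a b) x \<partial>lborel)"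
        by (simp add: emeasure_density)
      also have "\<dots> = (\<integral>\<^sup>+x. ennreal (?m x) \<partial>lborel)"
        unfolding m_def ind by (intro nn_integral_cong) (simp split: split_indicator)
      also have "\<dots> = ennreal (LINT x|lborel. ?m x)" using im by (intro nn_integral_eq_integral) auto
      finally show "emeasure (density lborel p) (box a b) = emeasure (density lborel m) (box a b)"
        "emeasure (density lborel p) (box a b) \<noteq> \<infinity>" using p e by auto
    qed
    have "density lborel p = density lborel m"
    proof (rule measure_eqI_generator_eq[where E = "range (\<lambda>(a, b). box a b)" and \<Omega> = UNIV
          and A = "\<lambda>n. box (- (real n *\<^sub>R One)) (real n *\<^sub>R One)"])
      show "Int_stable (range (\<lambda>(a, b). box a b :: R3 set))"
        by (auto simp: Int_stable_def box_Int_box)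
      show "(\<Union>i. box (- (real i *\<^sub>R One)) (real i *\<^sub>R One)) = (UNIV :: R3 set)"
        by (rule UN_box_eq_UNIV)
      show "sets (density lborel p) = sigma_sets UNIV (range (\<lambda>(a, b). box a b))"
        "sets (density lborel m) = sigma_sets UNIV (range (\<lambda>(a, b). box a b))"
        by (simp_all add: borel_eq_box)
      show "emeasure (density lborel p) Y = emeasure (density lborel m) Y"
        if "Y \<in> range (\<lambda>(a, b). box a b)" for Y
        using that eq by auto
      show "emeasure (density lborel p) (box (- (real i *\<^sub>R One)) (real i *\<^sub>R One)) \<noteq> \<infinity>" for i
        by (rule fin)
      show "range (\<lambda>n. box (- (real n *\<^sub>R One)) (real n *\<^sub>R One)) \<subseteq> (range (\<lambda>(a, b). box a b) :: R3 set set)"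
        by blast
    qed simp
    then have "AE x in lborel. p x = m x"
      using sigma_finite_measure.density_unique_iff[OF sigma_finite_lborel, of p m] by simp
    then show ?thesis
    proof eventually_elim
      case (elim x)
      show ?case unfolding B_def[symmetric]
      proof
        assume "x \<in> B"
        with elim have "max 0 (g x) = max 0 (- g x)" by (simp add: p_def m_def)
        then show "g x = 0" by linarith
      qed
    qed
  qed
  then have "AE x in lborel. \<forall>n. x \<in> box (- (real n *\<^sub>R One)) (real n *\<^sub>R One) \<longrightarrow> g x = 0"
    by (subst AE_all_countable) simp
  then show ?thesis
  proof eventually_elim
    case (elim x)
    have "x \<in> (\<Union>i. box (- (real i *\<^sub>R One)) (real i *\<^sub>R One))" unfolding UN_box_eq_UNIV ..
    with elim show ?case by blast
  qed
qed

lemma fundamental_lemma: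
  fixes g :: "R3 \<Rightarrow> real"
  assumes g: "locally_integrable g"
    and z: "\<And>\<phi>. test_function \<phi> \<Longrightarrow> (LINT x|lborel. \<phi> x *\<^sub>R g x) = 0"
  shows "AE x in lborel. g x = 0"
proof (rule integral_boxes_zero_imp_AE_zero[OF g])
  fix a b :: R3
  note [measurable] = locally_integrable_measurable[OF g]
  have "(\<lambda>n. LINT x|lborel. box_approx a b n x *\<^sub>R g x) \<longlonglongrightarrow> (LINT x|lborel. indicator (box a b) x *\<^sub>R g x)"
  proof (rule integral_dominated_convergence[where w = "\<lambda>x. norm (indicator (cbox a b) x *\<^sub>R g x)"])
    show "integrable lborel (\<lambda>x. norm (indicator (cbox a b) x *\<^sub>R g x))"
      using g compact_cbox[of a b] unfolding locally_integrable_def set_integrable_def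
      by (intro integrable_norm) blast
    show "AE x in lborel. norm (box_approx a b n x *\<^sub>R g x) \<le> norm (indicator (cbox a b) x *\<^sub>R g x)" for n
    proof (intro always_eventually allI)
      fix x
      have "\<bar>box_approx a b n x\<bar> \<le> indicator (cbox a b) x"
        by (rule order_trans[OF abs_box_approx_le]) (use box_subset_cbox[of a b] in \<open>auto simp: indicator_def\<close>)
      then show "norm (box_approx a b n x *\<^sub>R g x) \<le> norm (indicator (cbox a b) x *\<^sub>R g x)"
        by (simp add: abs_mult mult_right_mono)
    qed
    show "AE x in lborel. (\<lambda>n. box_approx a b n x *\<^sub>R g x) \<longlonglongrightarrow> indicator (box a b) x *\<^sub>R g x"
      by (intro always_eventually allI tendsto_scaleR box_approx_tendsto tendsto_const)
    show "(\<lambda>x. box_approx a b n x *\<^sub>R g x) \<in> borel_measurable lborel" for n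
    proof -
      have "Ck 0 (box_approx a b n)" using test_function_box_approx unfolding test_function_def by blast
      then have [measurable]: "box_approx a b n \<in> borel_measurable borel"
        by (simp add: borel_measurable_continuous_onI)
      show ?thesis by measurable
    qed
  qed measurable
  then show "(LINT x|lborel. indicator (box a b) x *\<^sub>R g x) = 0"
    using z[OF test_function_box_approx] by (simp add: LIMSEQ_const_iff)
qed

lemma test_functionE:
  assumes "test_function \<phi>"
  obtains \<rho> B where "\<rho> > 0" "\<And>x. norm x > \<rho> \<Longrightarrow> \<phi> x = 0" "\<And>x. norm x > \<rho> \<Longrightarrow> grad \<phi> x = 0"
    "\<And>x. \<bar>\<phi> x\<bar> \<le> B" "\<And>x. norm (grad \<phi> x) \<le> B"
    "\<phi> \<in> borel_measurable borel" "grad \<phi> \<in> borel_measurable borel"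
    "\<And>x. (\<phi> has_derivative (\<lambda>h. h \<bullet> grad \<phi> x)) (at x)" "continuous_on UNIV \<phi>" "continuous_on UNIV (grad \<phi>)"
proof -
  have C: "Ck 1 \<phi>" "Ck 0 \<phi>" using assms unfolding test_function_def by blast+
  have cont: "continuous_on UNIV \<phi>" using C(2) by simp
  have contg: "continuous_on UNIV (grad \<phi>)" using Ck_Suc_continuous_grad[of 0] C by simp
  have der: "(\<phi> has_derivative (\<lambda>h. h \<bullet> grad \<phi> x)) (at x)" for x
    using C(1) by (intro has_derivative_grad) simp
  have "bounded {x. \<phi> x \<noteq> 0}"
    using assms unfolding test_function_def compact_support_def by (intro bounded_subset[OF compact_imp_bounded closure_subset]) simp
  then obtain \<rho> where \<rho>: "\<rho> > 0" "\<And>x. \<phi> x \<noteq> 0 \<Longrightarrow> norm x \<le> \<rho>"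
    unfolding bounded_pos by auto
  have out: "\<phi> x = 0" if "norm x > \<rho>" for x using \<rho>(2)[of x] that by auto
  have outg: "grad \<phi> x = 0" if "norm x > \<rho>" for x
  proof -
    have "((\<lambda>_. 0::real) has_derivative (\<lambda>h. h \<bullet> 0)) (at x)" by simp
    then have "(\<phi> has_derivative (\<lambda>h. h \<bullet> 0)) (at x)"
      by (rule has_derivative_transform_within_open[of _ _ _ _ "- cball 0 \<rho>"]) (use that out in auto)
    then show ?thesis by (rule grad_eqI)
  qed
  have "\<exists>B. \<forall>x\<in>cball 0 \<rho>. norm (f x) \<le> B" if "continuous_on UNIV f" for f :: "R3 \<Rightarrow> 'z::euclidean_space"
  proof -
    have "compact (f ` cball 0 \<rho>)"
      by (rule compact_continuous_image[OF continuous_on_subset[OF that]]) auto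
    then have "bounded (f ` cball 0 \<rho>)" by (rule compact_imp_bounded)
  then obtain B where "\<forall>y\<in>f ` cball 0 \<rho>. norm y \<le> B" unfolding bounded_iff ..
    then show ?thesis by auto
  qed
  note bd = this
  obtain B1 where B1: "\<forall>x\<in>cball 0 \<rho>. norm (\<phi> x) \<le> B1" using bd[OF cont] by blast
  obtain B2 where B2: "\<forall>x\<in>cball 0 \<rho>. norm (grad \<phi> x) \<le> B2" using bd[OF contg] by blast
  have B: "norm (\<phi> x) \<le> B1" "norm (grad \<phi> x) \<le> B2" if "norm x \<le> \<rho>" for x
    using B1 B2 that by auto
  have b1: "\<bar>\<phi> x\<bar> \<le> max 0 (max B1 B2)" for x
    using B(1)[of x] out[of x] by (cases "norm x \<le> \<rho>") (auto simp: le_max_iff_disj)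
  have b2: "norm (grad \<phi> x) \<le> max 0 (max B1 B2)" for x
    using B(2)[of x] outg[of x] by (cases "norm x \<le> \<rho>") (auto simp: le_max_iff_disj)
  show thesis
    by (rule that[OF \<rho>(1) out outg b1 b2 _ _ der cont contg])
      (auto intro: borel_measurable_continuous_onI cont contg)
qed

lemma test_function_grad_integrable:
  assumes \<phi>: "test_function \<phi>"
  shows "integrable lborel (\<lambda>x. norm (grad \<phi> x))"
proof -
  obtain \<rho> B where "\<rho> > 0" "\<And>x. norm x > \<rho> \<Longrightarrow> \<phi> x = 0" and outg: "\<And>x. norm x > \<rho> \<Longrightarrow> grad \<phi> x = 0"
    and "\<And>x. \<bar>\<phi> x\<bar> \<le> B" and Bg: "\<And>x. norm (grad \<phi> x) \<le> B" and "\<phi> \<in> borel_measurable borel"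
    and [measurable]: "grad \<phi> \<in> borel_measurable borel"
    by (rule test_functionE[OF \<phi>]) blast
  show ?thesis
  proof (rule Bochner_Integration.integrable_bound)
    show "integrable lborel (\<lambda>x. B * indicator (cball (0::R3) \<rho>) x)"
      by (intro integrable_mult_right integrable_indicator_compact compact_cball)
    show "AE x in lborel. norm (norm (grad \<phi> x)) \<le> norm (B * indicator (cball 0 \<rho>) x)"
    proof (intro always_eventually allI)
      fix x show "norm (norm (grad \<phi> x)) \<le> norm (B * indicator (cball 0 \<rho>) x)"
        using Bg[of x] outg[of x] by (cases "norm x \<le> \<rho>") auto
    qed
  qed measurable
qed

lemma weak_grad_unique:
  assumes v: "has_weak_grad f v" and w: "has_weak_grad f w"
  shows "AE x in lborel. v x = w x"
proof -
  have lv: "locally_integrable v" and lw: "locally_integrable w"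
    using assms by (auto simp: has_weak_grad_def)
  have "AE x in lborel. v x $ i - w x $ i = 0" for i
  proof (rule fundamental_lemma)
    have comp: "locally_integrable (\<lambda>x. u x $ i)" if "locally_integrable u" for u :: "R3 \<Rightarrow> R3"
      using that unfolding locally_integrable_def set_integrable_def
    proof (intro allI impI)
      fix K :: "R3 set" assume "\<forall>K. compact K \<longrightarrow> integrable lborel (\<lambda>x. indicator K x *\<^sub>R u x)" "compact K"
      then have "integrable lborel (\<lambda>x. (indicator K x *\<^sub>R u x) \<bullet> axis i 1)"
        by (intro integrable_inner_left) auto
      then show "integrable lborel (\<lambda>x. indicator K x *\<^sub>R (u x $ i))"
        by (simp add: inner_axis)
    qed
    show "locally_integrable (\<lambda>x. v x $ i - w x $ i)"
      using locally_integrable_add[OF comp[OF lv] locally_integrable_scaleR[OF comp[OF lw], of "-1"]] by simp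
    fix \<phi> assume \<phi>: "test_function \<phi>"
    obtain \<rho> B where "\<rho> > 0" and T: "\<And>x. norm x > \<rho> \<Longrightarrow> \<phi> x = 0" and "\<And>x. norm x > \<rho> \<Longrightarrow> grad \<phi> x = 0"
      and T': "\<And>x. \<bar>\<phi> x\<bar> \<le> B" and "\<And>x. norm (grad \<phi> x) \<le> B" and T'': "\<phi> \<in> borel_measurable borel"
      by (rule test_functionE[OF \<phi>]) blast
    have iv: "integrable lborel (\<lambda>x. \<phi> x *\<^sub>R v x)" and iw: "integrable lborel (\<lambda>x. \<phi> x *\<^sub>R w x)"
      using locally_integrable_mult[OF lv T'' T' T] locally_integrable_mult[OF lw T'' T' T] by auto
    have "(LINT x|lborel. \<phi> x *\<^sub>R v x) = (LINT x|lborel. \<phi> x *\<^sub>R w x)"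
      proof -
      have "- (LINT x|lborel. \<phi> x *\<^sub>R v x) = - (LINT x|lborel. \<phi> x *\<^sub>R w x)"
        using v w \<phi> unfolding has_weak_grad_def by (auto dest!: spec[of _ \<phi>])
      then show ?thesis by simp
    qed
    then have "(LINT x|lborel. (\<phi> x *\<^sub>R v x) \<bullet> axis i 1) = (LINT x|lborel. (\<phi> x *\<^sub>R w x) \<bullet> axis i 1)"
      by (simp only: integral_inner_left[OF iv] integral_inner_left[OF iw])
    then show "(LINT x|lborel. \<phi> x *\<^sub>R (v x $ i - w x $ i)) = 0"
      using integrable_inner_left[OF iv, of "axis i 1"] integrable_inner_left[OF iw, of "axis i 1"]
      by (simp add: inner_axis right_diff_distrib Bochner_Integration.integral_diff)
  qed
  then have "AE x in lborel. \<forall>i. v x $ i - w x $ i = 0"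
    by (simp add: AE_all_countable)
  then show ?thesis by eventually_elim (simp add: vec_eq_iff)
qed

lemma AE_weak_grad_eq:
  assumes "has_weak_grad f w"
  shows "AE x in lborel. weak_grad f x = w x" "weak_grad f \<in> borel_measurable borel"
proof -
  have *: "has_weak_grad f (weak_grad f)" unfolding weak_grad_def using someI[of "has_weak_grad f", OF assms] by simp
  show "AE x in lborel. weak_grad f x = w x" by (rule weak_grad_unique[OF * assms])
  show "weak_grad f \<in> borel_measurable borel"
    using * by (auto simp: has_weak_grad_def intro: locally_integrable_measurable)
qed

subsection \<open>Functions with a gradient along almost every line\<close>

text \<open>Translating a difference quotient from \<open>\<phi>\<close> to \<open>F\<close> replaces integration by parts: the increment of
  \<open>F\<close> is an average of \<open>W\<close> over a segment, and translating back puts the segment average on \<open>\<phi>\<close>, which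
  is continuous.\<close>

lemma has_weak_gradI_lines:
  assumes F: "locally_integrable F" and W: "locally_integrable W"
    and L: "\<And>h. AE x in lborel. F (x + h) - F x
          = (LINT t|lborel. indicator {0..1} t *\<^sub>R (h \<bullet> W (x + t *\<^sub>R h)))"
  shows "has_weak_grad F W"
  unfolding has_weak_grad_def
proof (intro conjI F W allI impI)
  fix \<phi> assume \<phi>: "test_function \<phi>"
  note [measurable] = locally_integrable_measurable[OF F] locally_integrable_measurable[OF W]
  obtain \<rho> B where "\<rho> > 0" and out: "\<And>x. norm x > \<rho> \<Longrightarrow> \<phi> x = 0" and outg: "\<And>x. norm x > \<rho> \<Longrightarrow> grad \<phi> x = 0"
    and B: "\<And>x. \<bar>\<phi> x\<bar> \<le> B" and Bg: "\<And>x. norm (grad \<phi> x) \<le> B" and [measurable]: "\<phi> \<in> borel_measurable borel" "grad \<phi> \<in> borel_measurable borel"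
    and der: "\<And>x. (\<phi> has_derivative (\<lambda>h. h \<bullet> grad \<phi> x)) (at x)" and cont: "continuous_on UNIV \<phi>"
    and contg: "continuous_on UNIV (grad \<phi>)"
    by (rule test_functionE[OF \<phi>]) blast
  have B0: "0 \<le> B" using B[of 0] by linarith
  have main: "(LINT x|lborel. F x * (h \<bullet> grad \<phi> x)) = - (LINT x|lborel. \<phi> x * (h \<bullet> W x))" for h
  proof -
    \<comment> \<open>A common majorant for all step sizes at most 1, whose shifts of \<open>\<phi>\<close> are supported in a fixed ball.\<close>
    define D where "D y = B * norm h * norm (indicator (cball 0 (\<rho> + norm h)) y *\<^sub>R W y)" for y
    have D: "integrable lborel D" unfolding D_def
      using W by (intro integrable_mult_right integrable_norm) (simp add: locally_integrable_def set_integrable_def)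
    have D0: "0 \<le> D y" for y by (simp add: D_def B0)
    have shift_out: "\<phi> (y - r *\<^sub>R h) = 0" if "\<bar>r\<bar> \<le> 1" "norm y > \<rho> + norm h" for r y
    proof (rule out)
      have "norm (r *\<^sub>R h) \<le> norm h" using that(1) by (simp add: mult_left_le_one_le)
      with that(2) show "norm (y - r *\<^sub>R h) > \<rho>" using norm_triangle_ineq2[of y "r *\<^sub>R h"] by linarith
    qed
    have dom: "\<bar>\<phi> (y - r *\<^sub>R h) * (h \<bullet> W y)\<bar> \<le> D y" if "\<bar>r\<bar> \<le> 1" for r y
    proof (cases "norm y \<le> \<rho> + norm h")
      case True
      have "\<bar>\<phi> (y - r *\<^sub>R h)\<bar> * \<bar>h \<bullet> W y\<bar> \<le> B * (norm h * norm (W y))"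
        using B B0 Cauchy_Schwarz_ineq2 by (intro mult_mono) auto
      with True show ?thesis by (simp add: D_def abs_mult)
    next
      case False
      then show ?thesis using shift_out[OF that, of y] B0 by (simp add: D_def)
    qed
    define I where "I r = (LINT y|lborel. \<phi> (y - r *\<^sub>R h) * (h \<bullet> W y))" for r
    have I_bound: "\<bar>I r\<bar> \<le> (LINT y|lborel. D y)" if "\<bar>r\<bar> \<le> 1" for r
    proof -
      have "norm (LINT y|lborel. \<phi> (y - r *\<^sub>R h) * (h \<bullet> W y)) \<le> (LINT y|lborel. D y)"
        by (rule Bochner_Integration.integral_norm_bound_integral[OF Bochner_Integration.integrable_bound[OF D] D])
          (use dom[OF that] in \<open>auto intro!: always_eventually intro: order_trans[OF _ abs_ge_self]\<close>)
      then show ?thesis by (simp add: I_def)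
    qed
    have intF: "integrable lborel (\<lambda>x. F x * \<phi> (x - r *\<^sub>R h))" if "\<bar>r\<bar> \<le> 1" for r
      using locally_integrable_mult[OF F, of "\<lambda>x. \<phi> (x - r *\<^sub>R h)" B "\<rho> + norm h"] B shift_out[OF that]
      by (simp add: mult.commute)
    \<comment> \<open>Translation of the difference quotient, before the limit in the step size \<open>r\<close>.\<close>
    have key: "(LINT x|lborel. F x * (\<phi> (x - r *\<^sub>R h) - \<phi> x)) = r * (LINT s|lborel. indicator {0..1} s * I (s * r))"
      if r: "\<bar>r\<bar> \<le> 1" for r
    proof -
      define T where "T s x = indicator {0..1} s * (r * (h \<bullet> W (x + s *\<^sub>R (r *\<^sub>R h))) * \<phi> x)" for s :: real and x
      have inner: "(\<integral>\<^sup>+x. ennreal (norm (T s x)) \<partial>lborel) \<le> ennreal (\<bar>r\<bar> * (LINT y|lborel. D y)) * indicator {0..1} s" for s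
      proof (cases "s \<in> {0..1}")
        case True
        then have sr: "\<bar>s * r\<bar> \<le> 1" using r by (simp add: abs_mult mult_le_one)
        have "(\<integral>\<^sup>+x. ennreal (norm (T s x)) \<partial>lborel)
            = (\<integral>\<^sup>+x. ennreal (\<bar>r\<bar> * \<bar>\<phi> (x + (s * r) *\<^sub>R h - (s * r) *\<^sub>R h) * (h \<bullet> W (x + (s * r) *\<^sub>R h))\<bar>) \<partial>lborel)"
          using True by (intro nn_integral_cong) (simp add: T_def abs_mult mult_ac)
        also have "\<dots> = (\<integral>\<^sup>+y. ennreal (\<bar>r\<bar> * \<bar>\<phi> (y - (s * r) *\<^sub>R h) * (h \<bullet> W y)\<bar>) \<partial>lborel)"
          by (rule nn_integral_translate(1)[of "\<lambda>y. ennreal (\<bar>r\<bar> * \<bar>\<phi> (y - (s * r) *\<^sub>R h) * (h \<bullet> W y)\<bar>)"]) measurable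
        also have "\<dots> \<le> (\<integral>\<^sup>+y. ennreal (\<bar>r\<bar> * D y) \<partial>lborel)"
          using dom[OF sr] by (intro nn_integral_mono ennreal_leI mult_left_mono) auto
        also have "\<dots> = ennreal (LINT y|lborel. \<bar>r\<bar> * D y)"
          using D D0 by (intro nn_integral_eq_integral integrable_mult_right) auto
        finally show ?thesis using True by simp
      qed (simp add: T_def)
      have Tint: "integrable (lborel \<Otimes>\<^sub>M lborel) (case_prod T)"
      proof (rule integrable_pairI)
        show "case_prod T \<in> borel_measurable (lborel \<Otimes>\<^sub>M lborel)"
          unfolding T_def by measurable
        have "(\<integral>\<^sup>+s. (\<integral>\<^sup>+x. ennreal (norm (T s x)) \<partial>lborel) \<partial>lborel)
            \<le> (\<integral>\<^sup>+s. ennreal (\<bar>r\<bar> * (LINT y|lborel. D y)) * indicator {0..1::real} s \<partial>lborel)"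
          by (rule nn_integral_mono) (rule inner)
        also have "\<dots> < \<infinity>" by (subst nn_integral_cmult_indicator) (auto simp: ennreal_mult_less_top)
        finally show "(\<integral>\<^sup>+s. (\<integral>\<^sup>+x. ennreal (norm (T s x)) \<partial>lborel) \<partial>lborel) < \<infinity>" .
      qed
      have intF0: "integrable lborel (\<lambda>x. F x * \<phi> x)" using intF[of 0] by simp
      have "(LINT x|lborel. F x * \<phi> (x - r *\<^sub>R h)) = (LINT x|lborel. F (x + r *\<^sub>R h) * \<phi> x)"
        using integral_translate(1)[of "\<lambda>x. F x * \<phi> (x - r *\<^sub>R h)" "r *\<^sub>R h"] by simp
      moreover have "integrable lborel (\<lambda>x. F (x + r *\<^sub>R h) * \<phi> x)"
        using integral_translate(3)[of "\<lambda>x. F x * \<phi> (x - r *\<^sub>R h)" "r *\<^sub>R h"] intF[OF r] by simp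
      ultimately have "(LINT x|lborel. F x * (\<phi> (x - r *\<^sub>R h) - \<phi> x))
          = (LINT x|lborel. (F (x + r *\<^sub>R h) - F x) * \<phi> x)"
        using intF[OF r] intF0 by (simp add: left_diff_distrib right_diff_distrib)
      also have "\<dots> = (LINT x|lborel. (LINT s|lborel. T s x))"
      proof (rule integral_cong_AE)
        show "AE x in lborel. (F (x + r *\<^sub>R h) - F x) * \<phi> x = (LINT s|lborel. T s x)"
          using L[of "r *\<^sub>R h"]
        proof eventually_elim
          case (elim x)
          have "(LINT s|lborel. T s x)
              = (LINT s|lborel. (indicator {0..1} s *\<^sub>R ((r *\<^sub>R h) \<bullet> W (x + s *\<^sub>R r *\<^sub>R h))) * \<phi> x)"
            by (simp add: T_def mult_ac)
          also have "\<dots> = (LINT s|lborel. indicator {0..1} s *\<^sub>R ((r *\<^sub>R h) \<bullet> W (x + s *\<^sub>R r *\<^sub>R h))) * \<phi> x"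
            by (rule integral_mult_left_zero)
          finally show ?case using elim by simp
        qed
      next
        show "(\<lambda>x. LINT s|lborel. T s x) \<in> borel_measurable lborel"
          unfolding T_def by measurable
      qed measurable
      also have "\<dots> = (LINT s|lborel. (LINT x|lborel. T s x))"
        using lborel_pair.Fubini_integral[OF Tint] .
      also have "\<dots> = (LINT s|lborel. r * (indicator {0..1} s * I (s * r)))"
      proof (rule Bochner_Integration.integral_cong[OF refl])
        fix s :: real
        have "(LINT x|lborel. T s x)
          = (LINT x|lborel. (indicator {0..1} s * r) * (\<phi> (x + (s * r) *\<^sub>R h - (s * r) *\<^sub>R h) * (h \<bullet> W (x + (s * r) *\<^sub>R h))))"
          by (simp add: T_def mult_ac)
        also have "\<dots> = (indicator {0..1} s * r) * (LINT x|lborel. (\<phi> (x + (s * r) *\<^sub>R h - (s * r) *\<^sub>R h) * (h \<bullet> W (x + (s * r) *\<^sub>R h))))"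
          by (rule integral_mult_right_zero)
        also have "(LINT x|lborel. (\<phi> (x + (s * r) *\<^sub>R h - (s * r) *\<^sub>R h) * (h \<bullet> W (x + (s * r) *\<^sub>R h)))) = I (s * r)"
          unfolding I_def by (rule integral_translate(1)[of "\<lambda>x. \<phi> (x - (s * r) *\<^sub>R h) * (h \<bullet> W x)"]) measurable
        finally show "(LINT x|lborel. T s x) = r * (indicator {0..1} s * I (s * r))" by simp
      qed
      finally show ?thesis by simp
    qed
    define \<tau> where "\<tau> n = 1 / real (Suc n)" for n
    have \<tau>: "\<tau> n > 0" "\<bar>\<tau> n\<bar> \<le> 1" for n by (simp_all add: \<tau>_def)
    have \<tau>0: "\<tau> \<longlonglongrightarrow> 0" unfolding \<tau>_def using LIMSEQ_inverse_real_of_nat by (simp add: divide_inverse)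
    have I_lim: "(\<lambda>n. I (s * \<tau> n)) \<longlonglongrightarrow> I 0" if "s \<in> {0..1}" for s
      unfolding I_def
    proof (rule integral_dominated_convergence[OF _ _ D])
      show "AE y in lborel. (\<lambda>n. \<phi> (y - (s * \<tau> n) *\<^sub>R h) * (h \<bullet> W y)) \<longlonglongrightarrow> \<phi> (y - 0 *\<^sub>R h) * (h \<bullet> W y)"
      proof (intro always_eventually allI tendsto_intros)
        fix y
        have "(\<lambda>n. y - (s * \<tau> n) *\<^sub>R h) \<longlonglongrightarrow> y - (s * 0) *\<^sub>R h" by (intro tendsto_intros \<tau>0)
        then have "(\<lambda>n. y - (s * \<tau> n) *\<^sub>R h) \<longlonglongrightarrow> y - 0 *\<^sub>R h" by simp
        then show "(\<lambda>n. \<phi> (y - (s * \<tau> n) *\<^sub>R h)) \<longlonglongrightarrow> \<phi> (y - 0 *\<^sub>R h)"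
          using cont by (auto intro: continuous_on_tendsto_compose)
      qed
      show "AE y in lborel. norm (\<phi> (y - (s * \<tau> n) *\<^sub>R h) * (h \<bullet> W y)) \<le> D y" for n
      proof -
        have "\<bar>s * \<tau> n\<bar> \<le> 1" using that \<tau>(2)[of n] by (simp add: abs_mult mult_le_one)
        from dom[OF this] show ?thesis by (intro always_eventually) simp
      qed
    qed measurable
    have "(\<lambda>n. LINT s|lborel. indicator {0..1} s * I (s * \<tau> n)) \<longlonglongrightarrow> (LINT s|lborel. indicator {0..1::real} s * I 0)"
    proof (rule integral_dominated_convergence[where w = "\<lambda>s. indicator {0..1} s * (LINT y|lborel. D y)"])
      show "integrable lborel (\<lambda>s::real. indicator {0..1} s * (LINT y|lborel. D y))"
        by (intro integrable_mult_left integrable_real_indicator) auto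
      show "AE s in lborel. (\<lambda>n. indicator {0..1} s * I (s * \<tau> n)) \<longlonglongrightarrow> indicator {0..1} s * I 0"
        using I_lim by (intro always_eventually allI) (auto split: split_indicator)
      show "AE s in lborel. norm (indicator {0..1} s * I (s * \<tau> n)) \<le> indicator {0..1} s * (LINT y|lborel. D y)" for n
      proof (intro always_eventually allI)
        fix s :: real
        have "\<bar>s * \<tau> n\<bar> \<le> 1" if "s \<in> {0..1}" using that \<tau>(2)[of n] by (simp add: abs_mult mult_le_one)
        then show "norm (indicator {0..1} s * I (s * \<tau> n)) \<le> indicator {0..1} s * (LINT y|lborel. D y)"
          using I_bound[of "s * \<tau> n"] by (auto split: split_indicator)
      qed
      show "(\<lambda>s. indicator {0..1} s * I (s * \<tau> n)) \<in> borel_measurable lborel" for n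
        unfolding I_def by measurable
    qed measurable
    then have lim1: "(\<lambda>n. LINT s|lborel. indicator {0..1} s * I (s * \<tau> n)) \<longlonglongrightarrow> I 0"
      by simp
    have lip: "\<bar>\<phi> y - \<phi> x\<bar> \<le> B * norm (y - x)" for x y
      by (rule line_gradient_Lipschitz[OF line_gradientI[OF der contg] Bg])
    have lim2: "(\<lambda>n. LINT x|lborel. F x * ((\<phi> (x - \<tau> n *\<^sub>R h) - \<phi> x) / \<tau> n)) \<longlonglongrightarrow> (LINT x|lborel. F x * (- (h \<bullet> grad \<phi> x)))"
    proof (rule integral_dominated_convergence[where w = "\<lambda>x. B * norm h * norm (indicator (cball 0 (\<rho> + norm h)) x *\<^sub>R F x)"])
      show "integrable lborel (\<lambda>x. B * norm h * norm (indicator (cball 0 (\<rho> + norm h)) x *\<^sub>R F x))"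
        using F by (intro integrable_mult_right integrable_norm) (simp add: locally_integrable_def set_integrable_def)
      show "AE x in lborel. norm (F x * ((\<phi> (x - \<tau> n *\<^sub>R h) - \<phi> x) / \<tau> n)) \<le> B * norm h * norm (indicator (cball 0 (\<rho> + norm h)) x *\<^sub>R F x)" for n
      proof (intro always_eventually allI)
        fix x
        show "norm (F x * ((\<phi> (x - \<tau> n *\<^sub>R h) - \<phi> x) / \<tau> n)) \<le> B * norm h * norm (indicator (cball 0 (\<rho> + norm h)) x *\<^sub>R F x)"
        proof (cases "norm x \<le> \<rho> + norm h")
          case True
          have "\<bar>(\<phi> (x - \<tau> n *\<^sub>R h) - \<phi> x) / \<tau> n\<bar> \<le> B * norm h"
            using lip[of "x - \<tau> n *\<^sub>R h" x] \<tau>(1)[of n] by (simp add: divide_le_eq mult_ac)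
          then have "\<bar>F x\<bar> * \<bar>(\<phi> (x - \<tau> n *\<^sub>R h) - \<phi> x) / \<tau> n\<bar> \<le> \<bar>F x\<bar> * (B * norm h)"
            by (intro mult_left_mono) auto
          then show ?thesis using True by (simp add: abs_mult mult_ac)
        next
          case False
          then have "\<phi> (x - \<tau> n *\<^sub>R h) = 0" "\<phi> x = 0" using shift_out[OF \<tau>(2), of x] shift_out[of 0 x] by auto
          then show ?thesis using B0 by simp
        qed
      qed
      show "AE x in lborel. (\<lambda>n. F x * ((\<phi> (x - \<tau> n *\<^sub>R h) - \<phi> x) / \<tau> n)) \<longlonglongrightarrow> F x * (- (h \<bullet> grad \<phi> x))"
      proof (intro always_eventually allI tendsto_mult tendsto_const)
        fix x
        have "((\<lambda>t. x - t *\<^sub>R h) has_derivative (\<lambda>t. - (t *\<^sub>R h))) (at 0)"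
          by (auto intro!: derivative_eq_intros)
        moreover have "(\<phi> has_derivative (\<lambda>h. h \<bullet> grad \<phi> x)) (at (x - 0 *\<^sub>R h))" using der[of x] by simp
        ultimately have "((\<lambda>t. \<phi> (x - t *\<^sub>R h)) has_derivative (\<lambda>t. (- (t *\<^sub>R h)) \<bullet> grad \<phi> x)) (at 0)"
          by (rule has_derivative_compose)
        then have "((\<lambda>t. \<phi> (x - t *\<^sub>R h)) has_real_derivative (- (h \<bullet> grad \<phi> x))) (at 0)"
          unfolding has_field_derivative_def by (rule has_derivative_eq_rhs) auto
        then have *: "((\<lambda>t. (\<phi> (x - t *\<^sub>R h) - \<phi> x) / t) \<longlongrightarrow> - (h \<bullet> grad \<phi> x)) (at 0)"
          by (simp add: DERIV_def)
        have "filterlim \<tau> (at 0) sequentially"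
          using \<tau>0 \<tau>(1) by (simp add: filterlim_at less_imp_neq[OF \<tau>(1), symmetric])
        from filterlim_compose[OF * this]
        show "(\<lambda>n. (\<phi> (x - \<tau> n *\<^sub>R h) - \<phi> x) / \<tau> n) \<longlonglongrightarrow> - (h \<bullet> grad \<phi> x)" .
      qed
    qed measurable
    have "(LINT x|lborel. F x * ((\<phi> (x - \<tau> n *\<^sub>R h) - \<phi> x) / \<tau> n)) = (LINT s|lborel. indicator {0..1} s * I (s * \<tau> n))" for n
    proof -
      have "(LINT x|lborel. F x * ((\<phi> (x - \<tau> n *\<^sub>R h) - \<phi> x) / \<tau> n)) = (LINT x|lborel. F x * (\<phi> (x - \<tau> n *\<^sub>R h) - \<phi> x) / \<tau> n)"
        by simp
      also have "\<dots> = (LINT x|lborel. F x * (\<phi> (x - \<tau> n *\<^sub>R h) - \<phi> x)) / \<tau> n"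
        by (rule integral_divide_zero)
      finally show ?thesis using key[OF \<tau>(2)[of n]] \<tau>(1)[of n] by simp
    qed
    then have "(LINT x|lborel. F x * (- (h \<bullet> grad \<phi> x))) = I 0"
      using lim1 lim2 LIMSEQ_unique by simp
    then show ?thesis by (simp add: I_def)
  qed
  have i1: "integrable lborel (\<lambda>x. F x *\<^sub>R grad \<phi> x)"
  proof -
    have [measurable]: "cball (0 :: R3) \<rho> \<in> sets borel" by simp
    have "integrable lborel (\<lambda>x. (indicator (cball 0 \<rho>) x *\<^sub>R F x) *\<^sub>R grad \<phi> x)"
    proof (rule Bochner_Integration.integrable_bound[where f = "\<lambda>x. B *\<^sub>R (indicator (cball 0 \<rho>) x *\<^sub>R F x)"])
      show "integrable lborel (\<lambda>x. B *\<^sub>R (indicator (cball 0 \<rho>) x *\<^sub>R F x))"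
        using F by (intro integrable_scaleR_right) (simp add: locally_integrable_def set_integrable_def)
      show "AE x in lborel. norm ((indicator (cball 0 \<rho>) x *\<^sub>R F x) *\<^sub>R grad \<phi> x) \<le> norm (B *\<^sub>R (indicator (cball 0 \<rho>) x *\<^sub>R F x))"
      proof (intro always_eventually allI)
        fix x
        show "norm ((indicator (cball 0 \<rho>) x *\<^sub>R F x) *\<^sub>R grad \<phi> x) \<le> norm (B *\<^sub>R (indicator (cball 0 \<rho>) x *\<^sub>R F x))"
          using mult_left_mono[OF Bg[of x], of "\<bar>F x\<bar>"] B0 by (simp add: indicator_def abs_mult mult.commute)
      qed
    qed measurable
    moreover have "(\<lambda>x. (indicator (cball 0 \<rho>) x *\<^sub>R F x) *\<^sub>R grad \<phi> x) = (\<lambda>x. F x *\<^sub>R grad \<phi> x)"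
      using outg by (auto simp: indicator_def fun_eq_iff not_le[symmetric])
    ultimately show ?thesis by (simp only:)
  qed
  have i2: "integrable lborel (\<lambda>x. \<phi> x *\<^sub>R W x)"
    by (rule locally_integrable_mult[OF W _ B out]) measurable
  show "(LINT x|lborel. F x *\<^sub>R grad \<phi> x) = - (LINT x|lborel. \<phi> x *\<^sub>R W x)"
  proof (rule vector_eq_rdot[THEN iffD1, rule_format])
    fix h :: R3
    show "(LINT x|lborel. F x *\<^sub>R grad \<phi> x) \<bullet> h = (- (LINT x|lborel. \<phi> x *\<^sub>R W x)) \<bullet> h"
      using main[of h] unfolding inner_minus_left integral_inner_left[OF i1, symmetric] integral_inner_left[OF i2, symmetric]
      by (simp add: inner_commute)
  qed
qed

lemma has_weak_gradI_line_gradient: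
  assumes "locally_integrable F" "locally_integrable W" "line_gradient F W"
  shows "has_weak_grad F W"
  using assms by (intro has_weak_gradI_lines) (auto simp: line_gradient_def)

section \<open>Convolution with the Newtonian kernel\<close>

text \<open>The Newtonian kernel (\<open>p = 1\<close>), its gradient (\<open>p = 2\<close>) and the Hoelder modulus of its gradient
  (\<open>p = 2 + \<alpha>\<close>) are all estimated through the following lemmas.\<close>

lemma kernel_integrable:
  fixes k :: "R3 \<Rightarrow> 'b::euclidean_space" and g :: "R3 \<Rightarrow> real"
  assumes [measurable]: "k \<in> borel_measurable borel" "g \<in> borel_measurable borel"
    and k: "\<And>z. norm (k z) \<le> riesz p z" "0 \<le> p" "p < 3"
    and g: "\<And>y. \<bar>g y\<bar> \<le> B" "integrable lborel g"
  shows "integrable lborel (\<lambda>y. g y *\<^sub>R k (x - y))" "integrable lborel (\<lambda>y. g y *\<^sub>R k (y - x))"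
    and "norm (LINT y|lborel. g y *\<^sub>R k (x - y)) \<le> 4 * pi / (3 - p) * B + (LINT y|lborel. \<bar>g y\<bar>)"
    and "(LINT y|lborel. norm (g y *\<^sub>R k (x - y))) \<le> 4 * pi / (3 - p) * B + (LINT y|lborel. \<bar>g y\<bar>)"
proof -
  let ?C = "4 * pi / (3 - p) * B + (LINT y|lborel. \<bar>g y\<bar>)"
  have b1: "(\<integral>\<^sup>+y. ennreal (norm (g y *\<^sub>R k (x - y))) \<partial>lborel) \<le> ennreal ?C"
    by (rule order_trans[OF nn_integral_mono nn_integral_riesz_bounded[OF k(2,3) assms(2) g, of x]])
      (use k(1) in \<open>auto intro!: ennreal_leI mult_left_mono simp: mult.commute\<close>)
  have b2: "(\<integral>\<^sup>+y. ennreal (norm (g y *\<^sub>R k (y - x))) \<partial>lborel) \<le> ennreal ?C"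
    by (rule order_trans[OF nn_integral_mono nn_integral_riesz_bounded[OF k(2,3) assms(2) g, of x]])
      (use k(1) in \<open>auto intro!: ennreal_leI mult_left_mono simp: mult.commute riesz_minus_commute[of p x]\<close>)
  show i1: "integrable lborel (\<lambda>y. g y *\<^sub>R k (x - y))"
    by (rule integrableI_bounded) (use b1 in \<open>auto intro: le_less_trans\<close>)
  show "integrable lborel (\<lambda>y. g y *\<^sub>R k (y - x))"
    by (rule integrableI_bounded) (use b2 in \<open>auto intro: le_less_trans\<close>)
  have "ennreal (LINT y|lborel. norm (g y *\<^sub>R k (x - y))) \<le> ennreal ?C"
    using b1 nn_integral_eq_integral[OF integrable_norm[OF i1]] by simp
  moreover have "0 \<le> B" using g(1)[of 0] by linarith
  then have "0 \<le> ?C" using k by (intro add_nonneg_nonneg mult_nonneg_nonneg integral_nonneg_AE) auto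
  ultimately show "(LINT y|lborel. norm (g y *\<^sub>R k (x - y))) \<le> ?C" by simp
  then show "norm (LINT y|lborel. g y *\<^sub>R k (x - y)) \<le> ?C"
    using integral_norm_bound[of lborel "\<lambda>y. g y *\<^sub>R k (x - y)"] by linarith
qed

lemma kernel_pair_integrable:
  fixes k :: "R3 \<Rightarrow> 'b::euclidean_space" and f g :: "R3 \<Rightarrow> real"
  assumes [measurable]: "k \<in> borel_measurable borel" "g \<in> borel_measurable borel"
    and k: "\<And>z. norm (k z) \<le> riesz p z" "0 \<le> p" "p < 3"
    and g: "\<And>y. \<bar>g y\<bar> \<le> B" "integrable lborel g"
    and f: "integrable lborel f"
  shows "integrable (lborel \<Otimes>\<^sub>M lborel) (\<lambda>(x, y). (g x * f y) *\<^sub>R k (x - y))"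
proof -
  let ?C = "4 * pi / (3 - p) * B + (LINT y|lborel. \<bar>g y\<bar>)"
  have [measurable]: "f \<in> borel_measurable borel" using f by auto
  have "integrable (lborel \<Otimes>\<^sub>M lborel) (\<lambda>(y, x). (g x * f y) *\<^sub>R k (x - y))"
  proof (rule integrable_pairI)
    have "(\<integral>\<^sup>+x. ennreal (norm ((g x * f y) *\<^sub>R k (x - y))) \<partial>lborel) \<le> ennreal ?C * ennreal \<bar>f y\<bar>" for y
    proof -
      have "(\<integral>\<^sup>+x. ennreal (norm ((g x * f y) *\<^sub>R k (x - y))) \<partial>lborel)
          \<le> (\<integral>\<^sup>+x. ennreal (riesz p (y - x) * \<bar>g x\<bar>) * ennreal \<bar>f y\<bar> \<partial>lborel)"
      proof (intro nn_integral_mono)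
        fix x
        have "\<bar>g x\<bar> * \<bar>f y\<bar> * norm (k (x - y)) \<le> \<bar>g x\<bar> * \<bar>f y\<bar> * riesz p (y - x)"
          using k(1)[of "x - y"] by (intro mult_left_mono) (auto simp: riesz_minus_commute)
        then show "ennreal (norm ((g x * f y) *\<^sub>R k (x - y))) \<le> ennreal (riesz p (y - x) * \<bar>g x\<bar>) * ennreal \<bar>f y\<bar>"
          by (simp add: ennreal_mult'[symmetric] abs_mult mult_ac ennreal_leI)
      qed
      also have "\<dots> = (\<integral>\<^sup>+x. ennreal (riesz p (y - x) * \<bar>g x\<bar>) \<partial>lborel) * ennreal \<bar>f y\<bar>"
        by (rule nn_integral_multc) measurable
      also have "\<dots> \<le> ennreal ?C * ennreal \<bar>f y\<bar>"
        by (rule mult_right_mono[OF nn_integral_riesz_bounded[OF k(2,3) assms(2) g]]) simp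
      finally show ?thesis .
    qed
    then have "(\<integral>\<^sup>+y. (\<integral>\<^sup>+x. ennreal (norm ((g x * f y) *\<^sub>R k (x - y))) \<partial>lborel) \<partial>lborel)
        \<le> (\<integral>\<^sup>+y. ennreal ?C * ennreal \<bar>f y\<bar> \<partial>lborel)"
      by (intro nn_integral_mono)
    also have "\<dots> = ennreal ?C * (\<integral>\<^sup>+y. ennreal \<bar>f y\<bar> \<partial>lborel)"
      by (rule nn_integral_cmult) measurable
    also have "\<dots> < \<infinity>"
      using nn_integral_eq_integral[OF integrable_norm[OF f]] by (simp add: ennreal_mult_less_top)
    finally show "(\<integral>\<^sup>+y. (\<integral>\<^sup>+x. ennreal (norm ((g x * f y) *\<^sub>R k (x - y))) \<partial>lborel) \<partial>lborel) < \<infinity>" .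
  qed measurable
  from lborel_pair.integrable_product_swap[OF this] show ?thesis by simp
qed

lemma locally_integrable_kernel:
  fixes k :: "R3 \<Rightarrow> 'b::euclidean_space"
  assumes "k \<in> borel_measurable borel" "\<And>z. norm (k z) \<le> riesz p z" "0 \<le> p" "p < 3"
  shows "locally_integrable (\<lambda>x. k (x - y))"
  unfolding locally_integrable_def set_integrable_def
proof (intro allI impI)
  fix K :: "R3 set" assume K: "compact K"
  show "integrable lborel (\<lambda>x. indicator K x *\<^sub>R k (x - y))"
  proof (rule kernel_integrable(2)[OF assms(1) _ assms(2-4), where B = 1])
    show "(indicator K :: R3 \<Rightarrow> real) \<in> borel_measurable borel"
      using K by (simp add: compact_imp_closed borel_closed)
    show "integrable lborel (indicator K :: R3 \<Rightarrow> real)"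
      using K by (rule integrable_indicator_compact)
  qed (simp add: indicator_def)
qed

lemma newton_le_riesz: "norm (newton z) \<le> riesz 1 z"
proof -
  have "riesz 1 z * 1 \<le> riesz 1 z * (4 * pi)" using pi_gt3 by (intro mult_left_mono) auto
  then show ?thesis using pi_gt_zero by (simp add: newton_riesz divide_le_eq)
qed

lemma newton_grad_le_riesz: "norm (newton_grad z) \<le> riesz 2 z"
proof -
  have "riesz 2 z * 1 \<le> riesz 2 z * (4 * pi)" using pi_gt3 by (intro mult_left_mono) auto
  then show ?thesis using pi_gt_zero by (simp add: norm_newton_grad divide_le_eq)
qed

text \<open>In a given direction almost no line meets the singularity.\<close>

lemma has_weak_grad_newton: "has_weak_grad (\<lambda>x. newton (x - y)) (\<lambda>x. newton_grad (x - y))"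
proof (rule has_weak_gradI_lines)
  show "locally_integrable (\<lambda>x. newton (x - y))"
    by (rule locally_integrable_kernel[OF _ newton_le_riesz]) auto
  show "locally_integrable (\<lambda>x. newton_grad (x - y))"
    by (rule locally_integrable_kernel[OF _ newton_grad_le_riesz]) auto
  fix h :: R3
  show "AE x in lborel. newton (x + h - y) - newton (x - y)
      = (LINT t|lborel. indicator {0..1} t *\<^sub>R (h \<bullet> newton_grad (x + t *\<^sub>R h - y)))"
    using AE_not_on_affine_line[of y h]
  proof eventually_elim
    case (elim x)
    have "x - y + t *\<^sub>R h \<noteq> 0" for t
    proof
      assume e: "x - y + t *\<^sub>R h = 0"
      have "x = (x - y + t *\<^sub>R h) + (y - t *\<^sub>R h)" by simp
      also have "\<dots> = y + (- t) *\<^sub>R h" unfolding e by simp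
      finally show False using elim by blast
    qed
    from newton_along_segment[of "x - y" h, OF this] show ?case by (simp add: algebra_simps)
  qed
qed

text \<open>The space in which the neutral density \<open>u - v\<close> varies: the \<open>L\<^sup>2\<close> bound tames the singularity of
  the Newtonian kernel, the \<open>L\<^sup>1\<close> bound its tail.\<close>

definition L12 :: "(R3 \<Rightarrow> real) set" where
  "L12 = {f. integrable lborel f \<and> integrable lborel (\<lambda>x. (f x)\<^sup>2)}"

lemma L12_measurable [measurable_dest]: "f \<in> L12 \<Longrightarrow> f \<in> borel_measurable borel"
  by (auto simp: L12_def)

lemma L12_product: "f \<in> L12 \<Longrightarrow> g \<in> L12 \<Longrightarrow> integrable lborel (\<lambda>x. f x * g x)"
proof -
  assume f: "f \<in> L12" and g: "g \<in> L12"
  note [measurable] = L12_measurable[OF f] L12_measurable[OF g]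
  show "integrable lborel (\<lambda>x. f x * g x)"
  proof (rule Bochner_Integration.integrable_bound)
    show "integrable lborel (\<lambda>x. (f x)\<^sup>2 + (g x)\<^sup>2)" using f g by (simp add: L12_def)
    show "AE x in lborel. norm (f x * g x) \<le> norm ((f x)\<^sup>2 + (g x)\<^sup>2)"
    proof (intro always_eventually allI)
      fix x
      have "0 \<le> (\<bar>f x\<bar> - \<bar>g x\<bar>)\<^sup>2 + (f x)\<^sup>2 + (g x)\<^sup>2" by simp
      then show "norm (f x * g x) \<le> norm ((f x)\<^sup>2 + (g x)\<^sup>2)" by (simp add: power2_diff abs_mult)
    qed
  qed measurable
qed

lemma L12_combination: "f \<in> L12 \<Longrightarrow> g \<in> L12 \<Longrightarrow> (\<lambda>x. a * f x + b * g x) \<in> L12"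
proof -
  assume f: "f \<in> L12" and g: "g \<in> L12"
  have "(\<lambda>x. (a * f x + b * g x)\<^sup>2) = (\<lambda>x. a\<^sup>2 * (f x)\<^sup>2 + b\<^sup>2 * (g x)\<^sup>2 + (2 * a * b) * (f x * g x))"
    by (simp add: power2_sum power_mult_distrib mult_ac)
  then show ?thesis
    using f g L12_product[OF f g] by (simp add: L12_def)
qed

lemma L12_diff: "f \<in> L12 \<Longrightarrow> g \<in> L12 \<Longrightarrow> (\<lambda>x. f x - g x) \<in> L12"
  using L12_combination[of f g 1 "-1"] by simp

lemma newton_conv_integrable:
  assumes "f \<in> L12"
  shows "integrable lborel (\<lambda>y. newton (x - y) * f y)"
    and "(LINT y|lborel. \<bar>newton (x - y) * f y\<bar>) \<le> 4 * pi + (LINT y|lborel. (f y)\<^sup>2) + (LINT y|lborel. \<bar>f y\<bar>)"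
proof -
  note [measurable] = L12_measurable[OF assms]
  let ?C = "4 * pi + (LINT y|lborel. (f y)\<^sup>2) + (LINT y|lborel. \<bar>f y\<bar>)"
  have b: "(\<integral>\<^sup>+y. ennreal (norm (newton (x - y) * f y)) \<partial>lborel) \<le> ennreal ?C"
  proof (rule order_trans[OF nn_integral_mono nn_integral_riesz_1_L2])
    show "ennreal (norm (newton (x - y) * f y)) \<le> ennreal (riesz 1 (x - y) * \<bar>f y\<bar>)" for y
      using newton_le_riesz[of "x - y"] by (intro ennreal_leI) (simp add: abs_mult mult_right_mono)
  qed (use assms in \<open>auto simp: L12_def\<close>)
  show i: "integrable lborel (\<lambda>y. newton (x - y) * f y)"
    by (rule integrableI_bounded) (use b in \<open>auto intro: le_less_trans\<close>)
  have "0 \<le> ?C" by (intro add_nonneg_nonneg integral_nonneg_AE) auto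
  then show "(LINT y|lborel. \<bar>newton (x - y) * f y\<bar>) \<le> ?C"
    using b nn_integral_eq_integral[OF integrable_norm[OF i]] by (simp del: ennreal_plus)
qed

lemma newton_conv_bound:
  assumes "f \<in> L12"
  shows "\<bar>convolution newton f x\<bar> \<le> 4 * pi + (LINT y|lborel. (f y)\<^sup>2) + (LINT y|lborel. \<bar>f y\<bar>)"
  unfolding convolution_def
  using newton_conv_integrable(2)[OF assms, of x] integral_abs_bound[of lborel "\<lambda>y. newton (x - y) * f y"]
  by linarith

lemma newton_conv_measurable [measurable]:
  assumes [measurable]: "f \<in> borel_measurable borel"
  shows "convolution newton f \<in> borel_measurable borel"
  unfolding convolution_def[abs_def] by measurable

definition newton_field :: "(R3 \<Rightarrow> real) \<Rightarrow> R3 \<Rightarrow> R3" where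
  "newton_field f x = (LINT y|lborel. f y *\<^sub>R newton_grad (x - y))"

lemma newton_field_measurable [measurable]:
  assumes [measurable]: "f \<in> borel_measurable borel"
  shows "newton_field f \<in> borel_measurable borel"
  unfolding newton_field_def[abs_def] by measurable

lemma integral_scaled_newton_field:
  "(LINT y|lborel. (c * f y) *\<^sub>R newton_grad (x - y)) = c *\<^sub>R newton_field f x"
  unfolding newton_field_def integral_scaleR_right[symmetric] scaleR_scaleR ..

text \<open>Fubini moves the test function onto the kernel, whose weak gradient is known for every
  position of the pole.\<close>

lemma has_weak_grad_newton_conv:
  assumes f: "f \<in> L12"
  shows "has_weak_grad (convolution newton f) (newton_field f)"
  unfolding has_weak_grad_def
proof (intro conjI allI impI)
  note [measurable] = L12_measurable[OF f]
  have fi: "integrable lborel f" using f by (simp add: L12_def)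
  show "locally_integrable (convolution newton f)"
    using newton_conv_bound[OF f] by (intro locally_integrableI_bounded exI allI impI) auto
  show "locally_integrable (newton_field f)"
    unfolding locally_integrable_def set_integrable_def
  proof (intro allI impI)
    fix K :: "R3 set" assume K: "compact K"
    have [measurable]: "K \<in> sets borel" using K by (simp add: compact_imp_closed borel_closed)
    have iK: "integrable lborel (indicator K :: R3 \<Rightarrow> real)"
      using K by (rule integrable_indicator_compact)
    have "integrable (lborel \<Otimes>\<^sub>M lborel) (\<lambda>(x, y). (indicator K x * f y) *\<^sub>R newton_grad (x - y))"
      by (rule kernel_pair_integrable[OF _ _ newton_grad_le_riesz _ _ _ iK fi, where B = 1]) (auto simp: indicator_def)
    from lborel_pair.integrable_fst[OF this]
    show "integrable lborel (\<lambda>x. indicator K x *\<^sub>R newton_field f x)"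
      unfolding integral_scaled_newton_field .
  qed
  fix \<phi> assume \<phi>: "test_function \<phi>"
  obtain \<rho> B where "\<rho> > 0" and out: "\<And>x. norm x > \<rho> \<Longrightarrow> \<phi> x = 0" and outg: "\<And>x. norm x > \<rho> \<Longrightarrow> grad \<phi> x = 0"
    and B: "\<And>x. \<bar>\<phi> x\<bar> \<le> B" and Bg: "\<And>x. norm (grad \<phi> x) \<le> B" and [measurable]: "\<phi> \<in> borel_measurable borel" "grad \<phi> \<in> borel_measurable borel"
    by (rule test_functionE[OF \<phi>]) blast
  have one: "locally_integrable (\<lambda>_::R3. 1::real)"
    by (intro locally_integrable_continuous continuous_intros)
  have "integrable lborel (\<lambda>x. \<phi> x *\<^sub>R (1::real))"
    by (rule locally_integrable_mult[OF one _ B out]) measurable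
  then have i\<phi>: "integrable lborel \<phi>" by simp
  show "(LINT x|lborel. convolution newton f x *\<^sub>R grad \<phi> x) = - (LINT x|lborel. \<phi> x *\<^sub>R newton_field f x)"
  proof (rule vector_eq_rdot[THEN iffD1, rule_format])
    fix h :: R3
    let ?g = "\<lambda>x. grad \<phi> x \<bullet> h"
    have Bh: "\<bar>?g x\<bar> \<le> B * norm h" for x
      using Cauchy_Schwarz_ineq2[of "grad \<phi> x" h] mult_right_mono[OF Bg[of x], of "norm h"] by simp
    have "integrable lborel (\<lambda>x. ?g x *\<^sub>R (1::real))"
    proof (rule locally_integrable_mult[OF one _ Bh])
      show "grad \<phi> x \<bullet> h = 0" if "norm x > \<rho>" for x using outg[OF that] by simp
    qed measurable
    then have ig: "integrable lborel ?g" by simp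
    have igg: "integrable lborel (\<lambda>x. newton (x - y) *\<^sub>R grad \<phi> x)" for y
    proof -
      have "integrable lborel (\<lambda>x. (B * indicator (cball 0 \<rho>) x) *\<^sub>R newton (x - y))"
      proof (rule kernel_integrable(2)[OF _ _ newton_le_riesz])
        show "\<bar>B * indicator (cball 0 \<rho>) x\<bar> \<le> \<bar>B\<bar>" for x :: R3
          by (simp add: indicator_def)
        show "integrable lborel (\<lambda>x. B * indicator (cball (0::R3) \<rho>) x)"
          by (intro integrable_mult_right integrable_indicator_compact compact_cball)
        show "(\<lambda>x. B * indicator (cball (0::R3) \<rho>) x) \<in> borel_measurable borel"
          by (intro borel_measurable_times borel_measurable_indicator borel_measurable_const) simp
      qed simp_all
      then show ?thesis
      proof (rule Bochner_Integration.integrable_bound)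
        show "AE x in lborel. norm (newton (x - y) *\<^sub>R grad \<phi> x) \<le> norm ((B * indicator (cball 0 \<rho>) x) *\<^sub>R newton (x - y))"
        proof (intro always_eventually allI)
          fix x
          show "norm (newton (x - y) *\<^sub>R grad \<phi> x) \<le> norm ((B * indicator (cball 0 \<rho>) x) *\<^sub>R newton (x - y))"
          proof (cases "norm x \<le> \<rho>")
            case True
            have "norm (grad \<phi> x) \<le> \<bar>B\<bar>" using Bg[of x] by linarith
            from mult_left_mono[OF this, of "\<bar>newton (x - y)\<bar>"] show ?thesis
              using True by (simp add: abs_mult mult.commute)
          qed (use outg[of x] in simp)
        qed
      qed measurable
    qed
    have igw: "integrable lborel (\<lambda>x. \<phi> x *\<^sub>R newton_grad (x - y))" for y
      by (rule kernel_integrable(2)[OF _ _ newton_grad_le_riesz _ _ B i\<phi>]) auto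
    have weak: "(LINT x|lborel. ?g x * newton (x - y)) = - (LINT x|lborel. \<phi> x * (newton_grad (x - y) \<bullet> h))" for y
    proof -
      have "(LINT x|lborel. newton (x - y) *\<^sub>R grad \<phi> x) = - (LINT x|lborel. \<phi> x *\<^sub>R newton_grad (x - y))"
        using has_weak_grad_newton[of y] \<phi> by (simp add: has_weak_grad_def)
      then have "(LINT x|lborel. newton (x - y) *\<^sub>R grad \<phi> x) \<bullet> h = - (LINT x|lborel. \<phi> x *\<^sub>R newton_grad (x - y)) \<bullet> h"
        by simp
      then show ?thesis
        unfolding inner_minus_left integral_inner_left[OF igg, symmetric] integral_inner_left[OF igw, symmetric]
        by (simp add: mult.commute)
    qed
    have p1: "integrable (lborel \<Otimes>\<^sub>M lborel) (\<lambda>(x, y). (?g x * f y) *\<^sub>R newton (x - y))"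
      by (rule kernel_pair_integrable[OF _ _ newton_le_riesz _ _ Bh ig fi]) auto
    have p2: "integrable (lborel \<Otimes>\<^sub>M lborel) (\<lambda>(x, y). (\<phi> x * f y) *\<^sub>R newton_grad (x - y))"
      by (rule kernel_pair_integrable[OF _ _ newton_grad_le_riesz _ _ B i\<phi> fi]) auto
    then have p3: "integrable (lborel \<Otimes>\<^sub>M lborel) (\<lambda>(x, y). ((\<phi> x * f y) *\<^sub>R newton_grad (x - y)) \<bullet> h)"
      using integrable_inner_left[of h _ "\<lambda>(x, y). (\<phi> x * f y) *\<^sub>R newton_grad (x - y)"]
      by (simp add: case_prod_beta')
    have L1: "integrable lborel (\<lambda>x. convolution newton f x *\<^sub>R grad \<phi> x)"
    proof (rule Bochner_Integration.integrable_bound[where f = "\<lambda>x. (4 * pi + (LINT y|lborel. (f y)\<^sup>2) + (LINT y|lborel. \<bar>f y\<bar>)) * (B * indicator (cball 0 \<rho>) x)"])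
      show "integrable lborel (\<lambda>x. (4 * pi + (LINT y|lborel. (f y)\<^sup>2) + (LINT y|lborel. \<bar>f y\<bar>)) * (B * indicator (cball (0::R3) \<rho>) x))"
        by (intro integrable_mult_right integrable_indicator_compact compact_cball)
      show "AE x in lborel. norm (convolution newton f x *\<^sub>R grad \<phi> x)
          \<le> norm ((4 * pi + (LINT y|lborel. (f y)\<^sup>2) + (LINT y|lborel. \<bar>f y\<bar>)) * (B * indicator (cball 0 \<rho>) x))"
      proof (intro always_eventually allI)
        fix x
        show "norm (convolution newton f x *\<^sub>R grad \<phi> x)
          \<le> norm ((4 * pi + (LINT y|lborel. (f y)\<^sup>2) + (LINT y|lborel. \<bar>f y\<bar>)) * (B * indicator (cball 0 \<rho>) x))"
        proof (cases "norm x \<le> \<rho>")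
          case True
          have "\<bar>convolution newton f x\<bar> * norm (grad \<phi> x) \<le> (4 * pi + (LINT y|lborel. (f y)\<^sup>2) + (LINT y|lborel. \<bar>f y\<bar>)) * B"
            using newton_conv_bound[OF f, of x] Bg[of x] by (intro mult_mono) auto
          then show ?thesis using True by simp
        qed (use outg[of x] in simp)
      qed
    qed measurable
    have L2: "integrable lborel (\<lambda>x. \<phi> x *\<^sub>R newton_field f x)"
      using lborel_pair.integrable_fst[OF p2] unfolding integral_scaled_newton_field .
    have "(LINT x|lborel. convolution newton f x *\<^sub>R grad \<phi> x) \<bullet> h
        = (LINT x|lborel. (LINT y|lborel. (?g x * f y) *\<^sub>R newton (x - y)))"
      unfolding integral_inner_left[OF L1, symmetric]
    proof (rule Bochner_Integration.integral_cong[OF refl])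
      fix x
      have "(LINT y|lborel. (?g x * f y) *\<^sub>R newton (x - y)) = (LINT y|lborel. ?g x * (newton (x - y) * f y))"
        by (simp add: mult_ac)
      then show "(convolution newton f x *\<^sub>R grad \<phi> x) \<bullet> h = (LINT y|lborel. (?g x * f y) *\<^sub>R newton (x - y))"
        by (simp add: convolution_def mult.commute)
    qed
    also have "\<dots> = (LINT y|lborel. (LINT x|lborel. (?g x * f y) *\<^sub>R newton (x - y)))"
      using lborel_pair.Fubini_integral[OF p1] by simp
    also have "\<dots> = (LINT y|lborel. (LINT x|lborel. - (((\<phi> x * f y) *\<^sub>R newton_grad (x - y)) \<bullet> h)))"
    proof (rule Bochner_Integration.integral_cong[OF refl])
      fix y
      have "(LINT x|lborel. (?g x * f y) *\<^sub>R newton (x - y)) = f y * (LINT x|lborel. ?g x * newton (x - y))"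
        by (subst integral_mult_right_zero[symmetric]) (simp add: mult_ac)
      also have "\<dots> = - (f y * (LINT x|lborel. \<phi> x * (newton_grad (x - y) \<bullet> h)))" by (simp add: weak)
      also have "\<dots> = (LINT x|lborel. - (((\<phi> x * f y) *\<^sub>R newton_grad (x - y)) \<bullet> h))"
        by (subst integral_mult_right_zero[symmetric]) (simp add: mult_ac)
      finally show "(LINT x|lborel. (?g x * f y) *\<^sub>R newton (x - y))
          = (LINT x|lborel. - (((\<phi> x * f y) *\<^sub>R newton_grad (x - y)) \<bullet> h))" .
    qed
    also have "\<dots> = - (LINT y|lborel. (LINT x|lborel. ((\<phi> x * f y) *\<^sub>R newton_grad (x - y)) \<bullet> h))" by simp
    also have "\<dots> = - (LINT x|lborel. (LINT y|lborel. ((\<phi> x * f y) *\<^sub>R newton_grad (x - y)) \<bullet> h))"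
      using lborel_pair.Fubini_integral[OF p3] by simp
    also have "(LINT x|lborel. (LINT y|lborel. ((\<phi> x * f y) *\<^sub>R newton_grad (x - y)) \<bullet> h))
        = (LINT x|lborel. (\<phi> x *\<^sub>R newton_field f x) \<bullet> h)"
    proof (rule integral_cong_AE)
      show "AE x in lborel. (LINT y|lborel. ((\<phi> x * f y) *\<^sub>R newton_grad (x - y)) \<bullet> h) = (\<phi> x *\<^sub>R newton_field f x) \<bullet> h"
        using lborel_pair.AE_integrable_fst[OF p2]
      proof eventually_elim
        case (elim x)
        have "(\<phi> x *\<^sub>R newton_field f x) = (LINT y|lborel. (\<phi> x * f y) *\<^sub>R newton_grad (x - y))"
          by (rule integral_scaled_newton_field[symmetric])
        then show ?case using integral_inner_left[OF elim] by simp
      qed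
    qed measurable
    also have "\<dots> = (LINT x|lborel. \<phi> x *\<^sub>R newton_field f x) \<bullet> h"
      by (rule integral_inner_left[OF L2])
    finally show "(LINT x|lborel. convolution newton f x *\<^sub>R grad \<phi> x) \<bullet> h
        = (- (LINT x|lborel. \<phi> x *\<^sub>R newton_field f x)) \<bullet> h" by simp
  qed
qed

section \<open>The fundamental solution\<close>

lemma has_bochner_integral_tail:
  fixes z :: R3
  assumes "z \<noteq> 0"
  shows "has_bochner_integral lborel (\<lambda>s. indicator {norm z..} s * s powr (- 4)) (1 / (3 * norm z ^ 3))"
proof (rule has_bochner_integral_nn_integral)
  have tail: "((\<lambda>s. s powr (- 4)) has_integral (- (norm z powr (- 4 + 1)) / (- 4 + 1))) {norm z..}"
    by (rule has_integral_powr_to_inf) (use assms in auto)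
  have *: "(\<integral>\<^sup>+s. ennreal (s powr (- 4)) * indicator {norm z..} s \<partial>lborel) = ennreal (- (norm z powr (- 4 + 1)) / (- 4 + 1))"
    by (rule nn_integral_has_integral_lebesgue'[OF _ tail]) (rule powr_ge_zero)
  have "norm z powr (- 3) = 1 / norm z ^ 3"
    using powr_minus[of "norm z" 3] powr_realpow[of "norm z" 3] assms by (simp add: inverse_eq_divide)
  then have **: "- (norm z powr (- 4 + 1)) / (- 4 + 1) = 1 / (3 * norm z ^ 3)" by simp
  have "(\<integral>\<^sup>+s. ennreal (indicator {norm z..} s * s powr (- 4)) \<partial>lborel)
      = (\<integral>\<^sup>+s. ennreal (s powr (- 4)) * indicator {norm z..} s \<partial>lborel)"
    by (intro nn_integral_cong) (simp add: indicator_def)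
  also note *
  also note **
  finally show "(\<integral>\<^sup>+s. ennreal (indicator {norm z..} s * s powr (- 4)) \<partial>lborel) = ennreal (1 / (3 * norm z ^ 3))" .
  show "(\<lambda>s. indicator {norm z..} s * s powr (- 4)) \<in> borel_measurable lborel"
    by measurable
  show "AE s in lborel. 0 \<le> indicator {norm z..} s * s powr (- 4)"
    by (intro always_eventually allI mult_nonneg_nonneg) simp_all
qed simp

lemma integral_scale:
  fixes g :: "R3 \<Rightarrow> real"
  assumes [measurable]: "g \<in> borel_measurable borel" and "s > 0"
  shows "(LINT z|lborel. g z) = s ^ 3 * (LINT y|lborel. g (s *\<^sub>R y))"
proof -
  have "(LINT z|lborel. g z) = (LINT z|density (distr lborel borel (\<lambda>y. 0 + s *\<^sub>R y)) (\<lambda>_. ennreal (s ^ 3)). g z)"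
    using lborel_affine[of s "0 :: R3"] assms(2) by (simp add: abs_of_pos)
  also have "\<dots> = (LINT z|distr lborel borel (\<lambda>y. 0 + s *\<^sub>R y). s ^ 3 *\<^sub>R g z)"
    using assms(2) by (intro integral_density) auto
  also have "\<dots> = (LINT y|lborel. s ^ 3 *\<^sub>R g (0 + s *\<^sub>R y))"
    by (rule integral_distr) measurable
  finally show ?thesis by simp
qed

text \<open>The weight \<open>1/\<bar>z\<bar>\<^sup>3\<close> in the kernel is, up to a factor, the integral of \<open>1/s\<^sup>4\<close> over the radii \<open>s\<close> of
  all balls around the origin that contain \<open>z\<close>. Rescaling each of these balls to the unit ball leaves
  the integral over \<open>s\<close> of the derivative of \<open>\<phi>\<close> along the ray through a point of the unit ball, which
  is \<open>- c\<close>. Only the behaviour along almost every ray enters, so \<open>\<phi>\<close> may itself be singular.\<close>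

lemma newton_flux:
  fixes \<phi> :: "R3 \<Rightarrow> real" and D :: "R3 \<Rightarrow> R3"
  assumes [measurable]: "D \<in> borel_measurable borel"
    and rays: "AE y in lborel. (\<forall>s>0. ((\<lambda>s. \<phi> (s *\<^sub>R y)) has_real_derivative (y \<bullet> D (s *\<^sub>R y))) (at s))
        \<and> (\<forall>s>0. isCont (\<lambda>s. y \<bullet> D (s *\<^sub>R y)) s)
        \<and> ((\<lambda>s. \<phi> (s *\<^sub>R y)) \<longlongrightarrow> c) (at_right 0) \<and> ((\<lambda>s. \<phi> (s *\<^sub>R y)) \<longlongrightarrow> 0) at_top"
    and fin: "(\<integral>\<^sup>+z. ennreal (riesz 2 z * norm (D z)) \<partial>lborel) < \<infinity>"
  shows "(LINT z|lborel. newton_grad z \<bullet> D z) = c"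
proof -
  define q where "q z s = indicator {norm z..} s * s powr (- 4)" for z :: R3 and s :: real
  have [measurable]: "(\<lambda>(z, s). q z s) \<in> borel_measurable (borel \<Otimes>\<^sub>M borel)"
  proof -
    have "(\<lambda>(z, s). q z s) = (\<lambda>(z, s). (if norm z \<le> s then 1 else 0) * s powr (- 4))"
      by (auto simp: q_def fun_eq_iff)
    then show ?thesis by simp
  qed
  have [measurable]: "(\<lambda>z. q z s) \<in> borel_measurable borel" for s
  proof -
    have "(\<lambda>z. q z s) = (\<lambda>z. (if norm z \<le> s then 1 else 0) * s powr (- 4))"
      by (auto simp: q_def fun_eq_iff)
    then show ?thesis by simp
  qed
  have q_nn: "0 \<le> q z s" for z s by (simp add: q_def)
  \<comment> \<open>The same integrand before (\<open>T\<close>) and after (\<open>S\<close>) the rescaling \<open>z = s y\<close>.\<close>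
  define T where "T z s = q z s * (z \<bullet> D z)" for z s
  define S where "S s y = indicator {0<..} s * (indicator (cball 0 1) y * (y \<bullet> D (s *\<^sub>R y)))" for s :: real and y :: R3
  have [measurable]: "(indicator (cball (0::R3) 1) :: R3 \<Rightarrow> real) \<in> borel_measurable borel"
    by (intro borel_measurable_indicator) simp
  have [measurable]: "(\<lambda>z. T z s) \<in> borel_measurable borel" for s
    unfolding T_def by measurable
  have [measurable]: "case_prod T \<in> borel_measurable (lborel \<Otimes>\<^sub>M lborel)"
    unfolding T_def by measurable
  have [measurable]: "case_prod S \<in> borel_measurable (lborel \<Otimes>\<^sub>M lborel)"
    unfolding S_def by measurable
  have qint: "(LINT s|lborel. q z s) = 1 / (3 * norm z ^ 3)" "integrable lborel (q z)" if "z \<noteq> 0" for z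
    using has_bochner_integral_tail[OF that] unfolding q_def[symmetric] by (auto simp: has_bochner_integral_iff)
  have Tnn: "(\<integral>\<^sup>+s. ennreal (norm (T z s)) \<partial>lborel) \<le> ennreal (riesz 2 z * norm (D z))" for z
  proof (cases "z = 0")
    case False
    have "(\<integral>\<^sup>+s. ennreal (norm (T z s)) \<partial>lborel) = (\<integral>\<^sup>+s. ennreal (q z s) * ennreal \<bar>z \<bullet> D z\<bar> \<partial>lborel)"
      by (intro nn_integral_cong) (simp add: T_def abs_mult q_nn ennreal_mult')
    also have "\<dots> = (\<integral>\<^sup>+s. ennreal (q z s) \<partial>lborel) * ennreal \<bar>z \<bullet> D z\<bar>"
      by (rule nn_integral_multc) (simp add: q_def)
    also have "(\<integral>\<^sup>+s. ennreal (q z s) \<partial>lborel) = ennreal (1 / (3 * norm z ^ 3))"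
      using nn_integral_eq_integral[OF qint(2)[OF False]] q_nn qint(1)[OF False] by simp
    also have "\<dots> * ennreal \<bar>z \<bullet> D z\<bar> = ennreal (1 / (3 * norm z ^ 3) * \<bar>z \<bullet> D z\<bar>)"
      by (rule ennreal_mult[symmetric]) auto
    also have "\<dots> \<le> ennreal (riesz 2 z * norm (D z))"
    proof (rule ennreal_leI)
      have "1 / (3 * norm z ^ 3) * \<bar>z \<bullet> D z\<bar> \<le> 1 / (3 * norm z ^ 3) * (norm z * norm (D z))"
        by (intro mult_left_mono Cauchy_Schwarz_ineq2) auto
      also have "\<dots> = riesz 2 z * norm (D z) / 3"
        using False by (simp add: riesz_power power3_eq_cube power2_eq_square)
      also have "\<dots> \<le> riesz 2 z * norm (D z)" by simp
      finally show "1 / (3 * norm z ^ 3) * \<bar>z \<bullet> D z\<bar> \<le> riesz 2 z * norm (D z)" .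
    qed
    finally show ?thesis .
  qed (simp add: T_def)
  have Tfin: "(\<integral>\<^sup>+z. (\<integral>\<^sup>+s. ennreal (norm (T z s)) \<partial>lborel) \<partial>lborel) < \<infinity>"
    by (rule le_less_trans[OF nn_integral_mono[OF Tnn] fin])
  have Tint: "integrable (lborel \<Otimes>\<^sub>M lborel) (case_prod T)"
    by (rule integrable_pairI[OF _ Tfin]) measurable
  have T0: "T z s = 0" if "s \<le> 0" for z s
  proof (cases "z = 0")
    case False
    then have "\<not> norm z \<le> s" using that by (meson less_le_trans not_le zero_less_norm_iff)
    then show ?thesis by (simp add: T_def q_def)
  qed (simp add: T_def)
  have scale: "s ^ 3 * T (s *\<^sub>R y) s = S s y" if "s > 0" for s y
  proof -
    have "s powr (- 4) = 1 / s ^ 4" using that by (simp add: powr_minus divide_inverse)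
    then have "s ^ 3 * (s powr (- 4) * s) = 1" using that by (simp add: field_simps eval_nat_numeral)
    moreover have "norm (s *\<^sub>R y) \<le> s \<longleftrightarrow> norm y \<le> 1" using that by simp
    ultimately have "s ^ 3 * T (s *\<^sub>R y) s = indicator (cball 0 1) y * ((s ^ 3 * (s powr (- 4) * s)) * (y \<bullet> D (s *\<^sub>R y)))"
      by (simp add: T_def q_def indicator_def mult_ac)
    also have "\<dots> = S s y" using that \<open>s ^ 3 * (s powr (- 4) * s) = 1\<close> by (simp add: S_def)
    finally show ?thesis .
  qed
  have S_nn: "(\<integral>\<^sup>+y. ennreal (norm (S s y)) \<partial>lborel) = (\<integral>\<^sup>+z. ennreal (norm (T z s)) \<partial>lborel)" for s
  proof (cases "s > 0")
    case True
    have "(\<integral>\<^sup>+z. ennreal (norm (T z s)) \<partial>lborel) = ennreal (\<bar>s\<bar> ^ 3) * (\<integral>\<^sup>+y. ennreal (norm (T (0 + s *\<^sub>R y) s)) \<partial>lborel)"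
      using True by (intro nn_integral_lborel_affine) auto
    also have "\<dots> = (\<integral>\<^sup>+y. ennreal (\<bar>s\<bar> ^ 3) * ennreal (norm (T (0 + s *\<^sub>R y) s)) \<partial>lborel)"
      by (rule nn_integral_cmult[symmetric]) simp
    also have "\<dots> = (\<integral>\<^sup>+y. ennreal (norm (S s y)) \<partial>lborel)"
      using True by (intro nn_integral_cong) (simp add: scale[OF True, symmetric] abs_mult ennreal_mult'[symmetric])
    finally show ?thesis by simp
  qed (simp add: S_def T0)
  have Sint: "integrable (lborel \<Otimes>\<^sub>M lborel) (case_prod S)"
  proof (rule integrable_pairI)
    have "(\<integral>\<^sup>+s. (\<integral>\<^sup>+y. ennreal (norm (S s y)) \<partial>lborel) \<partial>lborel) = (\<integral>\<^sup>+s. (\<integral>\<^sup>+z. ennreal (norm (T z s)) \<partial>lborel) \<partial>lborel)"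
      by (simp only: S_nn)
    also have "\<dots> = (\<integral>\<^sup>+z. (\<integral>\<^sup>+s. ennreal (norm (T z s)) \<partial>lborel) \<partial>lborel)"
      using lborel_pair.Fubini'[of "\<lambda>z s. ennreal (norm (T z s))"] by simp
    also have "\<dots> < \<infinity>" by (rule Tfin)
    finally show "(\<integral>\<^sup>+s. (\<integral>\<^sup>+y. ennreal (norm (S s y)) \<partial>lborel) \<partial>lborel) < \<infinity>" .
  qed measurable
  have S_ray: "(LINT s|lborel. S s y) = - c * indicator (cball 0 1) y"
    if y: "(\<forall>s>0. ((\<lambda>s. \<phi> (s *\<^sub>R y)) has_real_derivative (y \<bullet> D (s *\<^sub>R y))) (at s))
        \<and> (\<forall>s>0. isCont (\<lambda>s. y \<bullet> D (s *\<^sub>R y)) s)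
        \<and> ((\<lambda>s. \<phi> (s *\<^sub>R y)) \<longlongrightarrow> c) (at_right 0) \<and> ((\<lambda>s. \<phi> (s *\<^sub>R y)) \<longlongrightarrow> 0) at_top"
      and int: "integrable lborel (\<lambda>s. S s y)" for y
  proof (cases "y \<in> cball 0 1")
    case True
    have "(LBINT s=0..\<infinity>. y \<bullet> D (s *\<^sub>R y)) = 0 - c"
    proof (rule interval_integral_FTC_integrable)
      show "((\<lambda>s. \<phi> (s *\<^sub>R y)) has_vector_derivative (y \<bullet> D (s *\<^sub>R y))) (at s)"
        if "0 < ereal s" "ereal s < \<infinity>" for s
        using y that by (simp add: has_real_derivative_iff_has_vector_derivative)
      show "isCont (\<lambda>s. y \<bullet> D (s *\<^sub>R y)) s" if "0 < ereal s" "ereal s < \<infinity>" for s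
        using y that by simp
      show "set_integrable lborel (einterval 0 \<infinity>) (\<lambda>s. y \<bullet> D (s *\<^sub>R y))"
        using int True by (simp add: set_integrable_def S_def einterval_def greaterThan_def zero_ereal_def)
      show "(((\<lambda>s. \<phi> (s *\<^sub>R y)) \<circ> real_of_ereal) \<longlongrightarrow> c) (at_right 0)"
        using y by (simp add: zero_ereal_def ereal_tendsto_simps)
      show "(((\<lambda>s. \<phi> (s *\<^sub>R y)) \<circ> real_of_ereal) \<longlongrightarrow> 0) (at_left \<infinity>)"
        using y by (simp add: ereal_tendsto_simps)
    qed simp
    moreover have "(LBINT s=0..\<infinity>. y \<bullet> D (s *\<^sub>R y)) = (LINT s|lborel. S s y)"
      using True by (simp add: interval_lebesgue_integral_def set_lebesgue_integral_def S_def einterval_def greaterThan_def zero_ereal_def)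
    ultimately show ?thesis using True by simp
  qed (simp add: S_def)
  have "(LINT z|lborel. (LINT s|lborel. T z s)) = (LINT s|lborel. (LINT z|lborel. T z s))"
    using lborel_pair.Fubini_integral[OF Tint] by simp
  also have "\<dots> = (LINT s|lborel. (LINT y|lborel. S s y))"
  proof (rule Bochner_Integration.integral_cong[OF refl])
    fix s :: real
    show "(LINT z|lborel. T z s) = (LINT y|lborel. S s y)"
    proof (cases "s > 0")
      case True
      have "(LINT z|lborel. T z s) = s ^ 3 * (LINT y|lborel. T (s *\<^sub>R y) s)"
        using True by (intro integral_scale) auto
      also have "\<dots> = (LINT y|lborel. s ^ 3 * T (s *\<^sub>R y) s)" by simp
      finally show ?thesis by (simp add: scale[OF True])
    qed (simp add: S_def T0)
  qed
  also have "\<dots> = (LINT y|lborel. (LINT s|lborel. S s y))"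
    using lborel_pair.Fubini_integral[OF Sint] by simp
  also have "\<dots> = (LINT y|lborel. - c * indicator (cball 0 1) (y :: R3))"
  proof (rule integral_cong_AE)
    show "AE y in lborel. (LINT s|lborel. S s y) = - c * indicator (cball 0 1) y"
      using rays lborel_pair.AE_integrable_snd[OF Sint]
      by eventually_elim (rule S_ray)
  qed measurable
  also have "\<dots> = - c * (4 / 3 * pi)"
    by (simp add: measure_def emeasure_cball eval_unit_ball_vol)
  finally have Tc: "(LINT z|lborel. (LINT s|lborel. T z s)) = - c * (4 / 3 * pi)" .
  \<comment> \<open>The factor 3 comes from integrating \<open>1/s\<^sup>4\<close>, and cancels against the volume of the unit ball.\<close>
  have "newton_grad z \<bullet> D z = - (3 / (4 * pi)) * (LINT s|lborel. T z s)" for z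
  proof (cases "z = 0")
    case False
    have "(LINT s|lborel. T z s) = 1 / (3 * norm z ^ 3) * (z \<bullet> D z)"
      unfolding T_def integral_mult_left_zero using qint(1)[OF False] by simp
    then show ?thesis by (simp add: newton_grad_def)
  qed (simp add: newton_grad_def T_def)
  then have "(LINT z|lborel. newton_grad z \<bullet> D z) = - (3 / (4 * pi)) * (LINT z|lborel. (LINT s|lborel. T z s))"
    by simp
  then show ?thesis using Tc by simp
qed

lemma newton_flux_test_function:
  assumes \<phi>: "test_function \<phi>"
  shows "(LINT x|lborel. newton_grad (x - y) \<bullet> grad \<phi> x) = \<phi> y"
proof -
  obtain \<rho> B where "\<rho> > 0" and out: "\<And>x. norm x > \<rho> \<Longrightarrow> \<phi> x = 0" and outg: "\<And>x. norm x > \<rho> \<Longrightarrow> grad \<phi> x = 0"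
    and B: "\<And>x. \<bar>\<phi> x\<bar> \<le> B" and Bg: "\<And>x. norm (grad \<phi> x) \<le> B" and [measurable]: "\<phi> \<in> borel_measurable borel" "grad \<phi> \<in> borel_measurable borel"
    and der: "\<And>x. (\<phi> has_derivative (\<lambda>h. h \<bullet> grad \<phi> x)) (at x)" and cont: "continuous_on UNIV \<phi>"
    and contg: "continuous_on UNIV (grad \<phi>)"
    by (rule test_functionE[OF \<phi>]) blast
  note ng = test_function_grad_integrable[OF \<phi>]
  have "(LINT z|lborel. newton_grad z \<bullet> grad \<phi> (z + y)) = \<phi> y"
  proof (rule newton_flux[where \<phi> = "\<lambda>z. \<phi> (z + y)"])
    have "(\<integral>\<^sup>+z. ennreal (riesz 2 z * norm (grad \<phi> (z + y))) \<partial>lborel)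
        = (\<integral>\<^sup>+z. ennreal (riesz 2 (y - (z + y)) * norm (grad \<phi> (z + y))) \<partial>lborel)"
      by (simp add: riesz_def)
    also have "\<dots> = (\<integral>\<^sup>+x. ennreal (riesz 2 (y - x) * \<bar>norm (grad \<phi> x)\<bar>) \<partial>lborel)"
      using nn_integral_translate(1)[of "\<lambda>x. ennreal (riesz 2 (y - x) * \<bar>norm (grad \<phi> x)\<bar>)" y] by simp
    also have "\<dots> \<le> ennreal (4 * pi / (3 - 2) * B + (LINT y|lborel. \<bar>norm (grad \<phi> y)\<bar>))"
      by (rule nn_integral_riesz_bounded) (use Bg ng in auto)
    also have "\<dots> < \<infinity>" by simp
    finally show "(\<integral>\<^sup>+z. ennreal (riesz 2 z * norm (grad \<phi> (z + y))) \<partial>lborel) < \<infinity>" .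
    have "AE z in lborel. z \<noteq> (0::R3)" using AE_not_on_affine_line[of 0 0] by simp
    then show "AE z in lborel. (\<forall>s>0. ((\<lambda>s. \<phi> (s *\<^sub>R z + y)) has_real_derivative (z \<bullet> grad \<phi> (s *\<^sub>R z + y))) (at s))
        \<and> (\<forall>s>0. isCont (\<lambda>s. z \<bullet> grad \<phi> (s *\<^sub>R z + y)) s)
        \<and> ((\<lambda>s. \<phi> (s *\<^sub>R z + y)) \<longlongrightarrow> \<phi> y) (at_right 0) \<and> ((\<lambda>s. \<phi> (s *\<^sub>R z + y)) \<longlongrightarrow> 0) at_top"
    proof eventually_elim
      case (elim z)
      have d: "((\<lambda>s. \<phi> (s *\<^sub>R z + y)) has_real_derivative (z \<bullet> grad \<phi> (s *\<^sub>R z + y))) (at s)" for s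
      proof -
        have "((\<lambda>s. s *\<^sub>R z + y) has_derivative (\<lambda>t. t *\<^sub>R z)) (at s)"
          by (auto intro!: derivative_eq_intros)
        from has_derivative_compose[OF this der]
        show ?thesis unfolding has_field_derivative_def by (rule has_derivative_eq_rhs) auto
      qed
      have c: "isCont (\<lambda>s. z \<bullet> grad \<phi> (s *\<^sub>R z + y)) s" for s
      proof -
        have "continuous_on UNIV (\<lambda>s. z \<bullet> grad \<phi> (s *\<^sub>R z + y))"
          by (intro continuous_intros continuous_on_compose2[OF contg]) auto
        then show ?thesis by (simp add: continuous_on_eq_continuous_at)
      qed
      have "isCont (\<lambda>s. \<phi> (s *\<^sub>R z + y)) 0" using d[of 0] by (rule DERIV_isCont)
      then have l0: "((\<lambda>s. \<phi> (s *\<^sub>R z + y)) \<longlongrightarrow> \<phi> y) (at_right 0)"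
        by (simp add: isCont_def filterlim_at_split)
      have "eventually (\<lambda>s. \<phi> (s *\<^sub>R z + y) = 0) at_top"
        unfolding eventually_at_top_linorder
      proof (intro exI allI impI)
        fix s assume s: "(\<rho> + norm y + 1) / norm z \<le> s"
        then have "\<rho> + norm y + 1 \<le> s * norm z" using elim by (simp add: divide_le_eq)
        moreover have "0 \<le> s"
        proof -
          have "0 \<le> (\<rho> + norm y + 1) / norm z" using \<open>\<rho> > 0\<close> by simp
          with s show ?thesis by linarith
        qed
        ultimately have "norm (s *\<^sub>R z + y) > \<rho>" using norm_diff_ineq[of "s *\<^sub>R z" y] by simp
        then show "\<phi> (s *\<^sub>R z + y) = 0" by (rule out)
      qed
      then have "((\<lambda>s. \<phi> (s *\<^sub>R z + y)) \<longlongrightarrow> 0) at_top" by (rule tendsto_eventually)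
      with d c l0 show ?case by simp
    qed
  qed measurable
  then show ?thesis
    using integral_translate(1)[of "\<lambda>x. newton_grad (x - y) \<bullet> grad \<phi> x" y] by simp
qed

text \<open>The function \<open>\<phi> = G(\<cdot> - a)\<close> is singular at \<open>a\<close>, but only one line through the origin meets \<open>a\<close>.\<close>

lemma newton_flux_newton:
  fixes a :: R3
  assumes a: "a \<noteq> 0"
  shows "(LINT z|lborel. newton_grad z \<bullet> newton_grad (z - a)) = newton a"
proof (rule newton_flux[where \<phi> = "\<lambda>z. newton (z - a)"])
  have "(\<integral>\<^sup>+z. ennreal (riesz 2 z * norm (newton_grad (z - a))) \<partial>lborel)
      \<le> (\<integral>\<^sup>+z. ennreal (riesz 2 (z - 0) * riesz 2 (z - a)) \<partial>lborel)"
    using newton_grad_le_riesz by (intro nn_integral_mono ennreal_leI) (simp add: mult_left_mono)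
  also have "\<dots> \<le> ennreal (48 * pi * riesz 1 (0 - a))"
    using a by (intro nn_integral_riesz_composition) simp
  also have "\<dots> < \<infinity>" by simp
  finally show "(\<integral>\<^sup>+z. ennreal (riesz 2 z * norm (newton_grad (z - a))) \<partial>lborel) < \<infinity>" .
  show "AE y in lborel. (\<forall>s>0. ((\<lambda>s. newton (s *\<^sub>R y - a)) has_real_derivative (y \<bullet> newton_grad (s *\<^sub>R y - a))) (at s))
      \<and> (\<forall>s>0. isCont (\<lambda>s. y \<bullet> newton_grad (s *\<^sub>R y - a)) s)
      \<and> ((\<lambda>s. newton (s *\<^sub>R y - a)) \<longlongrightarrow> newton a) (at_right 0) \<and> ((\<lambda>s. newton (s *\<^sub>R y - a)) \<longlongrightarrow> 0) at_top"
    using AE_not_on_affine_line[of 0 a]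
  proof eventually_elim
    case (elim y)
    have nz: "s *\<^sub>R y - a \<noteq> 0" for s
    proof
      assume "s *\<^sub>R y - a = 0"
      then have e: "s *\<^sub>R y = a" by simp
      with a have "s \<noteq> 0" by auto
      then have "y = 0 + (1 / s) *\<^sub>R a" unfolding e[symmetric] by simp
      with elim show False by blast
    qed
    have d: "((\<lambda>s. newton (s *\<^sub>R y - a)) has_real_derivative (y \<bullet> newton_grad (s *\<^sub>R y - a))) (at s)" for s
    proof -
      have "((\<lambda>s. s *\<^sub>R y - a) has_derivative (\<lambda>t. t *\<^sub>R y)) (at s)"
        by (auto intro!: derivative_eq_intros)
      from has_derivative_compose[OF this newton_has_derivative[OF nz]]
      show ?thesis unfolding has_field_derivative_def by (rule has_derivative_eq_rhs) auto
    qed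
    have c: "isCont (\<lambda>s. y \<bullet> newton_grad (s *\<^sub>R y - a)) s" for s
    proof -
      have "continuous_on UNIV (\<lambda>s. y \<bullet> newton_grad (s *\<^sub>R y - a))"
        by (intro continuous_intros continuous_on_compose2[OF continuous_on_newton_grad]) (use nz in auto)
      then show ?thesis by (simp add: continuous_on_eq_continuous_at)
    qed
    have "isCont (\<lambda>s. newton (s *\<^sub>R y - a)) 0" using d[of 0] by (rule DERIV_isCont)
    then have l0: "((\<lambda>s. newton (s *\<^sub>R y - a)) \<longlongrightarrow> newton a) (at_right 0)"
      using newton_minus_commute[of 0 a] by (simp add: isCont_def filterlim_at_split)
    have "y \<noteq> 0" using elim[rule_format, of 0] by simp
    have "filterlim (\<lambda>s. norm y * s - norm a) at_top at_top"
    proof -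
      have id: "filterlim (\<lambda>s::real. s) at_top at_top" by (simp add: filterlim_def filtermap_ident)
      have "filterlim (\<lambda>s. norm y * s) at_top at_top"
        using \<open>y \<noteq> 0\<close> filterlim_tendsto_pos_mult_at_top[OF tendsto_const _ id, of "norm y"] by simp
      then have "filterlim (\<lambda>s. - norm a + norm y * s) at_top at_top"
        by (rule filterlim_tendsto_add_at_top[OF tendsto_const])
      then show ?thesis by simp
    qed
    then have "filterlim (\<lambda>s. norm (s *\<^sub>R y - a)) at_top at_top"
    proof (rule filterlim_at_top_mono)
      show "eventually (\<lambda>s. norm y * s - norm a \<le> norm (s *\<^sub>R y - a)) at_top"
      proof (intro always_eventually allI)
        fix s :: real
        have "s * norm y \<le> norm (s *\<^sub>R y)" by (simp add: mult_right_mono)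
        then show "norm y * s - norm a \<le> norm (s *\<^sub>R y - a)"
          using norm_triangle_ineq2[of "s *\<^sub>R y" a] by (simp add: mult.commute)
      qed
    qed
    then have "((\<lambda>s. inverse (norm (s *\<^sub>R y - a))) \<longlongrightarrow> 0) at_top"
      by (rule tendsto_inverse_0_at_top)
    then have "((\<lambda>s. inverse (norm (s *\<^sub>R y - a)) * (1 / (4 * pi))) \<longlongrightarrow> 0 * (1 / (4 * pi))) at_top"
      by (intro tendsto_mult tendsto_const)
    moreover have "(\<lambda>s. inverse (norm (s *\<^sub>R y - a)) * (1 / (4 * pi))) = (\<lambda>s. newton (s *\<^sub>R y - a))"
      by (simp add: newton_def fun_eq_iff field_simps)
    ultimately have "((\<lambda>s. newton (s *\<^sub>R y - a)) \<longlongrightarrow> 0) at_top" by simp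
    with d c l0 show ?case by simp
  qed
qed measurable

lemma newton_grad_composition:
  fixes x y :: R3
  assumes "x \<noteq> y"
  shows "(LINT z|lborel. newton_grad (z - x) \<bullet> newton_grad (z - y)) = newton (x - y)"
proof -
  have "(LINT z|lborel. newton_grad (z - x) \<bullet> newton_grad (z - y))
      = (LINT z|lborel. newton_grad z \<bullet> newton_grad (z - (y - x)))"
    using integral_translate(1)[of "\<lambda>z. newton_grad (z - x) \<bullet> newton_grad (z - y)" x] by (simp add: algebra_simps)
  also have "\<dots> = newton (x - y)"
    using newton_flux_newton[of "y - x"] assms newton_minus_commute[of x y] by simp
  finally show ?thesis .
qed

text \<open>Integrability holds at almost every point only: the kernel is not locally square integrable, so the
  \<open>L\<^sup>2\<close> bound available for densities gives nothing pointwise.\<close>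

lemma AE_newton_field_integrable:
  assumes f: "integrable lborel f"
  shows "AE z in lborel. integrable lborel (\<lambda>y. f y *\<^sub>R newton_grad (z - y))"
proof -
  have "AE z in lborel. z \<in> cball 0 (real n) \<longrightarrow> integrable lborel (\<lambda>y. f y *\<^sub>R newton_grad (z - y))" for n
  proof -
    have "integrable (lborel \<Otimes>\<^sub>M lborel) (\<lambda>(x, y). (indicator (cball 0 (real n)) x * f y) *\<^sub>R newton_grad (x - y))"
    proof (rule kernel_pair_integrable[OF _ _ newton_grad_le_riesz _ _ _ _ f])
      show "integrable lborel (indicator (cball 0 (real n)) :: R3 \<Rightarrow> real)"
        by (intro integrable_indicator_compact compact_cball)
      show "\<bar>indicator (cball 0 (real n)) y\<bar> \<le> (1::real)" for y :: R3 by (simp add: indicator_def)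
      show "(indicator (cball 0 (real n)) :: R3 \<Rightarrow> real) \<in> borel_measurable borel"
        by (intro borel_measurable_indicator) simp
    qed auto
    from lborel_pair.AE_integrable_fst[OF this] show ?thesis
    proof eventually_elim
      case (elim z)
      show ?case
      proof
        assume "z \<in> cball 0 (real n)"
        with elim show "integrable lborel (\<lambda>y. f y *\<^sub>R newton_grad (z - y))" by simp
      qed
    qed
  qed
  then have "AE z in lborel. \<forall>n. z \<in> cball 0 (real n) \<longrightarrow> integrable lborel (\<lambda>y. f y *\<^sub>R newton_grad (z - y))"
    by (subst AE_all_countable) simp
  then show ?thesis
  proof eventually_elim
    case (elim z)
    obtain n where "norm z \<le> real n" using real_arch_simple by blast
    with elim show ?case unfolding mem_cball_0 by blast
  qed
qed

text \<open>Expand the square of the field into a double integral over pairs \<open>(x, y)\<close> and integrate in \<open>z\<close>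
  first: the composition of the two kernels is the Newtonian kernel. The absolute version of the
  same computation, with the composition bound for \<open>riesz 2\<close>, justifies the exchange.\<close>

theorem newton_field_energy:
  assumes f: "f \<in> L12"
  shows "integrable lborel (\<lambda>z. (norm (newton_field f z))\<^sup>2)"
    and "(LINT z|lborel. (norm (newton_field f z))\<^sup>2) = (LINT x|lborel. f x * convolution newton f x)"
proof -
  note [measurable] = L12_measurable[OF f]
  have fi: "integrable lborel f" using f by (simp add: L12_def)
  define T where "T p z = (f (fst p) * f (snd p)) * (newton_grad (z - fst p) \<bullet> newton_grad (z - snd p))"
    for p :: "R3 \<times> R3" and z
  have [measurable]: "case_prod T \<in> borel_measurable (lborel \<Otimes>\<^sub>M lborel)"
  proof -
    let ?M = "borel :: ((R3 \<times> R3) \<times> R3) measure"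
    have x: "(\<lambda>w. fst (fst w)) \<in> ?M \<rightarrow>\<^sub>M borel" and y: "(\<lambda>w. snd (fst w)) \<in> ?M \<rightarrow>\<^sub>M borel"
      and zx: "(\<lambda>w. snd w - fst (fst w)) \<in> ?M \<rightarrow>\<^sub>M borel" and zy: "(\<lambda>w. snd w - snd (fst w)) \<in> ?M \<rightarrow>\<^sub>M borel"
      by (intro borel_measurable_continuous_onI continuous_intros)+
    have "(\<lambda>w. (f (fst (fst w)) * f (snd (fst w)))
        * (newton_grad (snd w - fst (fst w)) \<bullet> newton_grad (snd w - snd (fst w)))) \<in> borel_measurable ?M"
      by (intro borel_measurable_times borel_measurable_inner measurable_compose[OF x] measurable_compose[OF y]
          measurable_compose[OF zx] measurable_compose[OF zy]) measurable
    then show ?thesis by (simp add: T_def lborel_prod case_prod_beta')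
  qed
  have inner: "(\<integral>\<^sup>+z. ennreal (norm (T (x, y) z)) \<partial>lborel) \<le> ennreal (48 * pi * \<bar>f x\<bar>) * ennreal (riesz 1 (x - y) * \<bar>f y\<bar>)"
    if "y \<noteq> x" for x y
  proof -
    have "(\<integral>\<^sup>+z. ennreal (norm (T (x, y) z)) \<partial>lborel)
        \<le> (\<integral>\<^sup>+z. ennreal \<bar>f x * f y\<bar> * ennreal (riesz 2 (z - x) * riesz 2 (z - y)) \<partial>lborel)"
    proof (intro nn_integral_mono)
      fix z
      have "\<bar>newton_grad (z - x) \<bullet> newton_grad (z - y)\<bar> \<le> riesz 2 (z - x) * riesz 2 (z - y)"
        by (rule order_trans[OF Cauchy_Schwarz_ineq2]) (intro mult_mono newton_grad_le_riesz, auto)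
      then have "\<bar>f x * f y\<bar> * \<bar>newton_grad (z - x) \<bullet> newton_grad (z - y)\<bar> \<le> \<bar>f x * f y\<bar> * (riesz 2 (z - x) * riesz 2 (z - y))"
        by (intro mult_left_mono) auto
      then show "ennreal (norm (T (x, y) z)) \<le> ennreal \<bar>f x * f y\<bar> * ennreal (riesz 2 (z - x) * riesz 2 (z - y))"
        by (simp add: T_def abs_mult ennreal_mult'[symmetric] ennreal_leI)
    qed
    also have "\<dots> = ennreal \<bar>f x * f y\<bar> * (\<integral>\<^sup>+z. ennreal (riesz 2 (z - x) * riesz 2 (z - y)) \<partial>lborel)"
      by (rule nn_integral_cmult) measurable
    also have "\<dots> \<le> ennreal \<bar>f x * f y\<bar> * ennreal (48 * pi * riesz 1 (x - y))"
      using that by (intro mult_left_mono nn_integral_riesz_composition) auto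
    also have "\<dots> = ennreal (48 * pi * \<bar>f x\<bar>) * ennreal (riesz 1 (x - y) * \<bar>f y\<bar>)"
      by (simp add: ennreal_mult'[symmetric] abs_mult mult_ac)
    finally show ?thesis .
  qed
  let ?C = "4 * pi + (LINT y|lborel. (f y)\<^sup>2) + (LINT y|lborel. \<bar>f y\<bar>)"
  \<comment> \<open>On the diagonal the integral over \<open>z\<close> diverges, but the diagonal is a null set.\<close>
  have AE_neq: "AE y in lborel. y \<noteq> x" for x :: R3
    using AE_not_on_affine_line[of x 0] by simp
  have Tint: "integrable (lborel \<Otimes>\<^sub>M lborel) (case_prod T)"
  proof (rule integrable_pairI)
    have "(\<integral>\<^sup>+p. (\<integral>\<^sup>+z. ennreal (norm (T p z)) \<partial>lborel) \<partial>lborel)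
        = (\<integral>\<^sup>+p. (\<integral>\<^sup>+z. ennreal (norm (T p z)) \<partial>lborel) \<partial>(lborel \<Otimes>\<^sub>M lborel))"
      by (simp add: lborel_prod)
    also have "\<dots> = (\<integral>\<^sup>+x. (\<integral>\<^sup>+y. (\<integral>\<^sup>+z. ennreal (norm (T (x, y) z)) \<partial>lborel) \<partial>lborel) \<partial>lborel)"
      by (rule lborel.nn_integral_fst[symmetric]) (simp add: lborel_prod)
    also have "\<dots> \<le> (\<integral>\<^sup>+x. (\<integral>\<^sup>+y. ennreal (48 * pi * \<bar>f x\<bar>) * ennreal (riesz 1 (x - y) * \<bar>f y\<bar>) \<partial>lborel) \<partial>lborel)"
    proof (rule nn_integral_mono)
      fix x
      show "(\<integral>\<^sup>+y. (\<integral>\<^sup>+z. ennreal (norm (T (x, y) z)) \<partial>lborel) \<partial>lborel)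
          \<le> (\<integral>\<^sup>+y. ennreal (48 * pi * \<bar>f x\<bar>) * ennreal (riesz 1 (x - y) * \<bar>f y\<bar>) \<partial>lborel)"
      proof (rule nn_integral_mono_AE)
        show "AE y in lborel. (\<integral>\<^sup>+z. ennreal (norm (T (x, y) z)) \<partial>lborel)
            \<le> ennreal (48 * pi * \<bar>f x\<bar>) * ennreal (riesz 1 (x - y) * \<bar>f y\<bar>)"
          using AE_neq[of x] by eventually_elim (rule inner)
      qed
    qed
    also have "\<dots> = (\<integral>\<^sup>+x. ennreal (48 * pi * \<bar>f x\<bar>) * (\<integral>\<^sup>+y. ennreal (riesz 1 (x - y) * \<bar>f y\<bar>) \<partial>lborel) \<partial>lborel)"
      by (intro nn_integral_cong nn_integral_cmult) measurable
    also have "\<dots> \<le> (\<integral>\<^sup>+x. ennreal (48 * pi * \<bar>f x\<bar>) * ennreal ?C \<partial>lborel)"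
      using f by (intro nn_integral_mono mult_left_mono nn_integral_riesz_1_L2) (auto simp: L12_def)
    also have "\<dots> = (\<integral>\<^sup>+x. ennreal (48 * pi * \<bar>f x\<bar>) \<partial>lborel) * ennreal ?C"
      by (intro nn_integral_multc) measurable
    also have "(\<integral>\<^sup>+x. ennreal (48 * pi * \<bar>f x\<bar>) \<partial>lborel) = ennreal (LINT x|lborel. 48 * pi * \<bar>f x\<bar>)"
      using fi by (intro nn_integral_eq_integral) auto
    also have "\<dots> * ennreal ?C < \<infinity>" by (simp add: ennreal_mult_less_top del: ennreal_plus)
    finally show "(\<integral>\<^sup>+p. (\<integral>\<^sup>+z. ennreal (norm (T p z)) \<partial>lborel) \<partial>lborel) < \<infinity>" .
  qed measurable
  have AE_field: "AE z in lborel. (LINT p|lborel. T p z) = (norm (newton_field f z))\<^sup>2"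
    using lborel_pair.AE_integrable_snd[OF Tint] AE_newton_field_integrable[OF fi]
  proof eventually_elim
    case (elim z)
    have ip: "integrable (lborel \<Otimes>\<^sub>M lborel) (\<lambda>(x, y). T (x, y) z)"
      using elim(1) by (simp add: lborel_prod case_prod_unfold)
    have "(LINT p|lborel. T p z) = (LINT x|lborel. (LINT y|lborel. T (x, y) z))"
      using lborel_pair.integral_fst[OF ip] by (simp add: lborel_prod case_prod_unfold)
    also have "\<dots> = (LINT x|lborel. (f x *\<^sub>R newton_grad (z - x)) \<bullet> newton_field f z)"
    proof (rule Bochner_Integration.integral_cong[OF refl])
      fix x
      have "(LINT y|lborel. T (x, y) z) = (LINT y|lborel. (f x *\<^sub>R newton_grad (z - x)) \<bullet> (f y *\<^sub>R newton_grad (z - y)))"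
        by (simp add: T_def mult_ac)
      also have "\<dots> = (f x *\<^sub>R newton_grad (z - x)) \<bullet> newton_field f z"
        unfolding newton_field_def by (rule integral_inner_right[OF elim(2)])
      finally show "(LINT y|lborel. T (x, y) z) = (f x *\<^sub>R newton_grad (z - x)) \<bullet> newton_field f z" .
    qed
    also have "\<dots> = newton_field f z \<bullet> newton_field f z"
      unfolding integral_inner_left[OF elim(2)] by (simp add: newton_field_def)
    finally show ?case by (simp add: power2_norm_eq_inner)
  qed
  show "integrable lborel (\<lambda>z. (norm (newton_field f z))\<^sup>2)"
    by (rule integrable_cong_AE_imp[OF lborel_pair.integrable_snd[OF Tint]]) (use AE_field in auto)
  have ip: "integrable (lborel \<Otimes>\<^sub>M lborel) (\<lambda>(x, y). LINT z|lborel. T (x, y) z)"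
    using lborel_pair.integrable_fst[OF Tint] by (simp add: lborel_prod case_prod_unfold)
  have "(LINT z|lborel. (norm (newton_field f z))\<^sup>2) = (LINT z|lborel. (LINT p|lborel. T p z))"
    using AE_field by (intro integral_cong_AE) auto
  also have "\<dots> = (LINT p|lborel. (LINT z|lborel. T p z))"
    by (rule lborel_pair.Fubini_integral[OF Tint])
  also have "\<dots> = (LINT x|lborel. (LINT y|lborel. (LINT z|lborel. T (x, y) z)))"
    using lborel_pair.integral_fst[OF ip] by (simp add: lborel_prod case_prod_unfold)
  also have "\<dots> = (LINT x|lborel. f x * convolution newton f x)"
  proof (rule Bochner_Integration.integral_cong[OF refl])
    fix x
    have "(LINT y|lborel. (LINT z|lborel. T (x, y) z)) = (LINT y|lborel. f x * (newton (x - y) * f y))"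
    proof (rule integral_cong_AE)
      show "AE y in lborel. (LINT z|lborel. T (x, y) z) = f x * (newton (x - y) * f y)"
        using AE_neq[of x]
      proof eventually_elim
        case (elim y)
        then show ?case using newton_grad_composition[of x y] by (simp add: T_def mult_ac)
      qed
    qed (simp_all add: T_def)
    then show "(LINT y|lborel. (LINT z|lborel. T (x, y) z)) = f x * convolution newton f x"
      by (simp add: convolution_def)
  qed
  finally show "(LINT z|lborel. (norm (newton_field f z))\<^sup>2) = (LINT x|lborel. f x * convolution newton f x)" .
qed

text \<open>Fubini reduces the equation to the flux identity around every pole.\<close>

lemma has_weak_div_newton_field:
  assumes f: "f \<in> L12"
  shows "has_weak_div (newton_field f) (\<lambda>x. - f x)"
  unfolding has_weak_div_def
proof (intro conjI allI impI)
  note [measurable] = L12_measurable[OF f]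
  have fi: "integrable lborel f" using f by (simp add: L12_def)
  show "locally_integrable (newton_field f)"
    using has_weak_grad_newton_conv[OF f] by (simp add: has_weak_grad_def)
  show "locally_integrable (\<lambda>x. - f x)" using fi by (intro locally_integrable_integrable) simp
  fix \<phi> assume \<phi>: "test_function \<phi>"
  obtain \<rho> B where "\<rho> > 0" and out: "\<And>x. norm x > \<rho> \<Longrightarrow> \<phi> x = 0" and outg: "\<And>x. norm x > \<rho> \<Longrightarrow> grad \<phi> x = 0"
    and B: "\<And>x. \<bar>\<phi> x\<bar> \<le> B" and Bg: "\<And>x. norm (grad \<phi> x) \<le> B" and [measurable]: "\<phi> \<in> borel_measurable borel" "grad \<phi> \<in> borel_measurable borel"
    by (rule test_functionE[OF \<phi>]) blast
  note ng = test_function_grad_integrable[OF \<phi>]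
  have p0: "integrable (lborel \<Otimes>\<^sub>M lborel) (\<lambda>(x, y). (norm (grad \<phi> x) * f y) *\<^sub>R newton_grad (x - y))"
    by (rule kernel_pair_integrable[OF _ _ newton_grad_le_riesz _ _ _ ng fi, where B = B]) (use Bg in auto)
  have p: "integrable (lborel \<Otimes>\<^sub>M lborel) (\<lambda>(x, y). f y * (newton_grad (x - y) \<bullet> grad \<phi> x))"
  proof (rule Bochner_Integration.integrable_bound[OF p0])
    show "AE p in lborel \<Otimes>\<^sub>M lborel. norm (case p of (x, y) \<Rightarrow> f y * (newton_grad (x - y) \<bullet> grad \<phi> x))
        \<le> norm (case p of (x, y) \<Rightarrow> (norm (grad \<phi> x) * f y) *\<^sub>R newton_grad (x - y))"
    proof (intro always_eventually allI)
      fix p :: "R3 \<times> R3"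
      obtain x y where p: "p = (x, y)" by (cases p)
      show "norm (case p of (x, y) \<Rightarrow> f y * (newton_grad (x - y) \<bullet> grad \<phi> x))
        \<le> norm (case p of (x, y) \<Rightarrow> (norm (grad \<phi> x) * f y) *\<^sub>R newton_grad (x - y))"
        using mult_left_mono[OF Cauchy_Schwarz_ineq2[of "newton_grad (x - y)" "grad \<phi> x"], of "\<bar>f y\<bar>"]
        by (simp add: p abs_mult mult_ac)
    qed
  qed measurable
  have "(LINT x|lborel. newton_field f x \<bullet> grad \<phi> x) = (LINT x|lborel. (LINT y|lborel. f y * (newton_grad (x - y) \<bullet> grad \<phi> x)))"
  proof (rule integral_cong_AE)
    show "AE x in lborel. newton_field f x \<bullet> grad \<phi> x = (LINT y|lborel. f y * (newton_grad (x - y) \<bullet> grad \<phi> x))"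
      using AE_newton_field_integrable[OF fi]
    proof eventually_elim
      case (elim x)
      show ?case unfolding newton_field_def integral_inner_left[OF elim, symmetric] by simp
    qed
  qed measurable
  also have "\<dots> = (LINT y|lborel. (LINT x|lborel. f y * (newton_grad (x - y) \<bullet> grad \<phi> x)))"
    using lborel_pair.Fubini_integral[OF p] by simp
  also have "\<dots> = (LINT y|lborel. f y * \<phi> y)"
    by (simp add: newton_flux_test_function[OF \<phi>])
  finally show "(LINT x|lborel. newton_field f x \<bullet> grad \<phi> x) = - (LINT x|lborel. - f x * \<phi> x)" by simp
qed

section \<open>The Coulomb form\<close>

definition coulomb :: "(R3 \<Rightarrow> real) \<Rightarrow> (R3 \<Rightarrow> real) \<Rightarrow> real" where
  "coulomb f g = (LINT x|lborel. f x * convolution newton g x)"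

lemma integrable_times_bounded:
  fixes f g :: "'a::euclidean_space \<Rightarrow> real"
  assumes "integrable lborel f" and [measurable]: "g \<in> borel_measurable borel" and "\<And>x. \<bar>g x\<bar> \<le> B"
  shows "integrable lborel (\<lambda>x. f x * g x)"
proof (rule Bochner_Integration.integrable_bound[where f = "\<lambda>x. B * f x"])
  show "integrable lborel (\<lambda>x. B * f x)" using assms(1) by simp
  show "(\<lambda>x. f x * g x) \<in> borel_measurable lborel" using assms(1) by measurable
  show "AE x in lborel. norm (f x * g x) \<le> norm (B * f x)"
  proof (intro always_eventually allI)
    fix x
    have "\<bar>g x\<bar> \<le> \<bar>B\<bar>" using assms(3)[of x] by linarith
    then show "norm (f x * g x) \<le> norm (B * f x)"
      using mult_left_mono[of "\<bar>g x\<bar>" "\<bar>B\<bar>" "\<bar>f x\<bar>"] by (simp add: abs_mult mult.commute)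
  qed
qed

lemma coulomb_integrable:
  assumes "f \<in> L12" "g \<in> L12"
  shows "integrable lborel (\<lambda>x. f x * convolution newton g x)"
proof -
  note [measurable] = L12_measurable[OF assms(2)]
  show ?thesis
    by (rule integrable_times_bounded[OF _ _ newton_conv_bound[OF assms(2)]]) (use assms in \<open>auto simp: L12_def\<close>)
qed

lemma newton_conv_linear:
  assumes "f \<in> L12" "g \<in> L12"
  shows "convolution newton (\<lambda>x. a * f x + b * g x) x = a * convolution newton f x + b * convolution newton g x"
proof -
  have "(LINT y|lborel. newton (x - y) * (a * f y + b * g y))
      = (LINT y|lborel. a * (newton (x - y) * f y) + b * (newton (x - y) * g y))"
    by (simp add: algebra_simps)
  also have "\<dots> = a * (LINT y|lborel. newton (x - y) * f y) + b * (LINT y|lborel. newton (x - y) * g y)"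
    using newton_conv_integrable(1)[OF assms(1)] newton_conv_integrable(1)[OF assms(2)] by simp
  finally show ?thesis by (simp add: convolution_def)
qed

lemma coulomb_linear_right:
  assumes "f \<in> L12" "g \<in> L12" "h \<in> L12"
  shows "coulomb h (\<lambda>x. a * f x + b * g x) = a * coulomb h f + b * coulomb h g"
proof -
  have "coulomb h (\<lambda>x. a * f x + b * g x)
      = (LINT x|lborel. a * (h x * convolution newton f x) + b * (h x * convolution newton g x))"
    by (simp add: coulomb_def newton_conv_linear[OF assms(1,2)] algebra_simps)
  then show ?thesis
    using coulomb_integrable[OF assms(3,1)] coulomb_integrable[OF assms(3,2)] by (simp add: coulomb_def)
qed

lemma coulomb_sym:
  assumes f: "f \<in> L12" and g: "g \<in> L12"
  shows "coulomb f g = coulomb g f"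
proof -
  note [measurable] = L12_measurable[OF f] L12_measurable[OF g]
  let ?C = "4 * pi + (LINT y|lborel. (g y)\<^sup>2) + (LINT y|lborel. \<bar>g y\<bar>)"
  have inner: "(\<integral>\<^sup>+y. ennreal (norm (f x * (newton (x - y) * g y))) \<partial>lborel) \<le> ennreal \<bar>f x\<bar> * ennreal ?C" for x
  proof -
    have "(\<integral>\<^sup>+y. ennreal (norm (f x * (newton (x - y) * g y))) \<partial>lborel)
        = ennreal \<bar>f x\<bar> * (\<integral>\<^sup>+y. ennreal (norm (newton (x - y) * g y)) \<partial>lborel)"
      by (subst nn_integral_cmult[symmetric]) (auto simp: abs_mult ennreal_mult')
    also have "\<dots> = ennreal \<bar>f x\<bar> * ennreal (LINT y|lborel. \<bar>newton (x - y) * g y\<bar>)"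
      using nn_integral_eq_integral[OF integrable_norm[OF newton_conv_integrable(1)[OF g]]] by simp
    also have "\<dots> \<le> ennreal \<bar>f x\<bar> * ennreal ?C"
      by (intro mult_left_mono ennreal_leI newton_conv_integrable(2)[OF g]) simp
    finally show ?thesis .
  qed
  have "integrable (lborel \<Otimes>\<^sub>M lborel) (\<lambda>(x, y). f x * (newton (x - y) * g y))"
  proof (rule integrable_pairI)
    have "(\<integral>\<^sup>+x. (\<integral>\<^sup>+y. ennreal (norm (f x * (newton (x - y) * g y))) \<partial>lborel) \<partial>lborel)
        \<le> (\<integral>\<^sup>+x. ennreal \<bar>f x\<bar> * ennreal ?C \<partial>lborel)"
      by (rule nn_integral_mono) (rule inner)
    also have "\<dots> = (\<integral>\<^sup>+x. ennreal \<bar>f x\<bar> \<partial>lborel) * ennreal ?C"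
      by (rule nn_integral_multc) measurable
    also have "(\<integral>\<^sup>+x. ennreal \<bar>f x\<bar> \<partial>lborel) = ennreal (LINT x|lborel. \<bar>f x\<bar>)"
      using f by (intro nn_integral_eq_integral) (auto simp: L12_def)
    also have "\<dots> * ennreal ?C < \<infinity>" by (simp add: ennreal_mult_less_top del: ennreal_plus)
    finally show "(\<integral>\<^sup>+x. (\<integral>\<^sup>+y. ennreal (norm (f x * (newton (x - y) * g y))) \<partial>lborel) \<partial>lborel) < \<infinity>" .
  qed measurable
  from lborel_pair.Fubini_integral[OF this]
  have "(LINT x|lborel. (LINT y|lborel. f x * (newton (x - y) * g y)))
      = (LINT y|lborel. (LINT x|lborel. f x * (newton (x - y) * g y)))" by simp
  also have "\<dots> = (LINT y|lborel. (LINT x|lborel. g y * (newton (y - x) * f x)))"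
    by (simp add: newton_minus_commute mult_ac)
  finally show ?thesis by (simp add: coulomb_def convolution_def)
qed

text \<open>Positivity is visible only on the side of the Dirichlet energy.\<close>

lemma coulomb_nonneg: "f \<in> L12 \<Longrightarrow> 0 \<le> coulomb f f"
  using newton_field_energy(2)[of f] by (simp add: coulomb_def flip: newton_field_energy(2))

lemma coulomb_square:
  assumes "f \<in> L12" "g \<in> L12"
  shows "coulomb (\<lambda>x. f x + t * g x) (\<lambda>x. f x + t * g x) = coulomb f f + 2 * t * coulomb g f + t\<^sup>2 * coulomb g g"
proof -
  let ?h = "\<lambda>x. 1 * f x + t * g x"
  have h: "?h \<in> L12" using assms by (rule L12_combination)
  have "coulomb ?h ?h = coulomb ?h f + t * coulomb ?h g"
    using coulomb_linear_right[OF assms h, of 1 t] by simp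
  also have "coulomb ?h f = coulomb f f + t * coulomb g f"
    unfolding coulomb_sym[OF h assms(1)] using coulomb_linear_right[OF assms assms(1), of 1 t]
    by (simp add: coulomb_sym[OF assms])
  also have "coulomb ?h g = coulomb g f + t * coulomb g g"
    unfolding coulomb_sym[OF h assms(2)] using coulomb_linear_right[OF assms assms(2), of 1 t] by simp
  finally show ?thesis by (simp add: power2_eq_square algebra_simps)
qed

section \<open>The energy as a quadratic functional\<close>

text \<open>Differences of densities of finite energy; the energy is expanded in this vector space.\<close>

definition moment :: "(R3 \<Rightarrow> real) set" where
  "moment = {f \<in> L12. integrable lborel (\<lambda>x. (norm x)\<^sup>2 * f x)}"

text \<open>The densities for which the energy is finite.\<close>

definition Adm :: "(R3 \<Rightarrow> real) set" where
  "Adm = P2 \<inter> L2"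

lemma moment_L12: "f \<in> moment \<Longrightarrow> f \<in> L12"
  by (simp add: moment_def)

lemma moment_combination: "f \<in> moment \<Longrightarrow> g \<in> moment \<Longrightarrow> (\<lambda>x. a * f x + b * g x) \<in> moment"
proof -
  assume f: "f \<in> moment" and g: "g \<in> moment"
  have "(\<lambda>x. (norm x)\<^sup>2 * (a * f x + b * g x)) = (\<lambda>x. a * ((norm x)\<^sup>2 * f x) + b * ((norm x)\<^sup>2 * g x))"
    by (simp add: algebra_simps)
  then show ?thesis using f g L12_combination by (simp add: moment_def)
qed

lemma moment_diff: "f \<in> moment \<Longrightarrow> g \<in> moment \<Longrightarrow> (\<lambda>x. f x - g x) \<in> moment"
  using moment_combination[of f g 1 "-1"] by simp

lemma moment_weight:
  assumes f: "f \<in> moment" and [measurable]: "W \<in> borel_measurable borel" and W: "\<And>x. \<bar>W x\<bar> \<le> C * (1 + (norm x)\<^sup>2)"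
  shows "integrable lborel (\<lambda>x. f x * W x)"
proof (rule Bochner_Integration.integrable_bound)
  note [measurable] = L12_measurable[OF moment_L12[OF f]]
  have "integrable lborel (\<lambda>x. C * (norm (f x) + norm ((norm x)\<^sup>2 * f x)))"
    using f by (intro integrable_mult_right Bochner_Integration.integrable_add integrable_norm) (auto simp: moment_def L12_def)
  then show "integrable lborel (\<lambda>x. C * (norm (f x) + norm ((norm x)\<^sup>2 * f x)))" .
  show "(\<lambda>x. f x * W x) \<in> borel_measurable lborel" by measurable
  show "AE x in lborel. norm (f x * W x) \<le> norm (C * (norm (f x) + norm ((norm x)\<^sup>2 * f x)))"
  proof (intro always_eventually allI)
    fix x
    have "norm (f x * W x) \<le> \<bar>f x\<bar> * (C * (1 + (norm x)\<^sup>2))"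
      using mult_left_mono[OF W[of x], of "\<bar>f x\<bar>"] by (simp add: abs_mult)
    also have "\<dots> = C * (norm (f x) + norm ((norm x)\<^sup>2 * f x))" by (simp add: abs_mult algebra_simps)
    finally show "norm (f x * W x) \<le> norm (C * (norm (f x) + norm ((norm x)\<^sup>2 * f x)))" by simp
  qed
qed

lemma AdmD:
  assumes "u \<in> Adm"
  shows "u \<in> moment" "u \<in> L12" "(LINT x|lborel. u x) = 1" "AE x in lborel. 0 \<le> u x"
    "integrable lborel u" "integrable lborel (\<lambda>x. (norm x)\<^sup>2 * u x)" "u \<in> borel_measurable borel"
    "integrable lborel (\<lambda>x. (u x)\<^sup>2)"
  using assms by (auto simp: Adm_def P2_def L2_def moment_def L12_def has_bochner_integral_iff)

lemma AdmI:
  assumes "integrable lborel u" "(LINT x|lborel. u x) = 1" "AE x in lborel. 0 \<le> u x"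
    "integrable lborel (\<lambda>x. (norm x)\<^sup>2 * u x)" "integrable lborel (\<lambda>x. (u x)\<^sup>2)"
  shows "u \<in> Adm"
  using assms by (auto simp: Adm_def P2_def L2_def has_bochner_integral_iff)

lemma Adm_convex:
  assumes u: "u \<in> Adm" and u': "u' \<in> Adm" and t: "0 \<le> t" "t \<le> 1"
  shows "(\<lambda>x. u x + t * (u' x - u x)) \<in> Adm"
proof -
  have eq: "(\<lambda>x. u x + t * (u' x - u x)) = (\<lambda>x. (1 - t) * u x + t * u' x)" by (simp add: algebra_simps)
  have m: "(\<lambda>x. (1 - t) * u x + t * u' x) \<in> moment"
    by (rule moment_combination[OF AdmD(1)[OF u] AdmD(1)[OF u']])
  show ?thesis unfolding eq
  proof (rule AdmI)
    show "AE x in lborel. 0 \<le> (1 - t) * u x + t * u' x"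
      using AdmD(4)[OF u] AdmD(4)[OF u'] by eventually_elim (use t in auto)
    show "(LINT x|lborel. (1 - t) * u x + t * u' x) = 1"
      using AdmD(3,5)[OF u] AdmD(3,5)[OF u'] by simp
  qed (use m in \<open>auto simp: moment_def L12_def\<close>)
qed

text \<open>The upper growth makes the confinement energy of a density with second moment finite, the lower one
  turns a bound on the energy into a bound on second moments.\<close>

locale confinement =
  fixes U V :: "R3 \<Rightarrow> real" and \<epsilon> a b C :: real
  assumes contU: "continuous_on UNIV U" and contV: "continuous_on UNIV V"
    and growthU: "\<And>x. \<bar>U x\<bar> \<le> C * (1 + (norm x)\<^sup>2)" and growthV: "\<And>x. \<bar>V x\<bar> \<le> C * (1 + (norm x)\<^sup>2)"
    and coerciveU: "\<And>x. a * (norm x)\<^sup>2 - b \<le> U x" and coerciveV: "\<And>x. a * (norm x)\<^sup>2 - b \<le> V x"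
    and a_pos: "0 < a" and eps_pos: "0 < \<epsilon>"
begin

lemma measurable_UV [measurable]: "U \<in> borel_measurable borel" "V \<in> borel_measurable borel"
  using contU contV by (auto intro: borel_measurable_continuous_onI)

definition J :: "(R3 \<Rightarrow> real) \<Rightarrow> (R3 \<Rightarrow> real) \<Rightarrow> real" where
  "J u v = (LINT x|lborel. (u x)\<^sup>2) + (LINT x|lborel. (v x)\<^sup>2) + (LINT x|lborel. u x * U x)
     + (LINT x|lborel. v x * V x) + \<epsilon> / 2 * coulomb (\<lambda>x. u x - v x) (\<lambda>x. u x - v x)"

text \<open>The energy is a quadratic polynomial along every segment; \<open>dJ\<close> and \<open>N\<close> are its coefficients of
  first and second order.\<close>

definition dJ :: "(R3 \<Rightarrow> real) \<Rightarrow> (R3 \<Rightarrow> real) \<Rightarrow> (R3 \<Rightarrow> real) \<Rightarrow> (R3 \<Rightarrow> real) \<Rightarrow> real" where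
  "dJ u v p q = (LINT x|lborel. p x * (2 * u x + U x + \<epsilon> * potential u v x))
     + (LINT x|lborel. q x * (2 * v x + V x - \<epsilon> * potential u v x))"

definition N :: "(R3 \<Rightarrow> real) \<Rightarrow> (R3 \<Rightarrow> real) \<Rightarrow> real" where
  "N p q = (LINT x|lborel. (p x)\<^sup>2) + (LINT x|lborel. (q x)\<^sup>2)
     + \<epsilon> / 2 * coulomb (\<lambda>x. p x - q x) (\<lambda>x. p x - q x)"

text \<open>The only place where the weak gradient in the energy is evaluated: almost everywhere it is the field
  of the density, whose energy is the Coulomb energy.\<close>

lemma energy_eq_J:
  assumes u: "u \<in> Adm" and v: "v \<in> Adm"
  shows "energy U V \<epsilon> (u, v) = ereal (J u v)"
proof -
  let ?f = "\<lambda>x. u x - v x"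
  have f: "?f \<in> L12" using AdmD(2)[OF u] AdmD(2)[OF v] by (rule L12_diff)
  note [measurable] = L12_measurable[OF f]
  have wg: "has_weak_grad (potential u v) (newton_field ?f)"
    using has_weak_grad_newton_conv[OF f] by (simp add: potential_def)
  have AEw: "AE x in lborel. (norm (weak_grad (potential u v) x))\<^sup>2 = (norm (newton_field ?f x))\<^sup>2"
    using AE_weak_grad_eq(1)[OF wg] by eventually_elim simp
  note [measurable] = AE_weak_grad_eq(2)[OF wg]
  have iw: "integrable lborel (\<lambda>x. (norm (weak_grad (potential u v) x))\<^sup>2)"
    by (rule integrable_cong_AE_imp[OF newton_field_energy(1)[OF f]]) (use AEw in \<open>auto elim: eventually_mono\<close>)
  have "(LINT x|lborel. (norm (weak_grad (potential u v) x))\<^sup>2) = (LINT x|lborel. (norm (newton_field ?f x))\<^sup>2)"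
    by (rule integral_cong_AE) (use AEw in auto)
  also have "\<dots> = coulomb ?f ?f" using newton_field_energy(2)[OF f] by (simp add: coulomb_def)
  finally have w: "(LINT x|lborel. (norm (weak_grad (potential u v) x))\<^sup>2) = coulomb ?f ?f" .
  have iU: "integrable lborel (\<lambda>x. u x * U x)" and iV: "integrable lborel (\<lambda>x. v x * V x)"
    using moment_weight[OF AdmD(1)[OF u] _ growthU] moment_weight[OF AdmD(1)[OF v] _ growthV] by auto
  have "(LINT x|lborel. (u x)\<^sup>2 + (v x)\<^sup>2 + u x * U x + v x * V x + \<epsilon> / 2 * (norm (weak_grad (potential u v) x))\<^sup>2)
      = J u v"
    unfolding J_def w[symmetric]
    using AdmD(8)[OF u] AdmD(8)[OF v] iU iV iw by simp
  moreover have "u \<in> L2" "v \<in> L2" using u v by (auto simp: Adm_def)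
  ultimately show ?thesis by (simp add: energy_def)
qed

lemma energy_outside:
  assumes "(u, v) \<in> X" "\<not> (u \<in> Adm \<and> v \<in> Adm)"
  shows "energy U V \<epsilon> (u, v) = \<infinity>"
  using assms by (auto simp: energy_def X_def Adm_def)

lemma Adm_X: "u \<in> Adm \<Longrightarrow> v \<in> Adm \<Longrightarrow> (u, v) \<in> X"
  by (simp add: X_def Adm_def)

lemma N_ge:
  assumes "p \<in> L12" "q \<in> L12"
  shows "(LINT x|lborel. (p x)\<^sup>2) + (LINT x|lborel. (q x)\<^sup>2) \<le> N p q"
  using coulomb_nonneg[OF L12_diff[OF assms]] eps_pos by (simp add: N_def)

lemma integral_square_nonneg: "0 \<le> (LINT x|lborel. (p x :: real)\<^sup>2)"
  by (rule integral_nonneg_AE) simp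

lemma N_nonneg:
  assumes "p \<in> L12" "q \<in> L12" shows "0 \<le> N p q"
  using N_ge[OF assms] integral_square_nonneg[of p] integral_square_nonneg[of q] by linarith

lemma potential_bound:
  assumes "u \<in> L12" "v \<in> L12"
  shows "\<exists>M. \<forall>x. \<bar>potential u v x\<bar> \<le> M"
  using newton_conv_bound[OF L12_diff[OF assms]] unfolding potential_def by blast

lemma variation_integrable:
  assumes "u \<in> moment" "v \<in> moment" "p \<in> moment"
  shows "integrable lborel (\<lambda>x. p x * (2 * u x + U x + \<epsilon> * potential u v x))"
    and "integrable lborel (\<lambda>x. p x * (2 * v x + V x - \<epsilon> * potential u v x))"
    and "(LINT x|lborel. p x * (2 * u x + U x + \<epsilon> * potential u v x))
      = 2 * (LINT x|lborel. u x * p x) + (LINT x|lborel. p x * U x) + \<epsilon> * coulomb p (\<lambda>x. u x - v x)"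
    and "(LINT x|lborel. p x * (2 * v x + V x - \<epsilon> * potential u v x))
      = 2 * (LINT x|lborel. v x * p x) + (LINT x|lborel. p x * V x) - \<epsilon> * coulomb p (\<lambda>x. u x - v x)"
proof -
  have L: "u \<in> L12" "v \<in> L12" "p \<in> L12" using assms by (auto intro: moment_L12)
  have f: "(\<lambda>x. u x - v x) \<in> L12" using L by (intro L12_diff)
  have 1: "integrable lborel (\<lambda>x. u x * p x)" "integrable lborel (\<lambda>x. v x * p x)"
    using L by (auto intro: L12_product)
  have 2: "integrable lborel (\<lambda>x. p x * U x)" "integrable lborel (\<lambda>x. p x * V x)"
    using moment_weight[OF assms(3) _ growthU] moment_weight[OF assms(3) _ growthV] by auto
  have 3: "integrable lborel (\<lambda>x. p x * potential u v x)"
    unfolding potential_def using coulomb_integrable[OF L(3) f] .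
  have eq1: "(\<lambda>x. p x * (2 * u x + U x + \<epsilon> * potential u v x))
      = (\<lambda>x. 2 * (u x * p x) + p x * U x + \<epsilon> * (p x * potential u v x))"
    and eq2: "(\<lambda>x. p x * (2 * v x + V x - \<epsilon> * potential u v x))
      = (\<lambda>x. 2 * (v x * p x) + p x * V x - \<epsilon> * (p x * potential u v x))"
    by (simp_all add: algebra_simps)
  show "integrable lborel (\<lambda>x. p x * (2 * u x + U x + \<epsilon> * potential u v x))"
    and "integrable lborel (\<lambda>x. p x * (2 * v x + V x - \<epsilon> * potential u v x))"
    unfolding eq1 eq2 using 1 2 3 by simp_all
  have "coulomb p (\<lambda>x. u x - v x) = (LINT x|lborel. p x * potential u v x)"
    by (simp add: coulomb_def potential_def)
  then show "(LINT x|lborel. p x * (2 * u x + U x + \<epsilon> * potential u v x))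
      = 2 * (LINT x|lborel. u x * p x) + (LINT x|lborel. p x * U x) + \<epsilon> * coulomb p (\<lambda>x. u x - v x)"
    and "(LINT x|lborel. p x * (2 * v x + V x - \<epsilon> * potential u v x))
      = 2 * (LINT x|lborel. v x * p x) + (LINT x|lborel. p x * V x) - \<epsilon> * coulomb p (\<lambda>x. u x - v x)"
    unfolding eq1 eq2 using 1 2 3 by simp_all
qed

lemma J_expansion:
  assumes u: "u \<in> moment" and v: "v \<in> moment" and p: "p \<in> moment" and q: "q \<in> moment"
  shows "J (\<lambda>x. u x + t * p x) (\<lambda>x. v x + t * q x) = J u v + t * dJ u v p q + t\<^sup>2 * N p q"
proof -
  have L: "u \<in> L12" "v \<in> L12" "p \<in> L12" "q \<in> L12" using assms by (auto intro: moment_L12)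
  have sq: "(LINT x|lborel. (f x + t * g x)\<^sup>2) = (LINT x|lborel. (f x)\<^sup>2) + 2 * t * (LINT x|lborel. f x * g x) + t\<^sup>2 * (LINT x|lborel. (g x)\<^sup>2)"
    if "f \<in> L12" "g \<in> L12" for f g
  proof -
    have "(\<lambda>x. (f x + t * g x)\<^sup>2) = (\<lambda>x. (f x)\<^sup>2 + (2 * t) * (f x * g x) + t\<^sup>2 * (g x)\<^sup>2)"
      by (rule ext) (simp add: power2_sum power_mult_distrib algebra_simps)
    then show ?thesis using that L12_product[OF that] by (simp add: L12_def)
  qed
  have lin: "(LINT x|lborel. (f x + t * g x) * W x) = (LINT x|lborel. f x * W x) + t * (LINT x|lborel. g x * W x)"
    if "integrable lborel (\<lambda>x. f x * W x)" "integrable lborel (\<lambda>x. g x * W x)" for f g W :: "R3 \<Rightarrow> real"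
  proof -
    have "(\<lambda>x. (f x + t * g x) * W x) = (\<lambda>x. f x * W x + t * (g x * W x))" by (simp add: algebra_simps)
    then show ?thesis using that by simp
  qed
  have f: "(\<lambda>x. u x - v x) \<in> L12" and g: "(\<lambda>x. p x - q x) \<in> L12" using L by (auto intro: L12_diff)
  have eq: "(\<lambda>x. (u x + t * p x) - (v x + t * q x)) = (\<lambda>x. (u x - v x) + t * (p x - q x))"
    by (simp add: algebra_simps)
  have "coulomb (\<lambda>x. p x - q x) (\<lambda>x. u x - v x) = coulomb (\<lambda>x. u x - v x) (\<lambda>x. p x - q x)"
    by (rule coulomb_sym[OF g f])
  also have "\<dots> = coulomb (\<lambda>x. u x - v x) p - coulomb (\<lambda>x. u x - v x) q"
    using coulomb_linear_right[OF L(3,4) f, of 1 "-1"] by simp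
  finally have cg: "coulomb (\<lambda>x. p x - q x) (\<lambda>x. u x - v x) = coulomb p (\<lambda>x. u x - v x) - coulomb q (\<lambda>x. u x - v x)"
    by (simp add: coulomb_sym[OF f L(3)] coulomb_sym[OF f L(4)])
  show ?thesis
    unfolding J_def dJ_def N_def eq coulomb_square[OF f g] cg variation_integrable(3)[OF u v p] variation_integrable(4)[OF u v q]
      sq[OF L(1,3)] sq[OF L(2,4)]
      lin[OF moment_weight[OF u measurable_UV(1) growthU] moment_weight[OF p measurable_UV(1) growthU]]
      lin[OF moment_weight[OF v measurable_UV(2) growthV] moment_weight[OF q measurable_UV(2) growthV]]
    by (simp add: field_simps)
qed

lemma J_at:
  assumes "u \<in> moment" "v \<in> moment" "u' \<in> moment" "v' \<in> moment"
  shows "J u' v' = J u v + dJ u v (\<lambda>x. u' x - u x) (\<lambda>x. v' x - v x) + N (\<lambda>x. u' x - u x) (\<lambda>x. v' x - v x)"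
  using J_expansion[OF assms(1,2) moment_diff[OF assms(3,1)] moment_diff[OF assms(4,2)], of 1] by simp

text \<open>Uniform convexity, in the form of the parallelogram identity.\<close>

lemma J_midpoint:
  assumes "u \<in> moment" "v \<in> moment" "u' \<in> moment" "v' \<in> moment"
  shows "J (\<lambda>x. u x + 1/2 * (u' x - u x)) (\<lambda>x. v x + 1/2 * (v' x - v x))
     = (J u v + J u' v') / 2 - N (\<lambda>x. u' x - u x) (\<lambda>x. v' x - v x) / 4"
  using J_expansion[OF assms(1,2) moment_diff[OF assms(3,1)] moment_diff[OF assms(4,2)], of "1/2"] J_at[OF assms]
  by (simp add: power2_eq_square field_simps)

lemma J_lower_bound:
  assumes u: "u \<in> Adm" and v: "v \<in> Adm"
  shows "a * (LINT x|lborel. (norm x)\<^sup>2 * u x) + a * (LINT x|lborel. (norm x)\<^sup>2 * v x) - 2 * b \<le> J u v"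
proof -
  have w: "a * (LINT x|lborel. (norm x)\<^sup>2 * f x) - b \<le> (LINT x|lborel. f x * W x)"
    if f: "f \<in> Adm" and W: "\<And>x. a * (norm x)\<^sup>2 - b \<le> W x" "\<And>x. \<bar>W x\<bar> \<le> C * (1 + (norm x)\<^sup>2)"
      and [measurable]: "W \<in> borel_measurable borel" for f W
  proof -
    have "a * (LINT x|lborel. (norm x)\<^sup>2 * f x) - b = (LINT x|lborel. a * ((norm x)\<^sup>2 * f x) - b * f x)"
      using AdmD(3,5,6)[OF f] by simp
    also have "\<dots> \<le> (LINT x|lborel. f x * W x)"
    proof (rule integral_mono_AE)
      show "integrable lborel (\<lambda>x. a * ((norm x)\<^sup>2 * f x) - b * f x)" using AdmD(5,6)[OF f] by simp
      show "integrable lborel (\<lambda>x. f x * W x)" by (rule moment_weight[OF AdmD(1)[OF f] _ W(2)]) measurable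
      show "AE x in lborel. a * ((norm x)\<^sup>2 * f x) - b * f x \<le> f x * W x"
        using AdmD(4)[OF f]
      proof eventually_elim
        case (elim x)
        from mult_left_mono[OF W(1)[of x] elim] show ?case by (simp add: algebra_simps)
      qed
    qed
    finally show ?thesis .
  qed
  have "0 \<le> \<epsilon> / 2 * coulomb (\<lambda>x. u x - v x) (\<lambda>x. u x - v x)"
    using coulomb_nonneg[OF L12_diff[OF AdmD(2)[OF u] AdmD(2)[OF v]]] eps_pos by simp
  then show ?thesis
    using w[OF u coerciveU growthU measurable_UV(1)] w[OF v coerciveV growthV measurable_UV(2)] integral_square_nonneg[of u] integral_square_nonneg[of v]
    unfolding J_def by linarith
qed

definition minimizer :: "(R3 \<Rightarrow> real) \<Rightarrow> (R3 \<Rightarrow> real) \<Rightarrow> bool" where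
  "minimizer u v \<longleftrightarrow> u \<in> Adm \<and> v \<in> Adm \<and> (\<forall>u'\<in>Adm. \<forall>v'\<in>Adm. J u v \<le> J u' v')"

text \<open>Along the segment to the competitor the energy is \<open>J + t dJ + t\<^sup>2 N\<close>, which would drop below \<open>J\<close>
  for small \<open>t\<close> if \<open>dJ\<close> were negative.\<close>

lemma minimizer_first_variation:
  assumes m: "minimizer u v" and u': "u' \<in> Adm" and v': "v' \<in> Adm"
  shows "0 \<le> dJ u v (\<lambda>x. u' x - u x) (\<lambda>x. v' x - v x)"
proof -
  have u: "u \<in> Adm" and v: "v \<in> Adm" using m by (auto simp: minimizer_def)
  let ?d = "dJ u v (\<lambda>x. u' x - u x) (\<lambda>x. v' x - v x)" and ?N = "N (\<lambda>x. u' x - u x) (\<lambda>x. v' x - v x)"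
  note mom = AdmD(1)[OF u] AdmD(1)[OF v] moment_diff[OF AdmD(1)[OF u'] AdmD(1)[OF u]] moment_diff[OF AdmD(1)[OF v'] AdmD(1)[OF v]]
  have le: "- (t * ?N) \<le> ?d" if t: "0 < t" "t \<le> 1" for t
  proof -
    have "J u v \<le> J (\<lambda>x. u x + t * (u' x - u x)) (\<lambda>x. v x + t * (v' x - v x))"
      using m Adm_convex[OF u u'] Adm_convex[OF v v'] t by (simp add: minimizer_def)
    then have "0 \<le> t * (?d + t * ?N)"
      unfolding J_expansion[OF mom] by (simp add: power2_eq_square algebra_simps)
    then show ?thesis using t by (simp add: zero_le_mult_iff)
  qed
  have "0 \<le> ?N" by (intro N_nonneg moment_L12 mom)
  show ?thesis
  proof (rule ccontr)
    assume neg: "\<not> 0 \<le> ?d"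
    \<comment> \<open>Small enough for \<open>t N\<close> to stay below \<open>- dJ\<close>, also when \<open>N = 0\<close>.\<close>
    define t where "t = min 1 (- ?d / (2 * (?N + 1)))"
    have "0 < - ?d / (2 * (?N + 1))" using neg \<open>0 \<le> ?N\<close> by (intro divide_pos_pos) auto
    then have "0 < t" "t \<le> 1" by (auto simp: t_def)
    have "t * ?N \<le> (- ?d / (2 * (?N + 1))) * ?N"
      using \<open>0 \<le> ?N\<close> by (intro mult_right_mono) (auto simp: t_def)
    also have "\<dots> < - ?d"
    proof -
      have "?N / (2 * (?N + 1)) < 1" using \<open>0 \<le> ?N\<close> by (simp add: divide_less_eq)
      then have "(- ?d) * (?N / (2 * (?N + 1))) < (- ?d) * 1" using neg by (intro mult_strict_left_mono) auto
      then show ?thesis by simp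
    qed
    finally show False using le[OF \<open>0 < t\<close> \<open>t \<le> 1\<close>] by linarith
  qed
qed

lemma minimizer_unique:
  assumes m: "minimizer u v" and u': "u' \<in> Adm" and v': "v' \<in> Adm" and le: "J u' v' \<le> J u v"
  shows "AE x in lborel. u' x = u x" "AE x in lborel. v' x = v x"
proof -
  have u: "u \<in> Adm" and v: "v \<in> Adm" using m by (auto simp: minimizer_def)
  let ?p = "\<lambda>x. u' x - u x" and ?q = "\<lambda>x. v' x - v x"
  have L: "?p \<in> L12" "?q \<in> L12" using L12_diff AdmD(2) u v u' v' by auto
  have "N ?p ?q \<le> 0"
    using J_at[OF AdmD(1)[OF u] AdmD(1)[OF v] AdmD(1)[OF u'] AdmD(1)[OF v']] le
      minimizer_first_variation[OF m u' v'] by linarith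
  then have "(LINT x|lborel. (?p x)\<^sup>2) = 0" "(LINT x|lborel. (?q x)\<^sup>2) = 0"
    using N_ge[OF L] integral_square_nonneg[of ?p] integral_square_nonneg[of ?q] by linarith+
  then have "AE x in lborel. (?p x)\<^sup>2 = 0" "AE x in lborel. (?q x)\<^sup>2 = 0"
    using L integral_nonneg_eq_0_iff_AE[of lborel "\<lambda>x. (?p x)\<^sup>2"] integral_nonneg_eq_0_iff_AE[of lborel "\<lambda>x. (?q x)\<^sup>2"]
    by (auto simp: L12_def)
  then show "AE x in lborel. u' x = u x" "AE x in lborel. v' x = v x" by auto
qed

end

section \<open>Existence of a minimizer\<close>

lemma Fatou_real:
  fixes f :: "nat \<Rightarrow> 'a::euclidean_space \<Rightarrow> real"
  assumes f: "\<And>n. integrable lborel (f n)" "\<And>n. AE x in lborel. 0 \<le> f n x"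
    and g: "g \<in> borel_measurable lborel" and lim: "AE x in lborel. (\<lambda>n. f n x) \<longlonglongrightarrow> g x"
    and bound: "\<And>n. (LINT x|lborel. f n x) \<le> B"
  shows "integrable lborel g" "(LINT x|lborel. g x) \<le> B"
proof -
  have nn: "AE x in lborel. \<forall>n. 0 \<le> f n x" using f(2) by (subst AE_all_countable) simp
  have g0: "AE x in lborel. 0 \<le> g x"
    using nn lim by eventually_elim (auto intro: LIMSEQ_le_const)
  have B: "0 \<le> B" using bound[of 0] integral_nonneg_AE[OF f(2)[of 0]] by linarith
  have "(\<integral>\<^sup>+x. ennreal (g x) \<partial>lborel) = (\<integral>\<^sup>+x. liminf (\<lambda>n. ennreal (f n x)) \<partial>lborel)"
  proof (rule nn_integral_cong_AE)
    show "AE x in lborel. ennreal (g x) = liminf (\<lambda>n. ennreal (f n x))"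
      using lim
    proof eventually_elim
      case (elim x)
      have "(\<lambda>n. ennreal (f n x)) \<longlonglongrightarrow> ennreal (g x)" using elim by (rule tendsto_ennrealI)
      then show ?case by (metis lim_imp_Liminf trivial_limit_sequentially)
    qed
  qed
  also have "\<dots> \<le> liminf (\<lambda>n. \<integral>\<^sup>+x. ennreal (f n x) \<partial>lborel)"
    by (rule nn_integral_liminf) (use f(1) in auto)
  also have "\<dots> \<le> ennreal B"
  proof -
    have "(\<integral>\<^sup>+x. ennreal (f n x) \<partial>lborel) \<le> ennreal B" for n
      using nn_integral_eq_integral[OF f(1,2), of n] bound[of n] by (simp add: ennreal_leI)
    then have "liminf (\<lambda>n. \<integral>\<^sup>+x. ennreal (f n x) \<partial>lborel) \<le> liminf (\<lambda>n::nat. ennreal B)"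
      by (intro Liminf_mono always_eventually) auto
    then show ?thesis by (simp add: Liminf_const)
  qed
  finally have *: "(\<integral>\<^sup>+x. ennreal (g x) \<partial>lborel) \<le> ennreal B" .
  show i: "integrable lborel g"
    by (rule integrableI_nonneg[OF g g0]) (use * in \<open>auto intro: le_less_trans\<close>)
  show "(LINT x|lborel. g x) \<le> B"
    using * nn_integral_eq_integral[OF i g0] B by simp
qed

text \<open>The increments decay so fast that they stay integrable with the weights \<open>2\<^sup>n\<close>, so at almost every
  point they are bounded by a geometric sequence. Fatou then transfers the bounds to the limit.\<close>

lemma fast_Cauchy_L2:
  fixes u :: "nat \<Rightarrow> 'a::euclidean_space \<Rightarrow> real"
  assumes meas [measurable]: "\<And>n. u n \<in> borel_measurable borel"
    and int: "\<And>m n. n \<le> m \<Longrightarrow> integrable lborel (\<lambda>x. (u m x - u n x)\<^sup>2)"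
    and bound: "\<And>m n. n \<le> m \<Longrightarrow> (LINT x|lborel. (u m x - u n x)\<^sup>2) \<le> K * (1/4) ^ n"
  obtains w where "w \<in> borel_measurable borel" "AE x in lborel. (\<lambda>n. u n x) \<longlonglongrightarrow> w x"
    "\<And>n. integrable lborel (\<lambda>x. (w x - u n x)\<^sup>2)" "\<And>n. (LINT x|lborel. (w x - u n x)\<^sup>2) \<le> K * (1/4) ^ n"
proof -
  have K: "0 \<le> K" using bound[of 0 0] by simp
  let ?d = "\<lambda>n x. (u (Suc n) x - u n x)\<^sup>2"
  have "(\<integral>\<^sup>+x. (\<Sum>n. ennreal (2 ^ n * ?d n x)) \<partial>lborel) = (\<Sum>n. \<integral>\<^sup>+x. ennreal (2 ^ n * ?d n x) \<partial>lborel)"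
    by (rule nn_integral_suminf) measurable
  also have "\<dots> \<le> (\<Sum>n. ennreal (K * (1/2) ^ n))"
  proof (rule suminf_le)
    fix n
    have "(\<integral>\<^sup>+x. ennreal (2 ^ n * ?d n x) \<partial>lborel) = ennreal (LINT x|lborel. 2 ^ n * ?d n x)"
      using int[of n "Suc n"] by (intro nn_integral_eq_integral) auto
    also have "(LINT x|lborel. 2 ^ n * ?d n x) \<le> 2 ^ n * (K * (1/4) ^ n)"
      using bound[of n "Suc n"] by simp
    also have "2 ^ n * (K * (1/4) ^ n) = K * (1/2 :: real) ^ n"
      by (simp add: power_divide power_mult_distrib[symmetric] field_simps flip: power_mult_distrib)
    finally show "(\<integral>\<^sup>+x. ennreal (2 ^ n * ?d n x) \<partial>lborel) \<le> ennreal (K * (1/2) ^ n)"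
      by (simp add: ennreal_leI)
  qed auto
  also have "\<dots> < \<infinity>"
  proof -
    have "summable (\<lambda>n. K * (1/2 :: real) ^ n)" by (intro summable_mult summable_geometric) simp
    then have "(\<Sum>n. ennreal (K * (1/2) ^ n)) = ennreal (\<Sum>n. K * (1/2 :: real) ^ n)"
      using K by (intro suminf_ennreal2) auto
    then show ?thesis by simp
  qed
  finally have "(\<integral>\<^sup>+x. (\<Sum>n. ennreal (2 ^ n * ?d n x)) \<partial>lborel) \<noteq> \<infinity>" by simp
  then have "AE x in lborel. (\<Sum>n. ennreal (2 ^ n * ?d n x)) \<noteq> \<infinity>"
    by (intro nn_integral_PInf_AE) auto
  then have conv: "AE x in lborel. convergent (\<lambda>n. u n x)"
  proof eventually_elim
    case (elim x)
    define c where "c = enn2real (\<Sum>n. ennreal (2 ^ n * ?d n x))"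
    have c: "ennreal c = (\<Sum>n. ennreal (2 ^ n * ?d n x))" using elim by (simp add: c_def less_top)
    have c0: "0 \<le> c" by (simp add: c_def)
    have le: "\<bar>u (Suc n) x - u n x\<bar> \<le> sqrt c * (sqrt (1/2)) ^ n" for n
    proof -
      have "(\<Sum>i\<in>{n}. ennreal (2 ^ i * ?d i x)) \<le> (\<Sum>n. ennreal (2 ^ n * ?d n x))"
        by (rule sum_le_suminf) auto
      then have "2 ^ n * ?d n x \<le> c" using c0 by (simp add: c[symmetric])
      then have "?d n x \<le> c * (1/2) ^ n" by (simp add: field_simps power_divide)
      then have "sqrt (?d n x) \<le> sqrt (c * (1/2) ^ n)" by (rule real_sqrt_le_mono)
      also have "sqrt (c * (1/2) ^ n) = sqrt c * (sqrt (1/2)) ^ n" by (simp only: real_sqrt_mult real_sqrt_power)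
      finally show ?thesis by (simp only: real_sqrt_abs)
    qed
    have "summable (\<lambda>n. sqrt c * (sqrt (1/2)) ^ n)"
      by (intro summable_mult summable_geometric) (simp add: real_sqrt_lt_1_iff)
    then have "summable (\<lambda>n. u (Suc n) x - u n x)"
      by (rule summable_comparison_test'[where N = 0]) (use le in simp)
    then have "convergent (\<lambda>n. \<Sum>i<n. u (Suc i) x - u i x)" by (simp add: summable_iff_convergent)
    then have "convergent (\<lambda>n. u n x - u 0 x)" using sum_lessThan_telescope[of "\<lambda>n. u n x"] by simp
    then show ?case by (simp add: convergent_diff_const_right_iff)
  qed
  define w where "w x = lim (\<lambda>n. u n x)" for x
  have [measurable]: "w \<in> borel_measurable borel" unfolding w_def by measurable
  have lim: "AE x in lborel. (\<lambda>n. u n x) \<longlonglongrightarrow> w x"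
    using conv by eventually_elim (simp add: w_def convergent_LIMSEQ_iff)
  have "integrable lborel (\<lambda>x. (w x - u n x)\<^sup>2) \<and> (LINT x|lborel. (w x - u n x)\<^sup>2) \<le> K * (1/4) ^ n" for n
  proof -
    have "AE x in lborel. (\<lambda>k. (u (n + k) x - u n x)\<^sup>2) \<longlonglongrightarrow> (w x - u n x)\<^sup>2"
      using lim
    proof eventually_elim
      case (elim x)
      have "(\<lambda>k. u (n + k) x) \<longlonglongrightarrow> w x" using LIMSEQ_ignore_initial_segment[OF elim, of n] by (simp add: add.commute)
      then show ?case by (intro tendsto_intros)
    qed
    then have "integrable lborel (\<lambda>x. (w x - u n x)\<^sup>2)" "(LINT x|lborel. (w x - u n x)\<^sup>2) \<le> K * (1/4) ^ n"
      using Fatou_real[where f = "\<lambda>k x. (u (n + k) x - u n x)\<^sup>2" and g = "\<lambda>x. (w x - u n x)\<^sup>2" and B = "K * (1/4) ^ n"]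
        int[of n "n + k" for k] bound[of n "n + k" for k] by simp_all
    then show ?thesis by simp
  qed
  with lim show thesis by (intro that[of w]) auto
qed

text \<open>Nonnegativity and the second moment pass to the limit by Fatou, which alone could lose mass. It does
  not: outside a large ball the mass is small by the second moments, and inside the ball convergence
  in \<open>L\<^sup>2\<close> implies convergence in \<open>L\<^sup>1\<close>.\<close>

lemma Adm_limit:
  assumes u: "\<And>n. u n \<in> Adm" and M: "\<And>n. (LINT x|lborel. (norm x)\<^sup>2 * u n x) \<le> M"
    and [measurable]: "w \<in> borel_measurable borel" and lim: "AE x in lborel. (\<lambda>n. u n x) \<longlonglongrightarrow> w x"
    and int: "\<And>n. integrable lborel (\<lambda>x. (w x - u n x)\<^sup>2)"
    and L2: "(\<lambda>n. LINT x|lborel. (w x - u n x)\<^sup>2) \<longlonglongrightarrow> 0"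
  shows "w \<in> Adm"
proof -
  note [measurable] = AdmD(7)[OF u]
  have nn: "AE x in lborel. \<forall>n. 0 \<le> u n x" using AdmD(4)[OF u] by (subst AE_all_countable) simp
  have w0: "AE x in lborel. 0 \<le> w x"
    using nn lim by eventually_elim (auto intro: LIMSEQ_le_const)
  have iw: "integrable lborel w"
    by (rule Fatou_real(1)[OF AdmD(5)[OF u] AdmD(4)[OF u] _ lim, of 1]) (use AdmD(3)[OF u] in auto)
  have mom: "AE x in lborel. (\<lambda>n. (norm x)\<^sup>2 * u n x) \<longlonglongrightarrow> (norm x)\<^sup>2 * w x"
    using lim by eventually_elim (intro tendsto_intros)
  have momnn: "AE x in lborel. 0 \<le> (norm x)\<^sup>2 * u n x" for n
    using AdmD(4)[OF u, of n] by eventually_elim simp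
  note mw = Fatou_real[OF AdmD(6)[OF u] momnn _ mom M, simplified]
  have iw2: "integrable lborel (\<lambda>x. (w x)\<^sup>2)"
  proof (rule Bochner_Integration.integrable_bound)
    show "integrable lborel (\<lambda>x. 2 * (w x - u 0 x)\<^sup>2 + 2 * (u 0 x)\<^sup>2)"
      using int[of 0] AdmD(8)[OF u, of 0] by simp
    show "AE x in lborel. norm ((w x)\<^sup>2) \<le> norm (2 * (w x - u 0 x)\<^sup>2 + 2 * (u 0 x)\<^sup>2)"
    proof (intro always_eventually allI)
      fix x
      have "0 \<le> (w x - u 0 x - u 0 x)\<^sup>2" by simp
      then show "norm ((w x)\<^sup>2) \<le> norm (2 * (w x - u 0 x)\<^sup>2 + 2 * (u 0 x)\<^sup>2)"
        by (simp add: power2_eq_square algebra_simps)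
    qed
  qed measurable
  have M0: "0 \<le> M" using M[of 0] integral_nonneg_AE[OF momnn[of 0]] by linarith
  have small: "\<bar>(LINT x|lborel. w x) - 1\<bar> \<le> e" if e: "e > 0" for e
  proof -
    \<comment> \<open>The three terms of the majorant below cost \<open>e / 3\<close> each: first the radius makes the tails small,
    then \<open>\<delta>\<close> the constant on the ball, and then \<open>n\<close> the distance in \<open>L\<^sup>2\<close>.\<close>
    define R where "R = sqrt (6 * M / e) + 1"
    have R: "R > 0" using e M0 by (simp add: R_def add_nonneg_pos)
    have "6 * M / e \<le> R\<^sup>2"
    proof -
      have "6 * M / e = (sqrt (6 * M / e))\<^sup>2" using e M0 by simp
      also have "\<dots> \<le> R\<^sup>2" unfolding R_def using e M0 by (intro power_mono) auto
      finally show ?thesis .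
    qed
    then have R2: "2 * M / R\<^sup>2 \<le> e / 3" using e R by (simp add: field_simps)
    define vol where "vol = measure lborel (cball (0::R3) R)"
    define \<delta> where "\<delta> = e / (3 * (vol + 1))"
    have vol: "0 \<le> vol" by (simp add: vol_def)
    then have \<delta>: "\<delta> > 0" and \<delta>vol: "\<delta> * vol \<le> e / 3" using e by (simp_all add: \<delta>_def field_simps)
    have "eventually (\<lambda>n. (LINT x|lborel. (w x - u n x)\<^sup>2) < e * \<delta> / 3) sequentially"
      using L2 e \<delta> by (intro order_tendstoD) auto
    then obtain n where n: "(LINT x|lborel. (w x - u n x)\<^sup>2) < e * \<delta> / 3"
      by (auto simp: eventually_sequentially)
    \<comment> \<open>On the ball \<open>\<bar>d\<bar> \<le> \<delta> + d\<^sup>2 / \<delta>\<close>; off the ball \<open>1 \<le> \<bar>x\<bar>\<^sup>2 / R\<^sup>2\<close>.\<close>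
    let ?h = "\<lambda>x. \<delta> * indicator (cball 0 R) x + (1 / \<delta>) * (w x - u n x)\<^sup>2 + (1 / R\<^sup>2) * ((norm x)\<^sup>2 * w x + (norm x)\<^sup>2 * u n x)"
    have icb: "integrable lborel (indicator (cball (0::R3) R) :: R3 \<Rightarrow> real)"
      by (intro integrable_indicator_compact compact_cball)
    have ih: "integrable lborel ?h"
      using icb int[of n] mw(1) AdmD(6)[OF u, of n] by simp
    have "\<bar>(LINT x|lborel. w x) - 1\<bar> = \<bar>LINT x|lborel. w x - u n x\<bar>"
      using iw AdmD(3,5)[OF u, of n] by simp
    also have "\<dots> \<le> (LINT x|lborel. ?h x)"
    proof -
      have "\<bar>LINT x|lborel. w x - u n x\<bar> \<le> (LINT x|lborel. \<bar>w x - u n x\<bar>)"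
        by (rule integral_abs_bound)
      also have "\<dots> \<le> (LINT x|lborel. ?h x)"
      proof (rule integral_mono_AE[OF _ ih])
        show "integrable lborel (\<lambda>x. \<bar>w x - u n x\<bar>)" using iw AdmD(5)[OF u, of n] by simp
        show "AE x in lborel. \<bar>w x - u n x\<bar> \<le> ?h x"
          using nn w0
        proof eventually_elim
          case (elim x)
          show ?case
          proof (cases "norm x \<le> R")
            case True
            have "\<bar>w x - u n x\<bar> \<le> \<delta> + (1 / \<delta>) * (w x - u n x)\<^sup>2"
            proof (cases "\<bar>w x - u n x\<bar> \<le> \<delta>")
              case False
              then have "\<delta> * \<bar>w x - u n x\<bar> \<le> \<bar>w x - u n x\<bar> * \<bar>w x - u n x\<bar>" using \<delta> by (intro mult_right_mono) auto
              also have "\<dots> = (w x - u n x)\<^sup>2" by (simp add: power2_eq_square)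
              finally have "\<bar>w x - u n x\<bar> \<le> (1 / \<delta>) * (w x - u n x)\<^sup>2" using \<delta> by (simp add: field_simps)
              with \<delta> show ?thesis by linarith
            qed (use \<delta> in \<open>auto intro: add_increasing2\<close>)
            moreover have "0 \<le> (1 / R\<^sup>2) * ((norm x)\<^sup>2 * w x + (norm x)\<^sup>2 * u n x)" using elim by simp
            ultimately show ?thesis using True by simp
          next
            case False
            have "\<bar>w x - u n x\<bar> \<le> w x + u n x" using elim by (simp add: abs_le_iff)
            also have "\<dots> \<le> ((norm x)\<^sup>2 / R\<^sup>2) * (w x + u n x)"
            proof -
              have "1 \<le> (norm x)\<^sup>2 / R\<^sup>2" using False R by (simp add: power_mono)
              moreover have "0 \<le> w x + u n x" using elim by simp
              ultimately show ?thesis using mult_right_mono[of 1 "(norm x)\<^sup>2 / R\<^sup>2" "w x + u n x"] by simp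
            qed
            also have "\<dots> = (1 / R\<^sup>2) * ((norm x)\<^sup>2 * w x + (norm x)\<^sup>2 * u n x)" by (simp add: algebra_simps add_divide_distrib)
            also have "\<dots> \<le> ?h x" using \<delta> by simp
            finally show ?thesis .
          qed
        qed
      qed
      finally show ?thesis .
    qed
    also have "\<dots> = \<delta> * vol + (1 / \<delta>) * (LINT x|lborel. (w x - u n x)\<^sup>2)
        + (1 / R\<^sup>2) * ((LINT x|lborel. (norm x)\<^sup>2 * w x) + (LINT x|lborel. (norm x)\<^sup>2 * u n x))"
      using icb int[of n] mw(1) AdmD(6)[OF u, of n] by (simp add: vol_def)
    also have "\<dots> \<le> e / 3 + e / 3 + e / 3"
    proof (intro add_mono \<delta>vol)
      show "(1 / \<delta>) * (LINT x|lborel. (w x - u n x)\<^sup>2) \<le> e / 3" using n \<delta> by (simp add: field_simps)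
      have "(1 / R\<^sup>2) * ((LINT x|lborel. (norm x)\<^sup>2 * w x) + (LINT x|lborel. (norm x)\<^sup>2 * u n x)) \<le> (1 / R\<^sup>2) * (2 * M)"
        using mw(2) M[of n] by (intro mult_left_mono) auto
      also have "\<dots> \<le> e / 3" using R2 by simp
      finally show "(1 / R\<^sup>2) * ((LINT x|lborel. (norm x)\<^sup>2 * w x) + (LINT x|lborel. (norm x)\<^sup>2 * u n x)) \<le> e / 3" .
    qed
    finally show ?thesis by simp
  qed
  have "\<bar>(LINT x|lborel. w x) - 1\<bar> \<le> 0"
    by (rule field_le_epsilon) (use small in simp)
  then have "(LINT x|lborel. w x) = 1" by simp
  then show ?thesis by (intro AdmI iw w0 mw(1) iw2)
qed

text \<open>The competitors for the Euler-Lagrange equations.\<close>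

lemma Adm_uniform:
  assumes [measurable]: "A \<in> sets borel" and A: "bounded A" "measure lborel A > 0"
  shows "(\<lambda>x. indicator A x / measure lborel A) \<in> Adm"
proof -
  obtain R where R: "\<And>x. x \<in> A \<Longrightarrow> norm x \<le> R" using A(1) unfolding bounded_iff by blast
  have iA: "integrable lborel (\<lambda>x. indicator A x * W x)" if "continuous_on UNIV W" for W :: "R3 \<Rightarrow> real"
  proof -
    have "integrable lborel (\<lambda>x. indicator A x *\<^sub>R W x)"
      by (rule locally_integrable_mult[OF locally_integrable_continuous[OF that], where B = 1 and \<rho> = R])
        (auto simp: indicator_def dest: R)
    then show ?thesis by simp
  qed
  have i1: "integrable lborel (indicator A :: R3 \<Rightarrow> real)" using iA[of "\<lambda>_. 1"] by simp
  show ?thesis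
  proof (rule AdmI)
    show "integrable lborel (\<lambda>x. indicator A x / measure lborel A)" using i1 by simp
    show "(LINT x|lborel. indicator A x / measure lborel A) = 1" using A(2) by simp
    show "AE x in lborel. 0 \<le> indicator A x / measure lborel A" by simp
    show "integrable lborel (\<lambda>x. (norm x)\<^sup>2 * (indicator A x / measure lborel A))"
    proof -
      have "integrable lborel (\<lambda>x. indicator A x * (norm x)\<^sup>2 / measure lborel A)"
        by (intro integrable_divide iA continuous_intros)
      then show ?thesis by (simp add: mult.commute)
    qed
    have "(indicator A x / measure lborel A)\<^sup>2 = indicator A x / (measure lborel A)\<^sup>2" for x :: R3
      by (simp add: indicator_def power_divide)
    then show "integrable lborel (\<lambda>x. (indicator A x / measure lborel A)\<^sup>2)" using i1 by simp
  qed
qed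

context confinement
begin

lemma Adm_nonempty: "\<exists>u. u \<in> Adm"
proof -
  have "measure lborel (cball (0::R3) 1) > 0" by (simp add: content_cball_pos)
  then show ?thesis using Adm_uniform[of "cball 0 1"] by (auto simp: bounded_cball)
qed

lemma J_ge: "u \<in> Adm \<Longrightarrow> v \<in> Adm \<Longrightarrow> - 2 * b \<le> J u v"
proof -
  assume u: "u \<in> Adm" and v: "v \<in> Adm"
  have "0 \<le> (LINT x|lborel. (norm x)\<^sup>2 * f x)" if "f \<in> Adm" for f :: "R3 \<Rightarrow> real"
    by (rule integral_nonneg_AE) (use AdmD(4)[OF that] in \<open>auto elim: eventually_mono\<close>)
  from this[OF u] this[OF v] have "0 \<le> a * (LINT x|lborel. (norm x)\<^sup>2 * u x)" "0 \<le> a * (LINT x|lborel. (norm x)\<^sup>2 * v x)"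
    using a_pos by auto
  with J_lower_bound[OF u v] show ?thesis by linarith
qed

text \<open>Lower semicontinuity of the linear part, from Fatou's lemma: adding a constant makes the
  weight nonnegative, and does not change the integral against a difference of probability
  densities.\<close>

lemma linear_part_liminf:
  assumes un: "\<And>n. u n \<in> Adm" and w: "w \<in> Adm" and lim: "AE x in lborel. (\<lambda>n. u n x) \<longlonglongrightarrow> w x"
    and [measurable]: "F \<in> borel_measurable borel" and F: "AE x in lborel. - c \<le> F x"
    and iF: "\<And>f. f \<in> Adm \<Longrightarrow> integrable lborel (\<lambda>x. f x * F x)" and e: "e > 0"
  shows "eventually (\<lambda>n. - e \<le> (LINT x|lborel. (u n x - w x) * F x)) sequentially"
proof (rule ccontr)
  let ?I = "\<lambda>f. LINT x|lborel. f x * (F x + c)"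
  assume "\<not> ?thesis"
  then have "frequently (\<lambda>n. (LINT x|lborel. (u n x - w x) * F x) < - e) sequentially"
    by (simp add: not_eventually not_le)
  then have inf: "infinite {n. (LINT x|lborel. (u n x - w x) * F x) < - e}"
    by (simp add: frequently_cofinite cofinite_eq_sequentially[symmetric])
  \<comment> \<open>The bad indices form a subsequence along which Fatou would give a strict inequality.\<close>
  define r where "r = enumerate {n. (LINT x|lborel. (u n x - w x) * F x) < - e}"
  have r: "strict_mono r" unfolding r_def by (rule strict_mono_enumerate[OF inf])
  have rn: "(LINT x|lborel. (u (r n) x - w x) * F x) < - e" for n
    using enumerate_in_set[OF inf, of n] by (simp add: r_def)
  have iFc: "integrable lborel (\<lambda>x. f x * (F x + c))" "?I f = (LINT x|lborel. f x * F x) + c" if "f \<in> Adm" for f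
    using iF[OF that] AdmD(3,5)[OF that] by (simp_all add: distrib_left)
  have diff: "(LINT x|lborel. (u n x - w x) * F x) = ?I (u n) - ?I w" for n
  proof -
    have "(\<lambda>x. (u n x - w x) * F x) = (\<lambda>x. u n x * F x - w x * F x)" by (simp add: left_diff_distrib)
    then show ?thesis using iF[OF un] iF[OF w] iFc(2)[OF un] iFc(2)[OF w] by simp
  qed
  have "?I w \<le> ?I w - e"
  proof (rule Fatou_real(2))
    show "integrable lborel (\<lambda>x. u (r n) x * (F x + c))" for n by (rule iFc(1)[OF un])
    show "AE x in lborel. 0 \<le> u (r n) x * (F x + c)" for n
      using AdmD(4)[OF un, of "r n"] F by eventually_elim simp
    show "AE x in lborel. (\<lambda>n. u (r n) x * (F x + c)) \<longlonglongrightarrow> w x * (F x + c)"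
      using lim
    proof eventually_elim
      case (elim x)
      from LIMSEQ_subseq_LIMSEQ[OF this r] show ?case by (intro tendsto_intros) (simp add: o_def)
    qed
    show "?I (u (r n)) \<le> ?I w - e" for n using rn[of n] diff[of "r n"] by linarith
    show "(\<lambda>x. w x * (F x + c)) \<in> borel_measurable lborel" using AdmD(7)[OF w] by measurable
  qed
  with e show False by linarith
qed

text \<open>A minimizing sequence with energies within \<open>4\<^sup>-\<^sup>n\<close> of the infimum is Cauchy in \<open>L\<^sup>2\<close> at the same rate:
  by the parallelogram identity two almost minimal pairs far from each other would have a midpoint
  of energy below the infimum. At the limit the second-order term of the expansion is nonnegative,
  so only the linear term has to be controlled from below.\<close>

theorem minimizer_exists: "\<exists>u v. minimizer u v"
proof -
  define S where "S = {J u v |u v. u \<in> Adm \<and> v \<in> Adm}"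
  have S0: "S \<noteq> {}" using Adm_nonempty by (auto simp: S_def)
  have bdd: "bdd_below S" using J_ge by (auto simp: S_def bdd_below_def)
  define m where "m = Inf S"
  have m_le: "m \<le> J u v" if "u \<in> Adm" "v \<in> Adm" for u v
    unfolding m_def using that bdd by (intro cInf_lower) (auto simp: S_def)
  have "\<exists>u v. u \<in> Adm \<and> v \<in> Adm \<and> J u v < m + (1/4) ^ n" for n :: nat
  proof -
    have "Inf S < m + (1/4) ^ n" by (simp add: m_def)
    then obtain s where "s \<in> S" "s < m + (1/4) ^ n" using cInf_lessD[OF S0] by blast
    then show ?thesis by (auto simp: S_def)
  qed
  then obtain u v where u: "\<And>n. u n \<in> Adm" and v: "\<And>n. v n \<in> Adm" and J: "\<And>n. J (u n) (v n) < m + (1/4) ^ n"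
    by metis
  have N4: "N (\<lambda>x. u k x - u n x) (\<lambda>x. v k x - v n x) \<le> 4 * (1/4) ^ n" if "n \<le> k" for n k
  proof -
    have "m \<le> J (\<lambda>x. u n x + 1/2 * (u k x - u n x)) (\<lambda>x. v n x + 1/2 * (v k x - v n x))"
      by (intro m_le Adm_convex u v) auto
    also have "\<dots> = (J (u n) (v n) + J (u k) (v k)) / 2 - N (\<lambda>x. u k x - u n x) (\<lambda>x. v k x - v n x) / 4"
      by (rule J_midpoint[OF AdmD(1)[OF u] AdmD(1)[OF v] AdmD(1)[OF u] AdmD(1)[OF v]])
    finally have "m \<le> (J (u n) (v n) + J (u k) (v k)) / 2 - N (\<lambda>x. u k x - u n x) (\<lambda>x. v k x - v n x) / 4" .
    moreover have "(1/4 :: real) ^ k \<le> (1/4) ^ n" using that by (intro power_decreasing) auto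
    moreover have "x \<le> 4 * q" if "m \<le> (j + j') / 2 - x / 4" "q' \<le> q" "j < m + q" "j' < m + q'" for x q q' j j' :: real
      using that by argo
    ultimately show ?thesis using J[of n] J[of k] by blast
  qed
  have L: "(\<lambda>x. u k x - u n x) \<in> L12" "(\<lambda>x. v k x - v n x) \<in> L12" for k n
    using AdmD(2)[OF u] AdmD(2)[OF v] by (auto intro: L12_diff)
  have sqb: "(LINT x|lborel. (u k x - u n x)\<^sup>2) \<le> 4 * (1/4) ^ n" "(LINT x|lborel. (v k x - v n x)\<^sup>2) \<le> 4 * (1/4) ^ n"
    if "n \<le> k" for n k
    using N_ge[OF L(1)[of k n] L(2)[of k n]] N4[OF that] integral_square_nonneg[of "\<lambda>x. u k x - u n x"]
      integral_square_nonneg[of "\<lambda>x. v k x - v n x"] by linarith+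
  have sqi: "integrable lborel (\<lambda>x. (u k x - u n x)\<^sup>2)" "integrable lborel (\<lambda>x. (v k x - v n x)\<^sup>2)" for k n
    using L[of k n] by (auto simp: L12_def)
  have "\<exists>w. w \<in> borel_measurable borel \<and> (AE x in lborel. (\<lambda>n. u n x) \<longlonglongrightarrow> w x)
      \<and> (\<forall>n. integrable lborel (\<lambda>x. (w x - u n x)\<^sup>2)) \<and> (\<forall>n. (LINT x|lborel. (w x - u n x)\<^sup>2) \<le> 4 * (1/4) ^ n)"
    by (rule fast_Cauchy_L2[OF AdmD(7)[OF u] sqi(1) sqb(1)]) blast+
  then obtain uu where uu: "uu \<in> borel_measurable borel" "AE x in lborel. (\<lambda>n. u n x) \<longlonglongrightarrow> uu x"
    "\<And>n. integrable lborel (\<lambda>x. (uu x - u n x)\<^sup>2)" "\<And>n. (LINT x|lborel. (uu x - u n x)\<^sup>2) \<le> 4 * (1/4) ^ n"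
    by blast
  have "\<exists>w. w \<in> borel_measurable borel \<and> (AE x in lborel. (\<lambda>n. v n x) \<longlonglongrightarrow> w x)
      \<and> (\<forall>n. integrable lborel (\<lambda>x. (w x - v n x)\<^sup>2)) \<and> (\<forall>n. (LINT x|lborel. (w x - v n x)\<^sup>2) \<le> 4 * (1/4) ^ n)"
    by (rule fast_Cauchy_L2[OF AdmD(7)[OF v] sqi(2) sqb(2)]) blast+
  then obtain vv where vv: "vv \<in> borel_measurable borel" "AE x in lborel. (\<lambda>n. v n x) \<longlonglongrightarrow> vv x"
    "\<And>n. integrable lborel (\<lambda>x. (vv x - v n x)\<^sup>2)" "\<And>n. (LINT x|lborel. (vv x - v n x)\<^sup>2) \<le> 4 * (1/4) ^ n"
    by blast
  have geo: "(\<lambda>n. 4 * (1/4 :: real) ^ n) \<longlonglongrightarrow> 0"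
    by (intro tendsto_mult_right_zero LIMSEQ_power_zero) simp
  have to0: "(\<lambda>n. LINT x|lborel. (uu x - u n x)\<^sup>2) \<longlonglongrightarrow> 0" "(\<lambda>n. LINT x|lborel. (vv x - v n x)\<^sup>2) \<longlonglongrightarrow> 0"
    by (rule tendsto_sandwich[OF _ _ tendsto_const geo],
        use uu(4) integral_square_nonneg in \<open>auto intro!: always_eventually\<close>,
        rule tendsto_sandwich[OF _ _ tendsto_const geo],
        use vv(4) integral_square_nonneg in \<open>auto intro!: always_eventually\<close>)
  \<comment> \<open>Every pair of the sequence has energy at most \<open>m + 1\<close>.\<close>
  define M where "M = (m + 1 + 2 * b) / a"
  have mom: "(LINT x|lborel. (norm x)\<^sup>2 * u n x) \<le> M" "(LINT x|lborel. (norm x)\<^sup>2 * v n x) \<le> M" for n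
  proof -
    have nn: "0 \<le> (LINT x|lborel. (norm x)\<^sup>2 * f x)" if "f \<in> Adm" for f :: "R3 \<Rightarrow> real"
      by (rule integral_nonneg_AE) (use AdmD(4)[OF that] in \<open>auto elim: eventually_mono\<close>)
    have "(1/4 :: real) ^ n \<le> 1" by (simp add: power_le_one)
    with J_lower_bound[OF u v, of n n] J[of n]
    have "a * (LINT x|lborel. (norm x)\<^sup>2 * u n x) + a * (LINT x|lborel. (norm x)\<^sup>2 * v n x) \<le> m + 1 + 2 * b" by linarith
    moreover have "0 \<le> a * (LINT x|lborel. (norm x)\<^sup>2 * u n x)" "0 \<le> a * (LINT x|lborel. (norm x)\<^sup>2 * v n x)"
      using nn[OF u] nn[OF v] a_pos by auto
    ultimately have "a * (LINT x|lborel. (norm x)\<^sup>2 * u n x) \<le> m + 1 + 2 * b" "a * (LINT x|lborel. (norm x)\<^sup>2 * v n x) \<le> m + 1 + 2 * b"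
      by linarith+
    then show "(LINT x|lborel. (norm x)\<^sup>2 * u n x) \<le> M" "(LINT x|lborel. (norm x)\<^sup>2 * v n x) \<le> M"
      using a_pos by (simp_all add: M_def field_simps)
  qed
  have uA: "uu \<in> Adm" by (rule Adm_limit[OF u mom(1) uu(1,2,3) to0(1)])
  have vA: "vv \<in> Adm" by (rule Adm_limit[OF v mom(2) vv(1,2,3) to0(2)])
  note mo = AdmD(1)[OF uA] AdmD(1)[OF vA]
  obtain B where B: "\<And>x. \<bar>potential uu vv x\<bar> \<le> B" using potential_bound[OF AdmD(2)[OF uA] AdmD(2)[OF vA]] by blast
  have [measurable]: "potential uu vv \<in> borel_measurable borel"
    unfolding potential_def using AdmD(7)[OF uA] AdmD(7)[OF vA] by measurable
  have lowF: "AE x in lborel. - (b + \<epsilon> * B) \<le> 2 * uu x + U x + \<epsilon> * potential uu vv x"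
    using AdmD(4)[OF uA]
  proof eventually_elim
    case (elim x)
    have "- b \<le> U x" using coerciveU[of x] a_pos zero_le_power2[of "norm x"] mult_nonneg_nonneg[of a "(norm x)\<^sup>2"] by linarith
    moreover have "- (\<epsilon> * B) \<le> \<epsilon> * potential uu vv x" using B[of x] eps_pos mult_left_mono[of "- B" "potential uu vv x" \<epsilon>] by (simp add: abs_le_iff)
    ultimately show ?case using elim by linarith
  qed
  have lowG: "AE x in lborel. - (b + \<epsilon> * B) \<le> 2 * vv x + V x - \<epsilon> * potential uu vv x"
    using AdmD(4)[OF vA]
  proof eventually_elim
    case (elim x)
    have "- b \<le> V x" using coerciveV[of x] a_pos zero_le_power2[of "norm x"] mult_nonneg_nonneg[of a "(norm x)\<^sup>2"] by linarith
    moreover have "\<epsilon> * potential uu vv x \<le> \<epsilon> * B" using B[of x] eps_pos by (simp add: abs_le_iff mult_left_mono)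
    ultimately show ?case using elim by linarith
  qed
  have "J uu vv \<le> m"
  proof (rule field_le_epsilon)
    fix e :: real assume e: "e > 0"
    have 1: "eventually (\<lambda>n. - (e/3) \<le> (LINT x|lborel. (u n x - uu x) * (2 * uu x + U x + \<epsilon> * potential uu vv x))) sequentially"
      by (rule linear_part_liminf[OF u uA uu(2) _ lowF])
        (use variation_integrable(1)[OF mo] AdmD(1) uu(1) e in auto)
    have 2: "eventually (\<lambda>n. - (e/3) \<le> (LINT x|lborel. (v n x - vv x) * (2 * vv x + V x - \<epsilon> * potential uu vv x))) sequentially"
      by (rule linear_part_liminf[OF v vA vv(2) _ lowG])
        (use variation_integrable(2)[OF mo] AdmD(1) vv(1) e in auto)
    have "(\<lambda>n. (1/4 :: real) ^ n) \<longlonglongrightarrow> 0" by (intro LIMSEQ_power_zero) simp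
    then have 3: "eventually (\<lambda>n. (1/4 :: real) ^ n < e / 3) sequentially" using e by (intro order_tendstoD) auto
    from 1 2 3 have "eventually (\<lambda>n. J uu vv \<le> m + e) sequentially"
    proof eventually_elim
      case (elim n)
      have "0 \<le> N (\<lambda>x. u n x - uu x) (\<lambda>x. v n x - vv x)"
        by (intro N_nonneg L12_diff AdmD(2) u v uA vA)
      then show ?case
        using elim J_at[OF mo AdmD(1)[OF u[of n]] AdmD(1)[OF v[of n]]] J[of n] by (simp add: dJ_def)
    qed
    then show "J uu vv \<le> m + e" by simp
  qed
  then have "minimizer uu vv"
    unfolding minimizer_def using uA vA m_le by (auto intro: order_trans)
  then show ?thesis by blast
qed

section \<open>The Euler-Lagrange equations\<close>

text \<open>If the weight were below the minimal value \<open>c\<close> on a set of positive measure, the normalized indicator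
  of a bounded part of this set would do better. So \<open>F - c\<close> is nonnegative, and its integral against
  \<open>u\<close> vanishes.\<close>

lemma linear_minimizer:
  assumes u: "u \<in> Adm" and [measurable]: "F \<in> borel_measurable borel"
    and iF: "\<And>f. f \<in> Adm \<Longrightarrow> integrable lborel (\<lambda>x. f x * F x)"
    and min: "\<And>f. f \<in> Adm \<Longrightarrow> (LINT x|lborel. u x * F x) \<le> (LINT x|lborel. f x * F x)"
  shows "\<exists>c. AE x in lborel. c \<le> F x \<and> (u x = 0 \<or> F x = c)"
proof -
  define c where "c = (LINT x|lborel. u x * F x)"
  have "AE x in lborel. x \<in> cball 0 (real n) \<longrightarrow> c \<le> F x" for n
  proof -
    define A where "A = {x \<in> cball 0 (real n). F x < c}"
    have [measurable]: "A \<in> sets borel"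
    proof -
      have "A = cball 0 (real n) \<inter> {x \<in> space borel. F x < c}" by (auto simp: A_def)
      also have "\<dots> \<in> sets borel" by (intro sets.Int) (simp, measurable)
      finally show ?thesis .
    qed
    have bA: "bounded A" by (rule bounded_subset[OF bounded_cball, of _ 0 "real n"]) (auto simp: A_def)
    have fA: "emeasure lborel A < \<infinity>" by (rule emeasure_bounded_finite[OF bA])
    have "measure lborel A = 0"
    proof (rule ccontr)
      assume "measure lborel A \<noteq> 0"
      then have pos: "measure lborel A > 0" by (simp add: zero_less_measure_iff)
      let ?f = "\<lambda>x. indicator A x / measure lborel A"
      have f: "?f \<in> Adm" by (rule Adm_uniform[OF _ bA pos]) simp
      have split: "(\<lambda>x. ?f x * (c - F x)) = (\<lambda>x. c * ?f x - ?f x * F x)"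
        by (rule ext) (simp only: right_diff_distrib mult.commute[of _ c])
      have i: "integrable lborel (\<lambda>x. ?f x * (c - F x))"
        unfolding split by (intro Bochner_Integration.integrable_diff integrable_mult_right iF[OF f] AdmD(5)[OF f])
      have "(LINT x|lborel. ?f x * (c - F x)) = c * (LINT x|lborel. ?f x) - (LINT x|lborel. ?f x * F x)"
        unfolding split by (subst Bochner_Integration.integral_diff) (simp_all only: integral_mult_right_zero integrable_mult_right iF[OF f] AdmD(5)[OF f])
      also have "\<dots> = c - (LINT x|lborel. ?f x * F x)" unfolding AdmD(3)[OF f] by simp
      also have "\<dots> \<le> 0" using min[OF f] unfolding c_def by linarith
      finally have le: "(LINT x|lborel. ?f x * (c - F x)) \<le> 0" .
      have nn: "0 \<le> ?f x * (c - F x)" for x by (simp add: A_def indicator_def)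
      have "(LINT x|lborel. ?f x * (c - F x)) = 0"
        using le integral_nonneg_AE[of "\<lambda>x. ?f x * (c - F x)" lborel] nn by (intro antisym) auto
      then have "AE x in lborel. ?f x * (c - F x) = 0"
        using integral_nonneg_eq_0_iff_AE[OF i] nn by simp
      then have "AE x in lborel. x \<notin> A"
        by eventually_elim (use pos in \<open>auto simp: A_def indicator_def\<close>)
      then have "emeasure lborel A = 0" by (simp add: AE_iff_measurable[OF _ refl])
      then show False using pos by (simp add: measure_def)
    qed
    then have "emeasure lborel A = 0" using fA by (simp add: emeasure_eq_ennreal_measure)
    then have "AE x in lborel. x \<notin> A" by (intro AE_not_in) auto
    then show ?thesis by eventually_elim (auto simp: A_def not_less)
  qed
  then have "AE x in lborel. \<forall>n. x \<in> cball 0 (real n) \<longrightarrow> c \<le> F x" by (subst AE_all_countable) simp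
  then have ge: "AE x in lborel. c \<le> F x"
  proof eventually_elim
    case (elim x)
    obtain n where "norm x \<le> real n" using real_arch_simple by blast
    with elim show ?case unfolding mem_cball_0 by blast
  qed
  have i: "integrable lborel (\<lambda>x. u x * (F x - c))"
    using iF[OF u] AdmD(5)[OF u] by (simp add: right_diff_distrib)
  have "(LINT x|lborel. u x * (F x - c)) = 0"
    using iF[OF u] AdmD(3,5)[OF u] by (simp add: right_diff_distrib c_def)
  moreover have "AE x in lborel. 0 \<le> u x * (F x - c)"
    using ge AdmD(4)[OF u] by eventually_elim simp
  ultimately have "AE x in lborel. u x * (F x - c) = 0"
    using integral_nonneg_eq_0_iff_AE[OF i] by simp
  with ge show ?thesis by (intro exI[of _ c]) (auto elim: eventually_elim2)
qed

text \<open>Varying one species at a time makes each of them a minimizer of a linear functional.\<close>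

lemma minimizer_Euler_Lagrange:
  assumes m: "minimizer u v"
  shows "\<exists>c. AE x in lborel. u x = 1/2 * max 0 (c - U x - \<epsilon> * potential u v x)"
    and "\<exists>c. AE x in lborel. v x = 1/2 * max 0 (c - V x + \<epsilon> * potential u v x)"
proof -
  have u: "u \<in> Adm" and v: "v \<in> Adm" using m by (auto simp: minimizer_def)
  note mo = AdmD(1)[OF u] AdmD(1)[OF v]
  have [measurable]: "u \<in> borel_measurable borel" "v \<in> borel_measurable borel" using AdmD(7) u v by auto
  have [measurable]: "potential u v \<in> borel_measurable borel" unfolding potential_def by measurable
  let ?F = "\<lambda>x. 2 * u x + U x + \<epsilon> * potential u v x" and ?G = "\<lambda>x. 2 * v x + V x - \<epsilon> * potential u v x"
  have minF: "(LINT x|lborel. u x * ?F x) \<le> (LINT x|lborel. f x * ?F x)" if f: "f \<in> Adm" for f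
  proof -
    have "0 \<le> (LINT x|lborel. (f x - u x) * ?F x)"
      using minimizer_first_variation[OF m f v] by (simp add: dJ_def)
    also have "\<dots> = (LINT x|lborel. f x * ?F x - u x * ?F x)" by (simp only: left_diff_distrib)
    also have "\<dots> = (LINT x|lborel. f x * ?F x) - (LINT x|lborel. u x * ?F x)"
      by (rule Bochner_Integration.integral_diff[OF variation_integrable(1)[OF mo AdmD(1)[OF f]] variation_integrable(1)[OF mo mo(1)]])
    finally show ?thesis by simp
  qed
  have minG: "(LINT x|lborel. v x * ?G x) \<le> (LINT x|lborel. f x * ?G x)" if f: "f \<in> Adm" for f
  proof -
    have "0 \<le> (LINT x|lborel. (f x - v x) * ?G x)"
      using minimizer_first_variation[OF m u f] by (simp add: dJ_def)
    also have "\<dots> = (LINT x|lborel. f x * ?G x - v x * ?G x)" by (simp only: left_diff_distrib)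
    also have "\<dots> = (LINT x|lborel. f x * ?G x) - (LINT x|lborel. v x * ?G x)"
      by (rule Bochner_Integration.integral_diff[OF variation_integrable(2)[OF mo AdmD(1)[OF f]] variation_integrable(2)[OF mo mo(2)]])
    finally show ?thesis by simp
  qed
  have "\<exists>c. AE x in lborel. c \<le> ?F x \<and> (u x = 0 \<or> ?F x = c)"
    by (rule linear_minimizer[OF u _ variation_integrable(1)[OF mo AdmD(1)] minF]) measurable
  then obtain c where c: "AE x in lborel. c \<le> ?F x \<and> (u x = 0 \<or> ?F x = c)" by blast
  have "AE x in lborel. u x = 1/2 * max 0 (c - U x - \<epsilon> * potential u v x)"
    using c AdmD(4)[OF u] by eventually_elim (auto simp: max_def)
  then show "\<exists>c. AE x in lborel. u x = 1/2 * max 0 (c - U x - \<epsilon> * potential u v x)" by blast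
  have "\<exists>c. AE x in lborel. c \<le> ?G x \<and> (v x = 0 \<or> ?G x = c)"
    by (rule linear_minimizer[OF v _ variation_integrable(2)[OF mo AdmD(1)] minG]) measurable
  then obtain d where d: "AE x in lborel. d \<le> ?G x \<and> (v x = 0 \<or> ?G x = d)" by blast
  have "AE x in lborel. v x = 1/2 * max 0 (d - V x + \<epsilon> * potential u v x)"
    using d AdmD(4)[OF v] by eventually_elim (auto simp: max_def)
  then show "\<exists>c. AE x in lborel. v x = 1/2 * max 0 (c - V x + \<epsilon> * potential u v x)" by blast
qed

end

section \<open>Regularity of Newtonian potentials\<close>

subsection \<open>Locally bounded gradients\<close>

text \<open>Enough for all integrals over segments and over compact sets to exist.\<close>

definition loc_bounded :: "(R3 \<Rightarrow> 'b::euclidean_space) \<Rightarrow> bool" where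
  "loc_bounded W \<longleftrightarrow> W \<in> borel_measurable borel \<and> (\<forall>\<rho>. \<exists>B. \<forall>x. norm x \<le> \<rho> \<longrightarrow> norm (W x) \<le> B)"

lemma loc_bounded_locally_integrable: "loc_bounded W \<Longrightarrow> locally_integrable W"
  unfolding loc_bounded_def by (intro locally_integrableI_bounded) auto

lemma loc_bounded_continuous:
  assumes "continuous_on UNIV W" shows "loc_bounded W"
  unfolding loc_bounded_def
proof (intro conjI allI)
  show "W \<in> borel_measurable borel" using assms by (rule borel_measurable_continuous_onI)
  fix \<rho>
  have "compact (W ` cball 0 \<rho>)"
    by (rule compact_continuous_image[OF continuous_on_subset[OF assms]]) auto
  then have "bounded (W ` cball 0 \<rho>)" by (rule compact_imp_bounded)
  then obtain B where "\<forall>y\<in>W ` cball 0 \<rho>. norm y \<le> B" unfolding bounded_iff ..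
  then have "\<forall>x. norm x \<le> \<rho> \<longrightarrow> norm (W x) \<le> B" by simp
  then show "\<exists>B. \<forall>x. norm x \<le> \<rho> \<longrightarrow> norm (W x) \<le> B" ..
qed

lemma loc_bounded_combination:
  assumes "loc_bounded V" "loc_bounded W"
  shows "loc_bounded (\<lambda>x. a *\<^sub>R V x + b *\<^sub>R W x)"
  unfolding loc_bounded_def
proof (intro conjI allI)
  show "(\<lambda>x. a *\<^sub>R V x + b *\<^sub>R W x) \<in> borel_measurable borel"
    using assms by (auto simp: loc_bounded_def)
  fix \<rho>
  obtain B1 where B1: "\<And>x. norm x \<le> \<rho> \<Longrightarrow> norm (V x) \<le> B1" using assms(1) unfolding loc_bounded_def by blast
  obtain B2 where B2: "\<And>x. norm x \<le> \<rho> \<Longrightarrow> norm (W x) \<le> B2" using assms(2) unfolding loc_bounded_def by blast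
  have "norm (a *\<^sub>R V x + b *\<^sub>R W x) \<le> \<bar>a\<bar> * B1 + \<bar>b\<bar> * B2" if "norm x \<le> \<rho>" for x
    using norm_triangle_ineq[of "a *\<^sub>R V x" "b *\<^sub>R W x"] mult_left_mono[OF B1[OF that], of "\<bar>a\<bar>"]
      mult_left_mono[OF B2[OF that], of "\<bar>b\<bar>"] by simp
  then show "\<exists>B. \<forall>x. norm x \<le> \<rho> \<longrightarrow> norm (a *\<^sub>R V x + b *\<^sub>R W x) \<le> B" by blast
qed

lemma loc_bounded_line_integrable:
  fixes W :: "R3 \<Rightarrow> R3"
  assumes W: "loc_bounded W"
  shows "integrable lborel (\<lambda>t. indicator {0..1} t *\<^sub>R (h \<bullet> W (x + t *\<^sub>R h)))"
proof -
  have [measurable]: "W \<in> borel_measurable borel" using W by (simp add: loc_bounded_def)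
  obtain B where B: "\<And>y. norm y \<le> norm x + norm h \<Longrightarrow> norm (W y) \<le> B"
    using W unfolding loc_bounded_def by blast
  show ?thesis
  proof (rule Bochner_Integration.integrable_bound)
    show "integrable lborel (\<lambda>t::real. indicator {0..1} t * (norm h * B))"
      by (intro integrable_mult_left integrable_indicator_compact) simp
    show "AE t in lborel. norm (indicator {0..1} t *\<^sub>R (h \<bullet> W (x + t *\<^sub>R h))) \<le> norm (indicator {0..1} t * (norm h * B))"
    proof (intro always_eventually allI)
      fix t :: real
      have "\<bar>h \<bullet> W (x + t *\<^sub>R h)\<bar> \<le> norm h * B" if t: "t \<in> {0..1}"
      proof -
        have "norm (t *\<^sub>R h) \<le> norm h" using t by (simp add: mult_left_le_one_le)
        then have "norm (x + t *\<^sub>R h) \<le> norm x + norm h" using norm_triangle_ineq[of x "t *\<^sub>R h"] by linarith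
        from mult_left_mono[OF B[OF this], of "norm h"] show ?thesis
          using Cauchy_Schwarz_ineq2[of h "W (x + t *\<^sub>R h)"] by simp
      qed
      then show "norm (indicator {0..1} t *\<^sub>R (h \<bullet> W (x + t *\<^sub>R h))) \<le> norm (indicator {0..1} t * (norm h * B))"
        by (auto simp: indicator_def)
    qed
  qed measurable
qed

lemma line_gradient_combination:
  assumes F: "line_gradient F V" and V: "loc_bounded V" and G: "line_gradient G W" and W: "loc_bounded W"
  shows "line_gradient (\<lambda>x. a * F x + b * G x) (\<lambda>x. a *\<^sub>R V x + b *\<^sub>R W x)"
  unfolding line_gradient_def
proof (intro allI)
  fix x h
  let ?v = "\<lambda>t. indicator {0..1} t *\<^sub>R (h \<bullet> V (x + t *\<^sub>R h))" and ?w = "\<lambda>t. indicator {0..1} t *\<^sub>R (h \<bullet> W (x + t *\<^sub>R h))"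
  have "(LINT t|lborel. indicator {0..1} t *\<^sub>R (h \<bullet> (a *\<^sub>R V (x + t *\<^sub>R h) + b *\<^sub>R W (x + t *\<^sub>R h))))
      = (LINT t|lborel. a * ?v t + b * ?w t)"
    by (intro Bochner_Integration.integral_cong) (auto simp: inner_add_right indicator_def)
  also have "\<dots> = a * (LINT t|lborel. ?v t) + b * (LINT t|lborel. ?w t)"
    by (subst Bochner_Integration.integral_add)
      (intro integrable_mult_right loc_bounded_line_integrable V W | simp only: integral_mult_right_zero)+
  also have "\<dots> = a * (F (x + h) - F x) + b * (G (x + h) - G x)"
    using F G unfolding line_gradient_def by metis
  finally show "(a * F (x + h) + b * G (x + h)) - (a * F x + b * G x)
      = (LINT t|lborel. indicator {0..1} t *\<^sub>R (h \<bullet> (a *\<^sub>R V (x + t *\<^sub>R h) + b *\<^sub>R W (x + t *\<^sub>R h))))"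
    by (simp add: algebra_simps)
qed

subsection \<open>Bounded densities of compact support\<close>

definition bounded_supp :: "(R3 \<Rightarrow> 'b::euclidean_space) \<Rightarrow> bool" where
  "bounded_supp f \<longleftrightarrow> f \<in> borel_measurable borel
     \<and> (\<exists>\<rho> B. \<forall>x. norm (f x) \<le> B \<and> (norm x > \<rho> \<longrightarrow> f x = 0))"

lemma bounded_suppE:
  assumes "bounded_supp f"
  obtains \<rho> B where "f \<in> borel_measurable borel" "\<And>x. norm (f x) \<le> B" "\<And>x. norm x > \<rho> \<Longrightarrow> f x = 0" "0 \<le> B"
proof -
  obtain \<rho> B where *: "f \<in> borel_measurable borel" "\<forall>x. norm (f x) \<le> B \<and> (norm x > \<rho> \<longrightarrow> f x = 0)"
    using assms unfolding bounded_supp_def by blast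
  have "0 \<le> B" using *(2)[rule_format, of 0] norm_ge_zero[of "f 0"] by linarith
  then show thesis using * by (intro that[of B \<rho>]) auto
qed

lemma bounded_supp_integrable:
  fixes f :: "R3 \<Rightarrow> 'b::euclidean_space"
  assumes "bounded_supp f" shows "integrable lborel f"
proof -
  obtain \<rho> B where f: "f \<in> borel_measurable borel" "\<And>x. norm (f x) \<le> B" "\<And>x. norm x > \<rho> \<Longrightarrow> f x = 0" "0 \<le> B"
    by (rule bounded_suppE[OF assms]) (rule that)
  show ?thesis
  proof (rule Bochner_Integration.integrable_bound)
    show "integrable lborel (\<lambda>x. B * indicator (cball (0::R3) \<rho>) x)"
      by (intro integrable_mult_right integrable_indicator_compact compact_cball)
    show "AE x in lborel. norm (f x) \<le> norm (B * indicator (cball 0 \<rho>) x)"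
    proof (intro always_eventually allI)
      fix x show "norm (f x) \<le> norm (B * indicator (cball 0 \<rho>) x)"
        using f(2)[of x] f(3)[of x] f(4) by (cases "norm x \<le> \<rho>") auto
    qed
  qed (use f(1) in simp)
qed

lemma bounded_supp_norm_power:
  fixes f :: "R3 \<Rightarrow> 'b::euclidean_space"
  assumes "bounded_supp f" shows "bounded_supp (\<lambda>x. (norm (f x))\<^sup>2)"
proof -
  obtain \<rho> B where f: "f \<in> borel_measurable borel" "\<And>x. norm (f x) \<le> B" "\<And>x. norm x > \<rho> \<Longrightarrow> f x = 0" "0 \<le> B"
    by (rule bounded_suppE[OF assms]) (rule that)
  have "norm ((norm (f x))\<^sup>2) \<le> B\<^sup>2 \<and> (norm x > \<rho> \<longrightarrow> (norm (f x))\<^sup>2 = 0)" for x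
    using f(2)[of x] f(3)[of x] by (auto intro: power_mono)
  then show ?thesis unfolding bounded_supp_def using f(1) by (intro conjI exI[of _ \<rho>] exI[of _ "B\<^sup>2"]) auto
qed

lemma bounded_supp_L2:
  fixes f :: "R3 \<Rightarrow> 'b::euclidean_space"
  assumes "bounded_supp f" shows "f \<in> L2"
  using bounded_supp_integrable[OF bounded_supp_norm_power[OF assms]] assms
  by (simp add: L2_def bounded_supp_def)

lemma bounded_supp_L12:
  assumes "bounded_supp f" shows "f \<in> L12"
  using bounded_supp_integrable[OF bounded_supp_norm_power[OF assms]] bounded_supp_integrable[OF assms]
  by (simp add: L12_def)

lemma bounded_supp_loc_bounded: "bounded_supp f \<Longrightarrow> loc_bounded f"
  unfolding bounded_supp_def loc_bounded_def by blast

lemma bounded_supp_diff: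
  fixes f g :: "R3 \<Rightarrow> 'b::euclidean_space"
  assumes "bounded_supp f" "bounded_supp g" shows "bounded_supp (\<lambda>x. f x - g x)"
proof -
  obtain \<rho> B where f: "f \<in> borel_measurable borel" "\<And>x. norm (f x) \<le> B" "\<And>x. norm x > \<rho> \<Longrightarrow> f x = 0"
    by (rule bounded_suppE[OF assms(1)]) (rule that)
  obtain \<sigma> C where g: "g \<in> borel_measurable borel" "\<And>x. norm (g x) \<le> C" "\<And>x. norm x > \<sigma> \<Longrightarrow> g x = 0"
    by (rule bounded_suppE[OF assms(2)]) (rule that)
  have "norm (f x - g x) \<le> B + C \<and> (norm x > max \<rho> \<sigma> \<longrightarrow> f x - g x = 0)" for x
    using norm_triangle_ineq4[of "f x" "g x"] f(2,3)[of x] g(2,3)[of x] by auto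
  then show ?thesis unfolding bounded_supp_def
    using f(1) g(1) by (intro conjI exI[of _ "max \<rho> \<sigma>"] exI[of _ "B + C"]) auto
qed

lemma bounded_supp_inner:
  fixes f :: "R3 \<Rightarrow> R3"
  assumes "bounded_supp f" shows "bounded_supp (\<lambda>x. h \<bullet> f x)"
proof -
  obtain \<rho> B where f: "f \<in> borel_measurable borel" "\<And>x. norm (f x) \<le> B" "\<And>x. norm x > \<rho> \<Longrightarrow> f x = 0" "0 \<le> B"
    by (rule bounded_suppE[OF assms]) (rule that)
  have "norm (h \<bullet> f x) \<le> norm h * B \<and> (norm x > \<rho> \<longrightarrow> h \<bullet> f x = 0)" for x
    using Cauchy_Schwarz_ineq2[of h "f x"] mult_left_mono[OF f(2)[of x], of "norm h"] f(3)[of x] by auto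
  then show ?thesis unfolding bounded_supp_def
    using f(1) by (intro conjI exI[of _ \<rho>] exI[of _ "norm h * B"]) auto
qed

subsection \<open>Hoelder continuity of the field\<close>

text \<open>If the points are farther apart than the smaller of their distances to the origin, both values are
  estimated separately; otherwise the mean value bound \<open>4 d / \<bar>z\<bar>\<^sup>3\<close> is available, and
  \<open>d \<le> d\<^sup>\<alpha> \<bar>z\<bar>\<^sup>1\<^sup>-\<^sup>\<alpha>\<close> interpolates. The factor \<open>1/(4\<pi>)\<close> absorbs the constants.\<close>

lemma newton_grad_difference_aux:
  fixes z w :: R3
  assumes \<alpha>: "0 < \<alpha>" "\<alpha> < 1" and "z \<noteq> 0" "w \<noteq> 0" and le: "norm z \<le> norm w"
  shows "norm (newton_grad z - newton_grad w) \<le> norm (z - w) powr \<alpha> * riesz (2 + \<alpha>) z"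
proof -
  define a b d where "a = norm z" and "b = norm w" and "d = norm (z - w)"
  have ab: "0 < a" "0 < b" "a \<le> b" and d: "0 \<le> d" using assms by (auto simp: a_def b_def d_def)
  have bd: "b - a \<le> d" using norm_triangle_ineq2[of w z] by (simp add: a_def b_def d_def norm_minus_commute)
  have pi1: "4 \<le> 4 * pi" using pi_gt3 by simp
  have ra: "riesz (2 + \<alpha>) z = a powr (- 2 - \<alpha>)" by (simp add: riesz_def a_def)
  show ?thesis
  proof (cases "a \<le> d")
    case True
    have "norm (newton_grad z - newton_grad w) \<le> norm (newton_grad z) + norm (newton_grad w)"
      by (rule norm_triangle_ineq4)
    also have "\<dots> = (1 / a\<^sup>2 + 1 / b\<^sup>2) / (4 * pi)"
      by (simp add: norm_newton_grad riesz_power a_def b_def add_divide_distrib)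
    also have "\<dots> \<le> (1 / a\<^sup>2 + 1 / a\<^sup>2) / (4 * pi)"
      using ab by (intro divide_right_mono add_left_mono divide_left_mono power_mono mult_pos_pos) auto
    also have "\<dots> \<le> (1 / a\<^sup>2 + 1 / a\<^sup>2) / 2"
      using pi1 ab by (intro divide_left_mono) auto
    also have "\<dots> = a powr \<alpha> * a powr (- 2 - \<alpha>)"
    proof -
      have "a powr \<alpha> * a powr (- 2 - \<alpha>) = a powr (- 2)" by (simp add: powr_add[symmetric])
      also have "\<dots> = 1 / a\<^sup>2" using ab powr_minus[of a 2] powr_realpow[of a 2] by (simp add: inverse_eq_divide)
      finally show ?thesis by simp
    qed
    also have "\<dots> \<le> d powr \<alpha> * a powr (- 2 - \<alpha>)"
      using True ab \<alpha> by (intro mult_right_mono powr_mono2) auto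
    finally show ?thesis by (simp add: ra d_def)
  next
    case False
    have "newton_grad z - newton_grad w
        = (1 / (4 * pi)) *\<^sub>R ((1 / a ^ 3) *\<^sub>R (w - z) + (1 / b ^ 3 - 1 / a ^ 3) *\<^sub>R w)"
    proof -
      have "newton_grad z = - (1 / (4 * pi) * (1 / a ^ 3)) *\<^sub>R z" "newton_grad w = - (1 / (4 * pi) * (1 / b ^ 3)) *\<^sub>R w"
        by (simp_all add: newton_grad_def a_def b_def)
      moreover have "- (c * p) *\<^sub>R z - - (c * q) *\<^sub>R w = c *\<^sub>R (p *\<^sub>R (w - z) + (q - p) *\<^sub>R w)" for c p q
        by (simp add: algebra_simps)
      ultimately show ?thesis by (simp only:)
    qed
    then have "norm (newton_grad z - newton_grad w)
        \<le> (1 / (4 * pi)) * (norm ((1 / a ^ 3) *\<^sub>R (w - z)) + norm ((1 / b ^ 3 - 1 / a ^ 3) *\<^sub>R w))"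
      using norm_triangle_ineq[of "(1 / a ^ 3) *\<^sub>R (w - z)" "(1 / b ^ 3 - 1 / a ^ 3) *\<^sub>R w"] by (simp add: divide_right_mono)
    moreover have "norm ((1 / a ^ 3) *\<^sub>R (w - z)) = d / a ^ 3"
      using ab by (simp add: d_def norm_minus_commute)
    moreover have "norm ((1 / b ^ 3 - 1 / a ^ 3) *\<^sub>R w) \<le> 3 * d / a ^ 3"
    proof -
      have "1 / b ^ 3 \<le> 1 / a ^ 3" using ab by (intro divide_left_mono power_mono) auto
      then have "norm ((1 / b ^ 3 - 1 / a ^ 3) *\<^sub>R w) = (1 / a ^ 3 - 1 / b ^ 3) * b" by (simp add: b_def)
      also have "\<dots> = (b ^ 3 - a ^ 3) / (a ^ 3 * b\<^sup>2)"
      proof -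
        have "(1 / a ^ 3 - 1 / b ^ 3) * b = (b ^ 3 - a ^ 3) / (a ^ 3 * b ^ 3) * b"
          using ab by (simp add: diff_frac_eq)
        also have "\<dots> = (b ^ 3 - a ^ 3) / (a ^ 3 * b\<^sup>2)"
          using ab by (simp add: power3_eq_cube power2_eq_square)
        finally show ?thesis .
      qed
      also have "b ^ 3 - a ^ 3 = (b - a) * (b\<^sup>2 + a * b + a\<^sup>2)" by (simp add: power3_eq_cube power2_eq_square algebra_simps)
      also have "(b - a) * (b\<^sup>2 + a * b + a\<^sup>2) / (a ^ 3 * b\<^sup>2) \<le> d * (3 * b\<^sup>2) / (a ^ 3 * b\<^sup>2)"
      proof (intro divide_right_mono mult_mono bd)
        have "a * b \<le> b * b" "a * a \<le> b * b" using ab by (intro mult_mono; simp)+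
        then show "b\<^sup>2 + a * b + a\<^sup>2 \<le> 3 * b\<^sup>2" by (simp add: power2_eq_square)
      qed (use ab d in auto)
      also have "\<dots> = 3 * d / a ^ 3" using ab by (simp add: field_simps)
      finally show ?thesis .
    qed
    ultimately have "norm (newton_grad z - newton_grad w) \<le> (1 / (4 * pi)) * (d / a ^ 3 + 3 * d / a ^ 3)"
      by (smt (verit) divide_nonneg_pos mult_left_mono pi_gt_zero)
    also have "\<dots> = (1 / (4 * pi)) * (4 * (d / a ^ 3))" by simp
    also have "\<dots> = (d / a ^ 3) / pi" by simp
    also have "\<dots> \<le> (d / a ^ 3) / 1"
      by (rule divide_left_mono) (use d ab pi_gt3 in auto)
    also have "\<dots> = d powr \<alpha> * d powr (1 - \<alpha>) / a ^ 3"
    proof -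
      have "d powr \<alpha> * d powr (1 - \<alpha>) = d" using d by (cases "d = 0") (simp_all add: powr_add[symmetric])
      then show ?thesis by simp
    qed
    also have "d powr \<alpha> * d powr (1 - \<alpha>) / a ^ 3 \<le> d powr \<alpha> * a powr (1 - \<alpha>) / a ^ 3"
      using False ab d \<alpha> by (intro divide_right_mono mult_left_mono powr_mono2) auto
    also have "\<dots> = d powr \<alpha> * a powr (- 2 - \<alpha>)"
    proof -
      have "a powr (1 - \<alpha>) = a powr (3 + (- 2 - \<alpha>))" by (rule arg_cong[where f = "\<lambda>e. a powr e"]) simp
      also have "\<dots> = a powr 3 * a powr (- 2 - \<alpha>)" by (rule powr_add)
      also have "a powr 3 = a ^ 3" using ab powr_realpow[of a 3] by simp
      finally have "a powr (1 - \<alpha>) = a ^ 3 * a powr (- 2 - \<alpha>)" .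
      then show ?thesis using ab by simp
    qed
    finally show ?thesis by (simp add: ra d_def)
  qed
qed

lemma newton_grad_difference:
  fixes z w :: R3
  assumes \<alpha>: "0 < \<alpha>" "\<alpha> < 1" and "z \<noteq> 0" "w \<noteq> 0"
  shows "norm (newton_grad z - newton_grad w) \<le> norm (z - w) powr \<alpha> * (riesz (2 + \<alpha>) z + riesz (2 + \<alpha>) w)"
proof (cases "norm z \<le> norm w")
  case True
  have "norm (newton_grad z - newton_grad w) \<le> norm (z - w) powr \<alpha> * riesz (2 + \<alpha>) z"
    by (rule newton_grad_difference_aux[OF assms True])
  also have "\<dots> \<le> norm (z - w) powr \<alpha> * (riesz (2 + \<alpha>) z + riesz (2 + \<alpha>) w)"
    by (intro mult_left_mono) auto
  finally show ?thesis .
next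
  case False
  then have "norm (newton_grad w - newton_grad z) \<le> norm (w - z) powr \<alpha> * riesz (2 + \<alpha>) w"
    by (intro newton_grad_difference_aux[OF assms(1,2,4,3)]) simp
  also have "\<dots> \<le> norm (w - z) powr \<alpha> * (riesz (2 + \<alpha>) z + riesz (2 + \<alpha>) w)"
    by (intro mult_left_mono) auto
  finally show ?thesis by (simp add: norm_minus_commute)
qed

lemma newton_field_integrable:
  assumes "bounded_supp f"
  shows "integrable lborel (\<lambda>y. f y *\<^sub>R newton_grad (x - y))"
proof -
  obtain \<rho> B where f: "f \<in> borel_measurable borel" "\<And>x. norm (f x) \<le> B" "\<And>x. norm x > \<rho> \<Longrightarrow> f x = 0" "0 \<le> B"
    by (rule bounded_suppE[OF assms]) (rule that)
  show ?thesis
  proof (rule kernel_integrable(1)[OF borel_measurable_newton_grad f(1) newton_grad_le_riesz _ _ _ bounded_supp_integrable[OF assms]])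
    show "\<bar>f y\<bar> \<le> B" for y using f(2)[of y] by simp
  qed simp_all
qed

lemma newton_field_bounded:
  assumes "bounded_supp f"
  shows "\<exists>M. \<forall>x. norm (newton_field f x) \<le> M"
proof -
  obtain \<rho> B where f: "f \<in> borel_measurable borel" "\<And>x. norm (f x) \<le> B" "\<And>x. norm x > \<rho> \<Longrightarrow> f x = 0" "0 \<le> B"
    by (rule bounded_suppE[OF assms]) (rule that)
  have "norm (newton_field f x) \<le> 4 * pi / (3 - 2) * B + (LINT y|lborel. \<bar>f y\<bar>)" for x
    unfolding newton_field_def
  proof (rule kernel_integrable(3)[OF borel_measurable_newton_grad f(1) newton_grad_le_riesz _ _ _ bounded_supp_integrable[OF assms]])
    show "\<bar>f y\<bar> \<le> B" for y using f(2)[of y] by simp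
  qed simp_all
  then show ?thesis by blast
qed

text \<open>The modulus of continuity of the kernel is bounded by kernels of order \<open>2 + \<alpha>\<close>, which are still
  integrable near their poles because \<open>\<alpha> < 1\<close>.\<close>

lemma newton_field_Holder:
  assumes f: "bounded_supp f" and \<alpha>: "0 < \<alpha>" "\<alpha> < 1"
  shows "\<exists>C. \<forall>x x'. norm (newton_field f x - newton_field f x') \<le> C * dist x x' powr \<alpha>"
proof -
  obtain \<rho> B where fB: "f \<in> borel_measurable borel" "\<And>x. norm (f x) \<le> B" "\<And>x. norm x > \<rho> \<Longrightarrow> f x = 0" "0 \<le> B"
    by (rule bounded_suppE[OF f]) (rule that)
  note [measurable] = fB(1)
  let ?r = "riesz (2 + \<alpha>)"
  let ?C = "4 * pi / (3 - (2 + \<alpha>)) * B + (LINT y|lborel. \<bar>f y\<bar>)"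
  have i: "integrable lborel (\<lambda>y. f y *\<^sub>R ?r (x - y))" and b: "(LINT y|lborel. norm (f y *\<^sub>R ?r (x - y))) \<le> ?C" for x
  proof -
    have k: "norm (?r z) \<le> riesz (2 + \<alpha>) z" for z by simp
    have fb: "\<bar>f y\<bar> \<le> B" for y using fB(2)[of y] by simp
    have p: "0 \<le> 2 + \<alpha>" "2 + \<alpha> < 3" using \<alpha> by auto
    show "integrable lborel (\<lambda>y. f y *\<^sub>R ?r (x - y))"
      by (rule kernel_integrable(1)[OF borel_measurable_riesz fB(1) k p fb bounded_supp_integrable[OF f]])
    show "(LINT y|lborel. norm (f y *\<^sub>R ?r (x - y))) \<le> ?C"
      by (rule kernel_integrable(4)[OF borel_measurable_riesz fB(1) k p fb bounded_supp_integrable[OF f]])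
  qed
  have "norm (newton_field f x - newton_field f x') \<le> (2 * ?C) * dist x x' powr \<alpha>" for x x'
  proof -
    let ?R = "\<lambda>y. dist x x' powr \<alpha> * (norm (f y *\<^sub>R ?r (x - y)) + norm (f y *\<^sub>R ?r (x' - y)))"
    have "newton_field f x - newton_field f x' = (LINT y|lborel. f y *\<^sub>R newton_grad (x - y) - f y *\<^sub>R newton_grad (x' - y))"
      unfolding newton_field_def
      by (rule Bochner_Integration.integral_diff[OF newton_field_integrable[OF f] newton_field_integrable[OF f], symmetric])
    then have "norm (newton_field f x - newton_field f x') \<le> (LINT y|lborel. norm (f y *\<^sub>R newton_grad (x - y) - f y *\<^sub>R newton_grad (x' - y)))"
      by (simp only: integral_norm_bound)
    also have "\<dots> \<le> (LINT y|lborel. ?R y)"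
    proof (rule integral_mono_AE)
      show "integrable lborel (\<lambda>y. norm (f y *\<^sub>R newton_grad (x - y) - f y *\<^sub>R newton_grad (x' - y)))"
        by (intro integrable_norm Bochner_Integration.integrable_diff newton_field_integrable f)
      show "integrable lborel ?R"
        by (intro integrable_mult_right Bochner_Integration.integrable_add integrable_norm i)
      have "AE y in lborel. y \<noteq> x" "AE y in lborel. y \<noteq> x'"
        using AE_not_on_affine_line[of x 0] AE_not_on_affine_line[of x' 0] by simp_all
      then show "AE y in lborel. norm (f y *\<^sub>R newton_grad (x - y) - f y *\<^sub>R newton_grad (x' - y)) \<le> ?R y"
      proof eventually_elim
        case (elim y)
        have "norm (newton_grad (x - y) - newton_grad (x' - y)) \<le> norm ((x - y) - (x' - y)) powr \<alpha> * (?r (x - y) + ?r (x' - y))"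
          using elim by (intro newton_grad_difference \<alpha>) auto
        then have "\<bar>f y\<bar> * norm (newton_grad (x - y) - newton_grad (x' - y))
            \<le> \<bar>f y\<bar> * (dist x x' powr \<alpha> * (?r (x - y) + ?r (x' - y)))"
          by (intro mult_left_mono) (simp_all add: dist_norm)
        also have "\<dots> = ?R y" by (simp add: abs_mult distrib_left mult.left_commute)
        finally show ?case by (simp only: scaleR_diff_right[symmetric] norm_scaleR)
      qed
    qed
    also have "\<dots> = dist x x' powr \<alpha> * ((LINT y|lborel. norm (f y *\<^sub>R ?r (x - y))) + (LINT y|lborel. norm (f y *\<^sub>R ?r (x' - y))))"
      unfolding integral_mult_right_zero
      by (subst Bochner_Integration.integral_add[OF integrable_norm[OF i] integrable_norm[OF i]]) (rule refl)
    also have "\<dots> \<le> dist x x' powr \<alpha> * (?C + ?C)"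
      by (intro mult_left_mono add_mono b) simp
    finally show ?thesis by (simp add: mult.commute)
  qed
  then show ?thesis by blast
qed

lemma Holder_bound_continuous:
  fixes F :: "R3 \<Rightarrow> 'b::euclidean_space"
  assumes F: "\<And>x y. norm (F x - F y) \<le> C * dist x y powr \<alpha>" and \<alpha>: "0 < \<alpha>"
  shows "continuous_on UNIV F"
proof -
  have "(F \<longlongrightarrow> F x) (at x)" for x
  proof -
    have "((\<lambda>y. dist y x) \<longlongrightarrow> 0) (at x)"
    proof -
      have "((\<lambda>y. dist y x) \<longlongrightarrow> dist x x) (at x)" by (intro tendsto_intros)
      then show ?thesis by simp
    qed
    then have "((\<lambda>y. C * dist y x powr \<alpha>) \<longlongrightarrow> C * (0 powr \<alpha>)) (at x)"
      using \<alpha> by (intro tendsto_mult tendsto_const tendsto_powr') auto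
    then have lim: "((\<lambda>y. C * dist y x powr \<alpha>) \<longlongrightarrow> 0) (at x)" by simp
    have "((\<lambda>y. F y - F x) \<longlongrightarrow> 0) (at x)"
      by (rule Lim_null_comparison[OF _ lim]) (use F in \<open>auto intro!: always_eventually\<close>)
    then show ?thesis by (simp add: LIM_zero_iff)
  qed
  then show ?thesis by (simp add: continuous_on_def)
qed

lemma newton_field_continuous:
  assumes "bounded_supp f" shows "continuous_on UNIV (newton_field f)"
proof -
  have "\<exists>C. \<forall>x x'. norm (newton_field f x - newton_field f x') \<le> C * dist x x' powr (1/2)"
    by (rule newton_field_Holder[OF assms]) simp_all
  then obtain C where C: "\<forall>x x'. norm (newton_field f x - newton_field f x') \<le> C * dist x x' powr (1/2)" ..
  show ?thesis by (rule Holder_bound_continuous[OF C[rule_format]]) simp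
qed

subsection \<open>Derivatives of the potential\<close>

lemma AE_segment_avoids: "AE y in lborel. \<forall>t. (x - y) + t *\<^sub>R h \<noteq> (0 :: R3)"
  using AE_not_on_affine_line[of x h]
proof eventually_elim
  case (elim y)
  show ?case
  proof (intro allI notI)
    fix t assume "(x - y) + t *\<^sub>R h = 0"
    then have "y = x + t *\<^sub>R h" by (simp add: algebra_simps eq_neg_iff_add_eq_0)
    with elim show False by blast
  qed
qed

text \<open>For a merely bounded density the derivative has to fall on the kernel. Almost every pole lies off the
  given line, and Fubini exchanges the integral over the segment with the convolution.\<close>

lemma newton_conv_line_gradient:
  assumes f: "bounded_supp f"
  shows "line_gradient (convolution newton f) (newton_field f)"
  unfolding line_gradient_def
proof (intro allI)
  fix x h :: R3
  obtain \<rho> B where fB: "f \<in> borel_measurable borel" "\<And>x. norm (f x) \<le> B" "\<And>x. norm x > \<rho> \<Longrightarrow> f x = 0" "0 \<le> B"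
    by (rule bounded_suppE[OF f]) (rule that)
  note [measurable] = fB(1)
  note fi = bounded_supp_integrable[OF f]
  define T where "T t y = indicator {0..1} t * (f y * (h \<bullet> newton_grad (x + t *\<^sub>R h - y)))" for t :: real and y
  let ?C = "4 * pi / (3 - 2) * B + (LINT y|lborel. \<bar>f y\<bar>)"
  have inner: "(\<integral>\<^sup>+y. ennreal (norm (T t y)) \<partial>lborel) \<le> ennreal (norm h) * ennreal ?C * indicator {0..1} t" for t
  proof (cases "t \<in> {0..1}")
    case True
    have "(\<integral>\<^sup>+y. ennreal (norm (T t y)) \<partial>lborel) \<le> (\<integral>\<^sup>+y. ennreal (norm h) * ennreal (riesz 2 (x + t *\<^sub>R h - y) * \<bar>f y\<bar>) \<partial>lborel)"
    proof (intro nn_integral_mono)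
      fix y
      have "\<bar>h \<bullet> newton_grad (x + t *\<^sub>R h - y)\<bar> \<le> norm h * riesz 2 (x + t *\<^sub>R h - y)"
        by (rule order_trans[OF Cauchy_Schwarz_ineq2]) (intro mult_left_mono newton_grad_le_riesz norm_ge_zero)
      from mult_left_mono[OF this, of "\<bar>f y\<bar>"]
      show "ennreal (norm (T t y)) \<le> ennreal (norm h) * ennreal (riesz 2 (x + t *\<^sub>R h - y) * \<bar>f y\<bar>)"
        using True by (simp add: T_def abs_mult ennreal_mult'[symmetric] ennreal_leI mult_ac)
    qed
    also have "\<dots> = ennreal (norm h) * (\<integral>\<^sup>+y. ennreal (riesz 2 (x + t *\<^sub>R h - y) * \<bar>f y\<bar>) \<partial>lborel)"
      by (rule nn_integral_cmult) measurable
    also have "\<dots> \<le> ennreal (norm h) * ennreal ?C"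
      by (intro mult_left_mono nn_integral_riesz_bounded) (use fB fi in auto)
    finally show ?thesis using True by simp
  qed (simp add: T_def)
  have Tint: "integrable (lborel \<Otimes>\<^sub>M lborel) (case_prod T)"
  proof (rule integrable_pairI)
    show "case_prod T \<in> borel_measurable (lborel \<Otimes>\<^sub>M lborel)" unfolding T_def by measurable
    have "(\<integral>\<^sup>+t. (\<integral>\<^sup>+y. ennreal (norm (T t y)) \<partial>lborel) \<partial>lborel)
        \<le> (\<integral>\<^sup>+t. ennreal (norm h) * ennreal ?C * indicator {0..1::real} t \<partial>lborel)"
      by (rule nn_integral_mono) (rule inner)
    also have "\<dots> < \<infinity>" by (subst nn_integral_cmult_indicator) (auto simp: ennreal_mult_less_top simp del: ennreal_plus)
    finally show "(\<integral>\<^sup>+t. (\<integral>\<^sup>+y. ennreal (norm (T t y)) \<partial>lborel) \<partial>lborel) < \<infinity>" .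
  qed
  have "convolution newton f (x + h) - convolution newton f x
      = (LINT y|lborel. newton (x + h - y) * f y - newton (x - y) * f y)"
    unfolding convolution_def
    by (rule Bochner_Integration.integral_diff[OF newton_conv_integrable(1)[OF bounded_supp_L12[OF f]]
          newton_conv_integrable(1)[OF bounded_supp_L12[OF f]], symmetric])
  also have "\<dots> = (LINT y|lborel. (LINT t|lborel. T t y))"
  proof (rule integral_cong_AE)
    show "AE y in lborel. newton (x + h - y) * f y - newton (x - y) * f y = (LINT t|lborel. T t y)"
      using AE_segment_avoids[of x h]
    proof eventually_elim
      case (elim y)
      have "(LINT t|lborel. T t y) = (LINT t|lborel. f y * (indicator {0..1} t *\<^sub>R (h \<bullet> newton_grad ((x - y) + t *\<^sub>R h))))"
        by (simp add: T_def algebra_simps)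
      also have "\<dots> = f y * (newton ((x - y) + h) - newton (x - y))"
        unfolding integral_mult_right_zero using newton_along_segment[of "x - y" h] elim by simp
      finally show ?case by (simp add: algebra_simps)
    qed
    show "(\<lambda>y. LINT t|lborel. T t y) \<in> borel_measurable lborel" unfolding T_def by measurable
  qed measurable
  also have "\<dots> = (LINT t|lborel. (LINT y|lborel. T t y))"
    by (rule lborel_pair.Fubini_integral[OF Tint])
  also have "\<dots> = (LINT t|lborel. indicator {0..1} t *\<^sub>R (h \<bullet> newton_field f (x + t *\<^sub>R h)))"
  proof (rule Bochner_Integration.integral_cong[OF refl])
    fix t :: real
    have "h \<bullet> newton_field f (x + t *\<^sub>R h) = (LINT y|lborel. h \<bullet> (f y *\<^sub>R newton_grad (x + t *\<^sub>R h - y)))"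
      unfolding newton_field_def by (rule integral_inner_right[OF newton_field_integrable[OF f], symmetric])
    then show "(LINT y|lborel. T t y) = indicator {0..1} t *\<^sub>R (h \<bullet> newton_field f (x + t *\<^sub>R h))"
      by (simp add: T_def)
  qed
  finally show "convolution newton f (x + h) - convolution newton f x
      = (LINT t|lborel. indicator {0..1} t *\<^sub>R (h \<bullet> newton_field f (x + t *\<^sub>R h)))" .
qed

lemma newton_conv_has_derivative:
  assumes "bounded_supp f"
  shows "(convolution newton f has_derivative (\<lambda>k. k \<bullet> newton_field f x)) (at x)"
  by (rule line_gradient_has_derivative[OF newton_conv_line_gradient newton_field_continuous]) fact+

text \<open>For a density that is itself differentiable along lines, the derivative may be moved from
  the kernel to the density; second derivatives of the potential then never meet a kernel more
  singular than \<open>\<bar>z\<bar>\<^sup>-\<^sup>2\<close>.\<close>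

lemma newton_field_reflect:
  assumes [measurable]: "f \<in> borel_measurable borel"
  shows "newton_field f x = (LINT z|lborel. f (x - z) *\<^sub>R newton_grad z)"
  using integral_translate(2)[of "\<lambda>y. f y *\<^sub>R newton_grad (x - y)" x] by (simp add: newton_field_def)

lemma newton_field_line_gradient:
  assumes f: "bounded_supp f" and D: "bounded_supp D" and fD: "line_gradient f D"
  shows "line_gradient (\<lambda>x. newton_field f x $ i) (\<lambda>x. \<chi> j. newton_field (\<lambda>y. D y $ j) x $ i)"
  unfolding line_gradient_def
proof (intro allI)
  fix x h :: R3
  obtain \<rho> B where DB: "D \<in> borel_measurable borel" "\<And>x. norm (D x) \<le> B" "\<And>x. norm x > \<rho> \<Longrightarrow> D x = 0" "0 \<le> B"
    by (rule bounded_suppE[OF D]) (rule that)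
  have [measurable]: "f \<in> borel_measurable borel" using f by (simp add: bounded_supp_def)
  note [measurable] = DB(1)
  define g where "g y = h \<bullet> D y" for y
  have g: "bounded_supp g" unfolding g_def by (rule bounded_supp_inner[OF D])
  obtain \<sigma> Bg where gB: "g \<in> borel_measurable borel" "\<And>x. norm (g x) \<le> Bg" "\<And>x. norm x > \<sigma> \<Longrightarrow> g x = 0" "0 \<le> Bg"
    by (rule bounded_suppE[OF g]) (rule that)
  note [measurable] = gB(1)
  note gi = bounded_supp_integrable[OF g]
  have [measurable]: "(\<lambda>z. newton_grad z $ i) \<in> borel_measurable borel"
    using borel_measurable_inner[OF borel_measurable_newton_grad borel_measurable_const[of "axis i 1"]] by (simp add: inner_axis)
  define T where "T t z = indicator {0..1} t * (g (x + t *\<^sub>R h - z) * newton_grad z $ i)" for t :: real and z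
  let ?C = "4 * pi / (3 - 2) * Bg + (LINT y|lborel. \<bar>g y\<bar>)"
  have inner: "(\<integral>\<^sup>+z. ennreal (norm (T t z)) \<partial>lborel) \<le> ennreal ?C * indicator {0..1} t" for t
  proof (cases "t \<in> {0..1}")
    case True
    let ?p = "x + t *\<^sub>R h"
    have "(\<integral>\<^sup>+z. ennreal (norm (T t z)) \<partial>lborel) \<le> (\<integral>\<^sup>+z. ennreal (riesz 2 (?p - (?p - z)) * \<bar>g (?p - z)\<bar>) \<partial>lborel)"
    proof (intro nn_integral_mono)
      fix z
      have "\<bar>newton_grad z $ i\<bar> \<le> riesz 2 z"
        using component_le_norm_cart[of "newton_grad z" i] newton_grad_le_riesz[of z] by linarith
      from mult_left_mono[OF this, of "\<bar>g (?p - z)\<bar>"]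
      show "ennreal (norm (T t z)) \<le> ennreal (riesz 2 (?p - (?p - z)) * \<bar>g (?p - z)\<bar>)"
        using True by (simp add: T_def abs_mult ennreal_leI mult_ac)
    qed
    also have "\<dots> = (\<integral>\<^sup>+y. ennreal (riesz 2 (?p - y) * \<bar>g y\<bar>) \<partial>lborel)"
      by (rule nn_integral_translate(3)[of "\<lambda>y. ennreal (riesz 2 (?p - y) * \<bar>g y\<bar>)"]) measurable
    also have "\<dots> \<le> ennreal ?C"
      by (rule nn_integral_riesz_bounded) (use gB gi in auto)
    finally show ?thesis using True by simp
  qed (simp add: T_def)
  have Tint: "integrable (lborel \<Otimes>\<^sub>M lborel) (case_prod T)"
  proof (rule integrable_pairI)
    show "case_prod T \<in> borel_measurable (lborel \<Otimes>\<^sub>M lborel)" unfolding T_def by measurable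
    have "(\<integral>\<^sup>+t. (\<integral>\<^sup>+z. ennreal (norm (T t z)) \<partial>lborel) \<partial>lborel)
        \<le> (\<integral>\<^sup>+t. ennreal ?C * indicator {0..1::real} t \<partial>lborel)"
      by (rule nn_integral_mono) (rule inner)
    also have "\<dots> < \<infinity>" by (subst nn_integral_cmult_indicator) (auto simp: ennreal_mult_less_top simp del: ennreal_plus)
    finally show "(\<integral>\<^sup>+t. (\<integral>\<^sup>+z. ennreal (norm (T t z)) \<partial>lborel) \<partial>lborel) < \<infinity>" .
  qed
  have iz: "integrable lborel (\<lambda>z. u (p - z) *\<^sub>R newton_grad z)" if u: "bounded_supp u" for u :: "R3 \<Rightarrow> real" and p
  proof -
    have [measurable]: "u \<in> borel_measurable borel" using u by (simp add: bounded_supp_def)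
    show ?thesis
      using integral_translate(4)[of "\<lambda>y. u y *\<^sub>R newton_grad (p - y)" p] newton_field_integrable[OF u, of p] by simp
  qed
  have comp: "newton_field u p $ i = (LINT z|lborel. u (p - z) * newton_grad z $ i)"
    and icomp: "integrable lborel (\<lambda>z. u (p - z) * newton_grad z $ i)" if u: "bounded_supp u" for u :: "R3 \<Rightarrow> real" and p
  proof -
    have [measurable]: "u \<in> borel_measurable borel" using u by (simp add: bounded_supp_def)
    have "newton_field u p $ i = (LINT z|lborel. u (p - z) *\<^sub>R newton_grad z) \<bullet> axis i 1"
      by (simp add: newton_field_reflect inner_axis)
    also have "\<dots> = (LINT z|lborel. (u (p - z) *\<^sub>R newton_grad z) \<bullet> axis i 1)"
      by (rule integral_inner_left[OF iz[OF u], symmetric])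
    finally show "newton_field u p $ i = (LINT z|lborel. u (p - z) * newton_grad z $ i)" by (simp add: inner_axis)
    show "integrable lborel (\<lambda>z. u (p - z) * newton_grad z $ i)"
      using integrable_inner_left[OF iz[OF u, of p], of "axis i 1"] by (simp add: inner_axis)
  qed
  have Dj: "bounded_supp (\<lambda>y. D y $ j)" for j
    using bounded_supp_inner[OF D, of "axis j 1"] by (simp add: inner_axis')
  have "newton_field f (x + h) $ i - newton_field f x $ i
      = (LINT z|lborel. f (x + h - z) * newton_grad z $ i - f (x - z) * newton_grad z $ i)"
    unfolding comp[OF f] by (rule Bochner_Integration.integral_diff[OF icomp[OF f] icomp[OF f], symmetric])
  also have "\<dots> = (LINT z|lborel. (LINT t|lborel. T t z))"
  proof (rule Bochner_Integration.integral_cong[OF refl])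
    fix z
    have "f ((x - z) + h) - f (x - z) = (LINT t|lborel. indicator {0..1} t *\<^sub>R (h \<bullet> D ((x - z) + t *\<^sub>R h)))"
      using fD unfolding line_gradient_def by blast
    then have "(f ((x - z) + h) - f (x - z)) * newton_grad z $ i
        = (LINT t|lborel. (indicator {0..1} t *\<^sub>R (h \<bullet> D ((x - z) + t *\<^sub>R h))) * newton_grad z $ i)"
      unfolding integral_mult_left_zero by simp
    also have "\<dots> = (LINT t|lborel. T t z)" by (simp add: T_def g_def algebra_simps)
    finally show "f (x + h - z) * newton_grad z $ i - f (x - z) * newton_grad z $ i = (LINT t|lborel. T t z)"
      by (simp add: algebra_simps)
  qed
  also have "\<dots> = (LINT t|lborel. (LINT z|lborel. T t z))"
    by (rule lborel_pair.Fubini_integral[OF Tint])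
  also have "\<dots> = (LINT t|lborel. indicator {0..1} t *\<^sub>R (h \<bullet> (\<chi> j. newton_field (\<lambda>y. D y $ j) (x + t *\<^sub>R h) $ i)))"
  proof (rule Bochner_Integration.integral_cong[OF refl])
    fix t :: real
    let ?p = "x + t *\<^sub>R h"
    have "(LINT z|lborel. T t z) = indicator {0..1} t * (LINT z|lborel. g (?p - z) * newton_grad z $ i)"
      unfolding T_def by (rule integral_mult_right_zero)
    also have "(LINT z|lborel. g (?p - z) * newton_grad z $ i)
        = (LINT z|lborel. (\<Sum>j\<in>UNIV. h $ j * (D (?p - z) $ j * newton_grad z $ i)))"
      by (simp add: g_def inner_vec_def sum_distrib_right mult.assoc)
    also have "\<dots> = (\<Sum>j\<in>UNIV. h $ j * (LINT z|lborel. D (?p - z) $ j * newton_grad z $ i))"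
      using icomp[OF Dj] by (subst Bochner_Integration.integral_sum) auto
    also have "\<dots> = h \<bullet> (\<chi> j. newton_field (\<lambda>y. D y $ j) ?p $ i)"
      by (simp add: comp[OF Dj] inner_vec_def)
    finally show "(LINT z|lborel. T t z) = indicator {0..1} t *\<^sub>R (h \<bullet> (\<chi> j. newton_field (\<lambda>y. D y $ j) ?p $ i))"
      by simp
  qed
  finally show "newton_field f (x + h) $ i - newton_field f x $ i
      = (LINT t|lborel. indicator {0..1} t *\<^sub>R (h \<bullet> (\<chi> j. newton_field (\<lambda>y. D y $ j) (x + t *\<^sub>R h) $ i)))" .
qed

text \<open>First derivatives carry the gradient on the kernel; in the second derivatives the additional one
  is on the density. Both are fields of bounded densities.\<close>

theorem newton_conv_Holder_2:
  assumes f: "bounded_supp f" and D: "bounded_supp D" and fD: "line_gradient f D" and \<alpha>: "0 < \<alpha>" "\<alpha> < 1"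
  shows "Holder 2 \<alpha> (convolution newton f)"
proof -
  let ?\<psi> = "convolution newton f"
  have Dj: "bounded_supp (\<lambda>y. D y $ j)" for j
    using bounded_supp_inner[OF D, of "axis j 1"] by (simp add: inner_axis')
  have comp_bounded: "bounded (range (\<lambda>x. newton_field g x $ i))" if g: "bounded_supp g" for g i
  proof -
    obtain M where M: "\<forall>x. norm (newton_field g x) \<le> M" using newton_field_bounded[OF g] ..
    have "norm (newton_field g x $ i) \<le> M" for x
      using component_le_norm_cart[of "newton_field g x" i] M[rule_format, of x] by simp
    then show ?thesis unfolding bounded_iff by (intro exI[of _ M]) auto
  qed
  have pd1: "pd i ?\<psi> = (\<lambda>x. newton_field f x $ i)" for i
    using pd_eqI[OF newton_conv_has_derivative[OF f]] by (rule ext)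
  have cont: "continuous_on UNIV (\<lambda>x. \<chi> j. newton_field (\<lambda>y. D y $ j) x $ i)" for i
    by (intro continuous_on_vec_lambda continuous_on_component newton_field_continuous Dj)
  have der2: "((\<lambda>x. newton_field f x $ i) has_derivative (\<lambda>k. k \<bullet> (\<chi> j. newton_field (\<lambda>y. D y $ j) x $ i))) (at x)" for i x
    by (rule line_gradient_has_derivative[OF newton_field_line_gradient[OF f D fD] cont])
  have pd2: "pd j (\<lambda>x. newton_field f x $ i) = (\<lambda>x. newton_field (\<lambda>y. D y $ j) x $ i)" for i j
    by (rule ext, subst pd_eqI[OF der2]) simp
  have H0: "Holder 0 \<alpha> (\<lambda>x. newton_field (\<lambda>y. D y $ j) x $ i)" for i j
  proof -
    obtain C where C: "\<forall>x x'. norm (newton_field (\<lambda>y. D y $ j) x - newton_field (\<lambda>y. D y $ j) x') \<le> C * dist x x' powr \<alpha>"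
      using newton_field_Holder[OF Dj \<alpha>] ..
    have "\<bar>newton_field (\<lambda>y. D y $ j) x $ i - newton_field (\<lambda>y. D y $ j) x' $ i\<bar> \<le> C * dist x x' powr \<alpha>" for x x'
      using component_le_norm_cart[of "newton_field (\<lambda>y. D y $ j) x - newton_field (\<lambda>y. D y $ j) x'" i] C[rule_format, of x x'] by simp
    then show ?thesis using comp_bounded[OF Dj] by auto
  qed
  have b0: "bounded (range ?\<psi>)"
    using newton_conv_bound[OF bounded_supp_L12[OF f]] unfolding bounded_iff by (auto intro!: exI)
  have d0: "?\<psi> differentiable (at x)" for x
    using newton_conv_has_derivative[OF f] by (rule differentiableI)
  have d1: "(\<lambda>x. newton_field f x $ i) differentiable (at x)" for x i
    using der2 by (rule differentiableI)
  have "Holder (Suc (Suc 0)) \<alpha> ?\<psi>"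
    unfolding Holder.simps(2) pd1 pd2 using b0 d0 d1 comp_bounded[OF f] H0 by blast
  then show ?thesis by (simp add: numeral_2_eq_2)
qed

section \<open>Regularity and stationarity of minimizers\<close>

lemma bounded_supp_scaleR:
  fixes f :: "R3 \<Rightarrow> 'b::euclidean_space"
  assumes "bounded_supp f" shows "bounded_supp (\<lambda>x. c *\<^sub>R f x)"
proof -
  obtain \<rho> B where f: "f \<in> borel_measurable borel" "\<And>x. norm (f x) \<le> B" "\<And>x. norm x > \<rho> \<Longrightarrow> f x = 0" "0 \<le> B"
    by (rule bounded_suppE[OF assms]) (rule that)
  have "norm (c *\<^sub>R f x) \<le> \<bar>c\<bar> * B \<and> (norm x > \<rho> \<longrightarrow> c *\<^sub>R f x = 0)" for x
    using mult_left_mono[OF f(2)[of x], of "\<bar>c\<bar>"] f(3)[of x] by auto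
  then show ?thesis unfolding bounded_supp_def
    using f(1) by (intro conjI exI[of _ \<rho>] exI[of _ "\<bar>c\<bar> * B"]) auto
qed

lemma bounded_supp_compact_support:
  assumes "bounded_supp f" shows "compact_support f"
proof -
  obtain \<rho> B where f: "f \<in> borel_measurable borel" "\<And>x. norm (f x) \<le> B" "\<And>x. norm x > \<rho> \<Longrightarrow> f x = 0" "0 \<le> B"
    by (rule bounded_suppE[OF assms]) (rule that)
  have "{x. f x \<noteq> 0} \<subseteq> cball 0 \<rho>" using f(3) by (auto simp: not_less[symmetric])
  then have "bounded {x. f x \<noteq> 0}" by (rule bounded_subset[OF bounded_cball])
  then show ?thesis by (simp add: compact_support_def compact_closure)
qed

text \<open>The Lipschitz bound serves at distances below 1, the bound on \<open>f\<close> beyond.\<close>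

lemma Lipschitz_bounded_Holder_0:
  assumes bd: "\<And>x. \<bar>f x\<bar> \<le> B" and L: "\<And>x y. \<bar>f y - f x\<bar> \<le> L * norm (y - x)" and \<alpha>: "0 < \<alpha>" "\<alpha> < 1"
  shows "Holder 0 \<alpha> f"
proof -
  have L0: "0 \<le> L"
  proof -
    have "0 \<le> L * norm ((axis 1 1 :: R3) - 0)" by (rule order_trans[OF abs_ge_zero L])
    then show ?thesis by (simp add: norm_axis_1)
  qed
  have B0: "0 \<le> B" using bd[of 0] by linarith
  have "\<bar>f x - f y\<bar> \<le> (L + 2 * B) * dist x y powr \<alpha>" for x y
  proof (cases "dist x y \<le> 1")
    case True
    have "dist x y \<le> dist x y powr \<alpha>"
    proof (cases "dist x y = 0")
      case False
      then have "dist x y powr 1 \<le> dist x y powr \<alpha>" using True \<alpha> by (intro powr_mono') auto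
      then show ?thesis using False by simp
    qed simp
    then have "L * dist x y \<le> L * dist x y powr \<alpha>" using L0 by (rule mult_left_mono)
    also have "\<dots> \<le> (L + 2 * B) * dist x y powr \<alpha>" using B0 by (intro mult_right_mono) auto
    finally show ?thesis using L[of x y] by (simp add: dist_norm)
  next
    case False
    have "\<bar>f x - f y\<bar> \<le> 2 * B" using bd[of x] bd[of y] by linarith
    also have "\<dots> \<le> (L + 2 * B) * 1" using L0 by simp
    also have "\<dots> \<le> (L + 2 * B) * dist x y powr \<alpha>"
      using False \<alpha> L0 B0 by (intro mult_left_mono ge_one_powr_ge_zero) auto
    finally show ?thesis .
  qed
  moreover have "bounded (range f)" unfolding bounded_iff using bd by (intro exI[of _ B]) auto
  ultimately show ?thesis by auto
qed

text \<open>One species at a time: \<open>W\<close> is its confinement and \<open>\<theta>\<close> the field of both species.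
  On the set \<open>u > 0\<close> the flux potential \<open>2u + W + \<theta>\<close> is the constant \<open>c\<close>.\<close>

lemma equilibrium_density:
  fixes u W \<theta> :: "R3 \<Rightarrow> real"
  assumes dW: "\<And>x. (W has_derivative (\<lambda>k. k \<bullet> DW x)) (at x)" and cW: "continuous_on UNIV DW"
    and d\<theta>: "\<And>x. (\<theta> has_derivative (\<lambda>k. k \<bullet> D\<theta> x)) (at x)" and c\<theta>: "continuous_on UNIV D\<theta>"
    and u: "\<And>x. u x = 1/2 * max 0 (c - W x - \<theta> x)" and bu: "bounded_supp u"
  shows "\<exists>D. bounded_supp D \<and> line_gradient u D"
    and "u \<in> W12"
    and "0 < \<alpha> \<Longrightarrow> \<alpha> < 1 \<Longrightarrow> Holder 0 \<alpha> u"
    and "\<exists>w. has_weak_grad (\<lambda>x. 2 * u x + W x + \<theta> x) w \<and> has_weak_div (\<lambda>x. u x *\<^sub>R w x) (\<lambda>x. 0)"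
proof -
  obtain \<rho> B where B: "u \<in> borel_measurable borel" "\<And>x. norm (u x) \<le> B" "\<And>x. norm x > \<rho> \<Longrightarrow> u x = 0" "0 \<le> B"
    by (rule bounded_suppE[OF bu]) (rule that)
  define s where "s x = c - W x - \<theta> x" for x
  define S where "S x = - DW x - D\<theta> x" for x
  define P where "P x = (if s x > 0 then S x else 0)" for x
  have ds: "(s has_derivative (\<lambda>k. k \<bullet> S x)) (at x)" for x
    unfolding s_def S_def by (auto intro!: derivative_eq_intros dW d\<theta> simp: inner_diff_right)
  have cS: "continuous_on UNIV S" unfolding S_def by (intro continuous_intros cW c\<theta>)
  have cs: "continuous_on UNIV s" by (rule differentiable_imp_continuous_on) (auto simp: differentiable_on_def intro: differentiableI[OF ds])
  have [measurable]: "s \<in> borel_measurable borel" "S \<in> borel_measurable borel"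
    using cs cS by (auto intro: borel_measurable_continuous_onI)
  have us: "u x = 1/2 * max 0 (s x)" for x by (simp add: u s_def)
  have lbS: "loc_bounded S" by (rule loc_bounded_continuous[OF cS])
  have P: "bounded_supp P"
  proof -
    obtain K where K: "\<forall>x. norm x \<le> \<rho> \<longrightarrow> norm (S x) \<le> K" using lbS unfolding loc_bounded_def by blast
    have "norm (P x) \<le> max 0 K \<and> (norm x > \<rho> \<longrightarrow> P x = 0)" for x
    proof (cases "s x > 0")
      case True
      then have "u x \<noteq> 0" by (simp add: us)
      then have "norm x \<le> \<rho>" using B(3)[of x] by linarith
      then show ?thesis using True K by (auto simp: P_def le_max_iff_disj)
    qed (simp add: P_def)
    moreover have "P \<in> borel_measurable borel" unfolding P_def by measurable
    ultimately show ?thesis unfolding bounded_supp_def by (intro conjI exI[of _ \<rho>] exI[of _ "max 0 K"]) auto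
  qed
  have lP: "line_gradient (\<lambda>x. max 0 (s x)) P"
    unfolding P_def by (rule line_gradient_pos_part[OF ds cS])
  have lu: "line_gradient u (\<lambda>x. (1/2) *\<^sub>R P x)"
  proof -
    have "line_gradient (\<lambda>x. 1/2 * max 0 (s x) + 0 * max 0 (s x)) (\<lambda>x. (1/2) *\<^sub>R P x + 0 *\<^sub>R P x)"
      by (rule line_gradient_combination[OF lP _ lP]) (intro bounded_supp_loc_bounded P)+
    then show ?thesis by (simp add: us[abs_def])
  qed
  have bP: "bounded_supp (\<lambda>x. (1/2) *\<^sub>R P x)" by (rule bounded_supp_scaleR[OF P])
  show "\<exists>D. bounded_supp D \<and> line_gradient u D" using lu bP by blast
  have "has_weak_grad u (\<lambda>x. (1/2) *\<^sub>R P x)"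
    by (intro has_weak_gradI_line_gradient loc_bounded_locally_integrable bounded_supp_loc_bounded bu bP lu)
  then show "u \<in> W12"
    using bounded_supp_L2[OF bu] bounded_supp_L2[OF bP] by (auto simp: W12_def)
  obtain \<sigma> L where L: "(\<lambda>x. (1/2) *\<^sub>R P x) \<in> borel_measurable borel" "\<And>x. norm ((1/2) *\<^sub>R P x) \<le> L"
    "\<And>x. norm x > \<sigma> \<Longrightarrow> (1/2) *\<^sub>R P x = 0" "0 \<le> L"
    by (rule bounded_suppE[OF bP]) (rule that)
  show "Holder 0 \<alpha> u" if "0 < \<alpha>" "\<alpha> < 1"
  proof (rule Lipschitz_bounded_Holder_0[OF _ _ that])
    show "\<bar>u x\<bar> \<le> B" for x using B(2)[of x] by simp
    show "\<bar>u y - u x\<bar> \<le> L * norm (y - x)" for x y by (rule line_gradient_Lipschitz[OF lu L(2)])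
  qed
  let ?w = "\<lambda>x. P x + (DW x + D\<theta> x)"
  have dsum: "((\<lambda>x. W x + \<theta> x) has_derivative (\<lambda>k. k \<bullet> (DW x + D\<theta> x))) (at x)" for x
    by (auto intro!: derivative_eq_intros dW d\<theta> simp: inner_add_right)
  have csum: "continuous_on UNIV (\<lambda>x. DW x + D\<theta> x)" by (intro continuous_intros cW c\<theta>)
  have "line_gradient (\<lambda>x. 1 * max 0 (s x) + 1 * (W x + \<theta> x)) (\<lambda>x. 1 *\<^sub>R P x + 1 *\<^sub>R (DW x + D\<theta> x))"
    by (rule line_gradient_combination[OF lP bounded_supp_loc_bounded[OF P] line_gradientI[OF dsum csum] loc_bounded_continuous[OF csum]])
  then have lw: "line_gradient (\<lambda>x. 2 * u x + W x + \<theta> x) ?w" by (simp add: us add.assoc)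
  have cWt: "continuous_on UNIV (\<lambda>x. W x + \<theta> x)"
    by (rule differentiable_imp_continuous_on) (auto simp: differentiable_on_def intro: differentiableI[OF dsum])
  have "loc_bounded (\<lambda>x. 2 *\<^sub>R u x + 1 *\<^sub>R (W x + \<theta> x))"
    by (intro loc_bounded_combination bounded_supp_loc_bounded bu loc_bounded_continuous cWt)
  then have l1: "locally_integrable (\<lambda>x. 2 * u x + W x + \<theta> x)"
    using loc_bounded_locally_integrable by (simp add: add.assoc)
  have "loc_bounded (\<lambda>x. 1 *\<^sub>R P x + 1 *\<^sub>R (DW x + D\<theta> x))"
    by (intro loc_bounded_combination bounded_supp_loc_bounded P loc_bounded_continuous csum)
  then have l2: "locally_integrable ?w" using loc_bounded_locally_integrable by simp
  have "u x *\<^sub>R ?w x = 0" for x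
    by (cases "s x > 0") (simp_all add: P_def S_def us)
  then have flux: "(\<lambda>x. u x *\<^sub>R ?w x) = (\<lambda>x. 0)" by (rule ext)
  have "has_weak_div (\<lambda>x. 0) (\<lambda>x. 0)"
    unfolding has_weak_div_def by (simp add: locally_integrable_continuous)
  then have "has_weak_div (\<lambda>x. u x *\<^sub>R ?w x) (\<lambda>x. 0)" by (simp only: flux)
  with has_weak_gradI_line_gradient[OF l1 l2 lw]
  show "\<exists>w. has_weak_grad (\<lambda>x. 2 * u x + W x + \<theta> x) w \<and> has_weak_div (\<lambda>x. u x *\<^sub>R w x) (\<lambda>x. 0)"
    by (intro exI[of _ ?w] conjI)
qed

lemma coercive_pos_part_bounded_supp:
  fixes u W \<theta> :: "R3 \<Rightarrow> real"
  assumes u: "\<And>x. u x = 1/2 * max 0 (c - W x - \<theta> x)" and [measurable]: "u \<in> borel_measurable borel"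
    and W: "\<And>x. a * (norm x)\<^sup>2 - b \<le> W x" and a: "a > 0" and \<theta>: "\<And>x. \<bar>\<theta> x\<bar> \<le> M"
  shows "bounded_supp u"
proof -
  define K where "K = \<bar>c\<bar> + \<bar>b\<bar> + M"
  have M: "0 \<le> M" using \<theta>[of 0] by linarith
  have K: "0 \<le> K" using M by (simp add: K_def)
  have le: "c - W x - \<theta> x \<le> K - a * (norm x)\<^sup>2" for x
    using W[of x] abs_le_D2[OF \<theta>[of x]] abs_ge_self[of c] abs_ge_self[of b] unfolding K_def by linarith
  have "norm (u x) \<le> K \<and> (norm x > sqrt (K / a) \<longrightarrow> u x = 0)" for x
  proof
    have "0 \<le> a * (norm x)\<^sup>2" using a by simp
    then have "max 0 (c - W x - \<theta> x) \<le> K" using le[of x] K by simp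
    then show "norm (u x) \<le> K" using K unfolding u by simp
    show "norm x > sqrt (K / a) \<longrightarrow> u x = 0"
    proof
      assume "norm x > sqrt (K / a)"
      then have "(sqrt (K / a))\<^sup>2 < (norm x)\<^sup>2" using K a by (intro power_strict_mono) auto
      then have "K < a * (norm x)\<^sup>2" using K a by (simp add: divide_less_eq mult.commute)
      then show "u x = 0" using le[of x] unfolding u by simp
    qed
  qed
  then show ?thesis unfolding bounded_supp_def by (intro conjI exI[of _ "sqrt (K / a)"] exI[of _ K]) auto
qed

context confinement
begin

lemma potential_cong:
  assumes [measurable]: "u \<in> borel_measurable borel" "v \<in> borel_measurable borel" "u' \<in> borel_measurable borel" "v' \<in> borel_measurable borel"
    and "AE x in lborel. u' x = u x" "AE x in lborel. v' x = v x"
  shows "potential u' v' = potential u v"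
proof
  fix x
  show "potential u' v' x = potential u v x"
    unfolding potential_def convolution_def
  proof (rule integral_cong_AE)
    show "AE y in lborel. newton (x - y) * (u' y - v' y) = newton (x - y) * (u y - v y)"
      using assms(5,6) by eventually_elim simp
  qed measurable
qed

lemma minimizer_cong:
  assumes m: "minimizer u v" and [measurable]: "u' \<in> borel_measurable borel" "v' \<in> borel_measurable borel"
    and eu: "AE x in lborel. u' x = u x" and ev: "AE x in lborel. v' x = v x"
  shows "minimizer u' v'"
proof -
  have u: "u \<in> Adm" and v: "v \<in> Adm" using m by (auto simp: minimizer_def)
  note [measurable] = AdmD(7)[OF u] AdmD(7)[OF v]
  have Adm: "f' \<in> Adm" if f: "f \<in> Adm" and e: "AE x in lborel. f' x = f x" and [measurable]: "f' \<in> borel_measurable borel" for f f'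
  proof -
    note [measurable] = AdmD(7)[OF f]
    show ?thesis
    proof (rule AdmI)
      show "integrable lborel f'"
        by (rule integrable_cong_AE_imp[OF AdmD(5)[OF f]]) (use e in \<open>auto elim: eventually_mono\<close>)
      have "(LINT x|lborel. f' x) = (LINT x|lborel. f x)" using e by (intro integral_cong_AE) auto
      then show "(LINT x|lborel. f' x) = 1" by (simp add: AdmD(3)[OF f])
      show "AE x in lborel. 0 \<le> f' x" using e AdmD(4)[OF f] by eventually_elim simp
      show "integrable lborel (\<lambda>x. (norm x)\<^sup>2 * f' x)"
        by (rule integrable_cong_AE_imp[OF AdmD(6)[OF f]]) (use e in \<open>auto elim: eventually_mono\<close>)
      show "integrable lborel (\<lambda>x. (f' x)\<^sup>2)"
        by (rule integrable_cong_AE_imp[OF AdmD(8)[OF f]]) (use e in \<open>auto elim: eventually_mono\<close>)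
    qed
  qed
  have u': "u' \<in> Adm" and v': "v' \<in> Adm" using Adm[OF u eu] Adm[OF v ev] by auto
  have pot: "convolution newton (\<lambda>x. u' x - v' x) = convolution newton (\<lambda>x. u x - v x)"
    using potential_cong[OF _ _ _ _ eu ev] by (simp add: potential_def)
  have c: "coulomb (\<lambda>x. u' x - v' x) (\<lambda>x. u' x - v' x) = coulomb (\<lambda>x. u x - v x) (\<lambda>x. u x - v x)"
    unfolding coulomb_def pot
  proof (rule integral_cong_AE)
    show "AE x in lborel. (u' x - v' x) * convolution newton (\<lambda>x. u x - v x) x = (u x - v x) * convolution newton (\<lambda>x. u x - v x) x"
      using eu ev by eventually_elim simp
  qed measurable
  have "(LINT x|lborel. (u' x)\<^sup>2) = (LINT x|lborel. (u x)\<^sup>2)" "(LINT x|lborel. u' x * U x) = (LINT x|lborel. u x * U x)"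
    by (rule integral_cong_AE; use eu in \<open>auto elim: eventually_mono\<close>)+
  moreover have "(LINT x|lborel. (v' x)\<^sup>2) = (LINT x|lborel. (v x)\<^sup>2)" "(LINT x|lborel. v' x * V x) = (LINT x|lborel. v x * V x)"
    by (rule integral_cong_AE; use ev in \<open>auto elim: eventually_mono\<close>)+
  ultimately have "J u' v' = J u v" by (simp add: J_def c)
  then show ?thesis using m u' v' by (simp add: minimizer_def)
qed

text \<open>The Euler-Lagrange equations hold almost everywhere; since the potential does not see null
  sets, their right-hand sides are representatives for which they hold everywhere.\<close>

lemma minimizer_representative:
  "\<exists>u v c d. minimizer u v \<and> (\<forall>x. u x = 1/2 * max 0 (c - U x - \<epsilon> * potential u v x))
     \<and> (\<forall>x. v x = 1/2 * max 0 (d - V x + \<epsilon> * potential u v x))"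
proof -
  obtain u0 v0 where m: "minimizer u0 v0" using minimizer_exists by blast
  then have [measurable]: "u0 \<in> borel_measurable borel" "v0 \<in> borel_measurable borel"
    by (auto simp: minimizer_def dest: AdmD(7))
  have [measurable]: "potential u0 v0 \<in> borel_measurable borel" unfolding potential_def by measurable
  obtain c where c: "AE x in lborel. u0 x = 1/2 * max 0 (c - U x - \<epsilon> * potential u0 v0 x)"
    using minimizer_Euler_Lagrange(1)[OF m] by blast
  obtain d where d: "AE x in lborel. v0 x = 1/2 * max 0 (d - V x + \<epsilon> * potential u0 v0 x)"
    using minimizer_Euler_Lagrange(2)[OF m] by blast
  define u where "u x = 1/2 * max 0 (c - U x - \<epsilon> * potential u0 v0 x)" for x
  define v where "v x = 1/2 * max 0 (d - V x + \<epsilon> * potential u0 v0 x)" for x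
  have [measurable]: "u \<in> borel_measurable borel" "v \<in> borel_measurable borel"
    unfolding u_def v_def by measurable
  have eu: "AE x in lborel. u x = u0 x" using c by eventually_elim (simp add: u_def)
  have ev: "AE x in lborel. v x = v0 x" using d by eventually_elim (simp add: v_def)
  have "potential u v = potential u0 v0" by (rule potential_cong[OF _ _ _ _ eu ev]) measurable
  moreover have "minimizer u v" by (rule minimizer_cong[OF m _ _ eu ev]) measurable
  ultimately show ?thesis by (intro exI[of _ u] exI[of _ v] exI[of _ c] exI[of _ d]) (simp add: u_def v_def)
qed

text \<open>Pairs outside \<open>Adm\<close> have infinite energy and do not compete.\<close>

lemma minimizer_is_arg_min:
  assumes m: "minimizer u v"
  shows "is_arg_min (energy U V \<epsilon>) (\<lambda>p. p \<in> X) (u, v)"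
  unfolding is_arg_min_def
proof (intro conjI notI)
  have u: "u \<in> Adm" and v: "v \<in> Adm" using m by (auto simp: minimizer_def)
  show "(u, v) \<in> X" using u v by (rule Adm_X)
  assume "\<exists>y. y \<in> X \<and> energy U V \<epsilon> y < energy U V \<epsilon> (u, v)"
  then obtain u' v' where p: "(u', v') \<in> X" "energy U V \<epsilon> (u', v') < energy U V \<epsilon> (u, v)" by auto
  have A: "u' \<in> Adm \<and> v' \<in> Adm"
  proof (rule ccontr)
    assume "\<not> (u' \<in> Adm \<and> v' \<in> Adm)"
    from energy_outside[OF p(1) this] p(2) show False by simp
  qed
  have "J u v \<le> J u' v'" using m A by (simp add: minimizer_def)
  with p(2) A u v show False by (simp add: energy_eq_J)
qed

lemma is_arg_min_unique:
  assumes m: "minimizer u v" and arg: "is_arg_min (energy U V \<epsilon>) (\<lambda>p. p \<in> X) (u', v')"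
  shows "(AE x in lborel. u' x = u x) \<and> (AE x in lborel. v' x = v x)"
proof -
  have u: "u \<in> Adm" and v: "v \<in> Adm" using m by (auto simp: minimizer_def)
  have p: "(u', v') \<in> X" and le: "\<not> energy U V \<epsilon> (u, v) < energy U V \<epsilon> (u', v')"
    using arg Adm_X[OF u v] unfolding is_arg_min_def by blast+
  have A: "u' \<in> Adm \<and> v' \<in> Adm"
  proof (rule ccontr)
    assume "\<not> (u' \<in> Adm \<and> v' \<in> Adm)"
    from energy_outside[OF p this] le show False by (simp add: energy_eq_J[OF u v])
  qed
  then have "J u' v' \<le> J u v" using le by (simp add: energy_eq_J u v)
  with minimizer_unique[OF m] A show ?thesis by blast
qed

end

section \<open>Growth of uniformly convex potentials\<close>

text \<open>The set where the bound fails is open and null, hence empty.\<close>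

lemma continuous_AE_le:
  fixes g :: "R3 \<Rightarrow> real"
  assumes "continuous_on UNIV g" "AE x in lborel. g x \<le> B"
  shows "g x \<le> B"
proof (rule ccontr)
  assume "\<not> g x \<le> B"
  let ?S = "{x. B < g x}"
  have op: "open ?S" by (rule open_Collect_less) (use assms(1) in \<open>auto intro: continuous_intros\<close>)
  have "AE x in lborel. x \<notin> ?S" using assms(2) by eventually_elim simp
  then have "?S \<in> null_sets lborel" using op by (subst AE_iff_null_sets) auto
  then have "negligible ?S" using op by (simp add: negligible_iff_null_sets null_sets_completionI)
  then have "?S = {}" using open_not_negligible[OF op] by blast
  moreover have "x \<in> ?S" using \<open>\<not> g x \<le> B\<close> by simp
  ultimately show False by blast
qed

text \<open>Taylor's theorem with the remainder of Lagrange along the segment from the origin to \<open>x\<close>.\<close>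

lemma Ck_2_second_order:
  assumes U: "Ck 2 U"
  shows "\<exists>\<xi>. U x = U 0 + x \<bullet> grad U 0 + (x \<bullet> (hess U \<xi> *v x)) / 2"
proof -
  have C: "\<And>x. U differentiable (at x)" "\<And>i x. pd i U differentiable (at x)"
    using U by (auto simp: numeral_2_eq_2)
  define g where "g t = U (t *\<^sub>R x)" for t :: real
  define g1 where "g1 t = x \<bullet> grad U (t *\<^sub>R x)" for t :: real
  define g2 where "g2 t = x \<bullet> (hess U (t *\<^sub>R x) *v x)" for t :: real
  have line: "((\<lambda>t. t *\<^sub>R x) has_derivative (\<lambda>s. s *\<^sub>R x)) (at t)" for t :: real
    by (auto intro!: derivative_eq_intros)
  have along: "((\<lambda>t. f (t *\<^sub>R x)) has_real_derivative (x \<bullet> grad f (t *\<^sub>R x))) (at t)"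
    if "\<And>y. f differentiable (at y)" for f :: "R3 \<Rightarrow> real" and t
    using has_derivative_compose[OF line has_derivative_grad[OF that]]
    unfolding has_field_derivative_def by (rule has_derivative_eq_rhs) auto
  have d0: "(g has_real_derivative g1 t) (at t)" for t
    unfolding g_def g1_def by (rule along[OF C(1)])
  have d1: "(g1 has_real_derivative g2 t) (at t)" for t
  proof -
    have "((\<lambda>t. \<Sum>j\<in>UNIV. x $ j * pd j U (t *\<^sub>R x)) has_real_derivative (\<Sum>j\<in>UNIV. x $ j * (x \<bullet> grad (pd j U) (t *\<^sub>R x)))) (at t)"
      by (intro DERIV_sum DERIV_cmult along C(2))
    moreover have "(\<lambda>t. \<Sum>j\<in>UNIV. x $ j * pd j U (t *\<^sub>R x)) = g1"
      by (simp add: g1_def[abs_def] inner_vec_def grad_def)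
    moreover have "(\<Sum>j\<in>UNIV. x $ j * (x \<bullet> grad (pd j U) (t *\<^sub>R x))) = g2 t"
    proof -
      have "(\<Sum>j\<in>UNIV. x $ j * (x \<bullet> grad (pd j U) (t *\<^sub>R x))) = (\<Sum>j\<in>UNIV. \<Sum>i\<in>UNIV. x $ i * (pd i (pd j U) (t *\<^sub>R x) * x $ j))"
        by (simp add: inner_vec_def grad_def sum_distrib_left mult_ac)
      also have "\<dots> = (\<Sum>i\<in>UNIV. \<Sum>j\<in>UNIV. x $ i * (pd i (pd j U) (t *\<^sub>R x) * x $ j))" by (rule sum.swap)
      also have "\<dots> = g2 t"
        by (simp add: g2_def inner_vec_def matrix_vector_mult_def hess_def sum_distrib_left)
      finally show ?thesis .
    qed
    ultimately show ?thesis by simp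
  qed
  have "\<exists>t>0. t < 1 \<and> g 1 = (\<Sum>m<2. (if m = 0 then g else if m = 1 then g1 else g2) 0 / fact m * 1 ^ m)
      + (if (2::nat) = 0 then g else if (2::nat) = 1 then g1 else g2) t / fact 2 * 1 ^ 2"
    by (rule Maclaurin[where diff = "\<lambda>m. if m = 0 then g else if m = 1 then g1 else g2"])
      (use d0 d1 in \<open>auto simp: less_2_cases_iff\<close>)
  then obtain t where "g 1 = g 0 + g1 0 + g2 t / 2" by (auto simp: numeral_2_eq_2 lessThan_Suc)
  then show ?thesis by (intro exI[of _ "t *\<^sub>R x"]) (simp add: g_def g1_def g2_def)
qed

text \<open>Taylor expansion at the origin. The linear term is absorbed by half of the quadratic lower bound, with
  Young's inequality; the factor 9 counts the entries of the Hessian.\<close>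

lemma uniformly_convex_growth:
  assumes U: "Ck 2 U" and H: "hess U \<in> Linf" and lam: "lam > 0" and le: "\<And>x. matrix_le (lam *\<^sub>R mat 1) (hess U x)"
  shows "\<exists>C b. \<forall>x. \<bar>U x\<bar> \<le> C * (1 + (norm x)\<^sup>2) \<and> lam / 4 * (norm x)\<^sup>2 - b \<le> U x"
proof -
  have "continuous_on UNIV (hess U)"
    unfolding hess_def using U by (intro continuous_on_vec_lambda) (auto simp: numeral_2_eq_2)
  then have cont: "continuous_on UNIV (\<lambda>x. norm (hess U x))" by (rule continuous_on_norm)
  obtain B where "AE x in lborel. norm (hess U x) \<le> B" using H by (auto simp: Linf_def)
  then have B: "norm (hess U x) \<le> B" for x by (rule continuous_AE_le[OF cont])
  have upper: "\<bar>x \<bullet> (hess U \<xi> *v x)\<bar> \<le> 9 * B * (norm x)\<^sup>2" for x \<xi> :: R3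
  proof -
    have "\<bar>x \<bullet> (hess U \<xi> *v x)\<bar> = \<bar>\<Sum>i\<in>UNIV. \<Sum>j\<in>UNIV. x $ i * (hess U \<xi> $ i $ j * x $ j)\<bar>"
      by (simp add: inner_vec_def matrix_vector_mult_def sum_distrib_left)
    also have "\<dots> \<le> (\<Sum>i\<in>(UNIV::3 set). \<bar>\<Sum>j\<in>UNIV. x $ i * (hess U \<xi> $ i $ j * x $ j)\<bar>)" by (rule sum_abs)
    also have "\<dots> \<le> (\<Sum>i\<in>(UNIV::3 set). \<Sum>j\<in>(UNIV::3 set). \<bar>x $ i * (hess U \<xi> $ i $ j * x $ j)\<bar>)"
      by (intro sum_mono sum_abs)
    also have "\<dots> \<le> (\<Sum>i\<in>(UNIV::3 set). \<Sum>j\<in>(UNIV::3 set). norm x * (B * norm x))"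
    proof (intro sum_mono)
      fix i j :: 3
      have h: "\<bar>hess U \<xi> $ i $ j\<bar> \<le> B"
        using component_le_norm_cart[of "hess U \<xi> $ i" j] Finite_Cartesian_Product.norm_nth_le[of "hess U \<xi>" i] B[of \<xi>] by linarith
      then have "0 \<le> B" by linarith
      have "\<bar>hess U \<xi> $ i $ j\<bar> * \<bar>x $ j\<bar> \<le> B * norm x"
        by (rule mult_mono[OF h component_le_norm_cart \<open>0 \<le> B\<close>]) simp
      then have "\<bar>x $ i\<bar> * (\<bar>hess U \<xi> $ i $ j\<bar> * \<bar>x $ j\<bar>) \<le> norm x * (B * norm x)"
        by (rule mult_mono[OF component_le_norm_cart]) simp_all
      then show "\<bar>x $ i * (hess U \<xi> $ i $ j * x $ j)\<bar> \<le> norm x * (B * norm x)" by (simp add: abs_mult)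
    qed
    also have "\<dots> = 9 * B * (norm x)\<^sup>2" by (simp add: power2_eq_square)
    finally show ?thesis .
  qed
  have lower: "lam * (norm x)\<^sup>2 \<le> x \<bullet> (hess U \<xi> *v x)" for x \<xi> :: R3
  proof -
    have "0 \<le> x \<bullet> ((hess U \<xi> - lam *\<^sub>R mat 1) *v x)" using le[of \<xi>] by (simp add: matrix_le_def)
    also have "(hess U \<xi> - lam *\<^sub>R mat 1) *v x = hess U \<xi> *v x - lam *\<^sub>R x"
      by (simp add: matrix_vector_mult_diff_rdistrib scaleR_matrix_vector_assoc[symmetric])
    finally show ?thesis by (simp add: inner_diff_right power2_norm_eq_inner)
  qed
  define G where "G = norm (grad U 0)"
  have G: "\<bar>x \<bullet> grad U 0\<bar> \<le> norm x * G" for x unfolding G_def by (rule Cauchy_Schwarz_ineq2)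
  have G0: "0 \<le> G" by (simp add: G_def)
  have B0: "0 \<le> B" using B[of 0] norm_ge_zero[of "hess U 0"] by linarith
  have "\<bar>U x\<bar> \<le> (\<bar>U 0\<bar> + G + 9 * B) * (1 + (norm x)\<^sup>2) \<and> lam / 4 * (norm x)\<^sup>2 - (\<bar>U 0\<bar> + G\<^sup>2 / lam) \<le> U x" for x
  proof
    obtain \<xi> where T: "U x = U 0 + x \<bullet> grad U 0 + (x \<bullet> (hess U \<xi> *v x)) / 2"
      using Ck_2_second_order[OF U, of x] by blast
    have n1: "norm x \<le> 1 + (norm x)\<^sup>2"
    proof -
      have "0 \<le> (norm x - 1)\<^sup>2 + 1 + (norm x)\<^sup>2" by simp
      then show ?thesis by (simp add: power2_diff)
    qed
    have "\<bar>U x\<bar> \<le> \<bar>U 0\<bar> + norm x * G + 9 * B * (norm x)\<^sup>2"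
      using G[of x] upper[of x \<xi>] B0 mult_nonneg_nonneg[OF B0 zero_le_power2[of "norm x"]] unfolding T by linarith
    also have "\<dots> \<le> \<bar>U 0\<bar> * (1 + (norm x)\<^sup>2) + G * (1 + (norm x)\<^sup>2) + 9 * B * (1 + (norm x)\<^sup>2)"
    proof (intro add_mono)
      show "\<bar>U 0\<bar> \<le> \<bar>U 0\<bar> * (1 + (norm x)\<^sup>2)" by (simp add: distrib_left)
      show "norm x * G \<le> G * (1 + (norm x)\<^sup>2)" using mult_left_mono[OF n1 G0] by (simp add: mult.commute)
      show "9 * B * (norm x)\<^sup>2 \<le> 9 * B * (1 + (norm x)\<^sup>2)" using B0 by (intro mult_left_mono) auto
    qed
    finally show "\<bar>U x\<bar> \<le> (\<bar>U 0\<bar> + G + 9 * B) * (1 + (norm x)\<^sup>2)" by (simp add: algebra_simps)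
    have "norm x * G \<le> lam / 4 * (norm x)\<^sup>2 + G\<^sup>2 / lam"
    proof -
      have "0 \<le> (lam * norm x - 2 * G)\<^sup>2 / (4 * lam)" using lam by simp
      also have "\<dots> = lam / 4 * (norm x)\<^sup>2 + G\<^sup>2 / lam - norm x * G"
        using lam by (simp add: power2_diff field_simps power2_eq_square)
      finally show ?thesis by simp
    qed
    moreover have "lam / 2 * (norm x)\<^sup>2 \<le> (x \<bullet> (hess U \<xi> *v x)) / 2" using lower[of x \<xi>] by simp
    moreover have "lam / 2 * (norm x)\<^sup>2 = lam / 4 * (norm x)\<^sup>2 + lam / 4 * (norm x)\<^sup>2" by simp
    ultimately show "lam / 4 * (norm x)\<^sup>2 - (\<bar>U 0\<bar> + G\<^sup>2 / lam) \<le> U x"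
      using G[of x] unfolding T by linarith
  qed
  then show ?thesis by blast
qed

section \<open>The minimizer\<close>

theorem theorem1p1:
  fixes U V :: "real^3 \<Rightarrow> real" and lam \<epsilon> :: real
  assumes "Ck 2 U" and "Ck 2 V"
    and "hess U \<in> Linf" and "hess V \<in> Linf"
    and "lam > 0"
    and "\<And>x. matrix_le (lam *\<^sub>R mat 1) (hess U x)"
    and "\<And>x. matrix_le (lam *\<^sub>R mat 1) (hess V x)"
    and "\<epsilon> > 0"
  shows "\<exists>u v.
      is_arg_min (energy U V \<epsilon>) (\<lambda>p. p \<in> X) (u, v)
    \<and> (u, v) \<in> X \<inter> (W12 \<times> W12)
    \<and> (\<forall>u' v'. is_arg_min (energy U V \<epsilon>) (\<lambda>p. p \<in> X) (u', v') \<longrightarrow>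
          (AE x in lborel. u' x = u x) \<and> (AE x in lborel. v' x = v x))
    \<and> stationary_solution U V \<epsilon> u v (potential u v)
    \<and> (\<exists>Cu Cv :: real.
          (\<forall>x. u x = 1/2 * max 0 (Cu - U x - \<epsilon> * potential u v x))
        \<and> (\<forall>x. v x = 1/2 * max 0 (Cv - V x + \<epsilon> * potential u v x))
        \<and> (LINT x|lborel. \<bar>u x\<bar>) = 1 \<and> (LINT x|lborel. \<bar>v x\<bar>) = 1)
    \<and> compact_support u \<and> compact_support v
    \<and> potential u v \<in> Linf
    \<and> (\<forall>\<alpha>::real. 0 < \<alpha> \<and> \<alpha> < 1 \<longrightarrow>
          Holder 0 \<alpha> u \<and> Holder 0 \<alpha> v \<and> Holder 2 \<alpha> (potential u v))"
proof -
  have C1: "Ck 1 U" "Ck 1 V" using Ck_Suc_imp[of 1] assms(1,2) by (simp_all add: numeral_2_eq_2)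
  have contU: "continuous_on UNIV U" and contV: "continuous_on UNIV V"
    using Ck_Suc_imp[of 0] C1 by simp_all
  have derU: "(U has_derivative (\<lambda>k. k \<bullet> grad U x)) (at x)" and derV: "(V has_derivative (\<lambda>k. k \<bullet> grad V x)) (at x)" for x
    using C1 by (auto intro: has_derivative_grad)
  have cgU: "continuous_on UNIV (grad U)" and cgV: "continuous_on UNIV (grad V)"
    using Ck_Suc_continuous_grad[of 0] C1 by simp_all
  obtain CU bU where gU: "\<forall>x. \<bar>U x\<bar> \<le> CU * (1 + (norm x)\<^sup>2) \<and> lam / 4 * (norm x)\<^sup>2 - bU \<le> U x"
    using uniformly_convex_growth[OF assms(1,3,5,6)] by blast
  obtain CV bV where gV: "\<forall>x. \<bar>V x\<bar> \<le> CV * (1 + (norm x)\<^sup>2) \<and> lam / 4 * (norm x)\<^sup>2 - bV \<le> V x"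
    using uniformly_convex_growth[OF assms(2,4,5,7)] by blast
  interpret confinement U V \<epsilon> "lam / 4" "max bU bV" "max CU CV"
  proof
    fix x :: R3
    have "CU * (1 + (norm x)\<^sup>2) \<le> max CU CV * (1 + (norm x)\<^sup>2)" "CV * (1 + (norm x)\<^sup>2) \<le> max CU CV * (1 + (norm x)\<^sup>2)"
      by (intro mult_right_mono; simp)+
    then show "\<bar>U x\<bar> \<le> max CU CV * (1 + (norm x)\<^sup>2)" "\<bar>V x\<bar> \<le> max CU CV * (1 + (norm x)\<^sup>2)"
      using gU[rule_format, of x] gV[rule_format, of x] by linarith+
    show "lam / 4 * (norm x)\<^sup>2 - max bU bV \<le> U x" "lam / 4 * (norm x)\<^sup>2 - max bU bV \<le> V x"
      using gU[rule_format, of x] gV[rule_format, of x] by linarith+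
  qed (use assms contU contV in auto)
  obtain u v c d where m: "minimizer u v"
    and u: "\<forall>x. u x = 1/2 * max 0 (c - U x - \<epsilon> * potential u v x)"
    and v: "\<forall>x. v x = 1/2 * max 0 (d - V x + \<epsilon> * potential u v x)"
    using minimizer_representative by blast
  have uA: "u \<in> Adm" and vA: "v \<in> Adm" using m by (auto simp: minimizer_def)
  let ?\<psi> = "potential u v" and ?f = "\<lambda>x. u x - v x"
  have \<psi>: "?\<psi> = convolution newton ?f" by (simp add: potential_def)
  have f12: "?f \<in> L12" by (intro L12_diff AdmD(2) uA vA)
  obtain M where M: "\<forall>x. \<bar>?\<psi> x\<bar> \<le> M" using potential_bound[OF AdmD(2)[OF uA] AdmD(2)[OF vA]] ..
  have eM: "\<bar>\<epsilon> * ?\<psi> x\<bar> \<le> \<epsilon> * M" "\<bar>- \<epsilon> * ?\<psi> x\<bar> \<le> \<epsilon> * M" for x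
    using M assms(8) by (simp_all add: abs_mult)
  have u': "u x = 1/2 * max 0 (c - U x - \<epsilon> * ?\<psi> x)" for x by (rule u[rule_format])
  have v': "v x = 1/2 * max 0 (d - V x - - \<epsilon> * ?\<psi> x)" for x using v[rule_format, of x] by simp
  have bu: "bounded_supp u" by (rule coercive_pos_part_bounded_supp[OF u' AdmD(7)[OF uA] coerciveU a_pos eM(1)])
  have bv: "bounded_supp v" by (rule coercive_pos_part_bounded_supp[OF v' AdmD(7)[OF vA] coerciveV a_pos eM(2)])
  have bf: "bounded_supp ?f" by (rule bounded_supp_diff[OF bu bv])
  have d\<psi>: "((\<lambda>x. e * ?\<psi> x) has_derivative (\<lambda>k. k \<bullet> (e *\<^sub>R newton_field ?f x))) (at x)" for e x
    using has_derivative_mult_right[OF newton_conv_has_derivative[OF bf], of e x] by (simp add: \<psi>)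
  have c\<psi>: "continuous_on UNIV (\<lambda>x. e *\<^sub>R newton_field ?f x)" for e
    by (intro continuous_intros newton_field_continuous bf)
  note eu = equilibrium_density[OF derU cgU d\<psi> c\<psi> u' bu]
  note ev = equilibrium_density[OF derV cgV d\<psi> c\<psi> v' bv]
  obtain Du where Du: "bounded_supp Du" "line_gradient u Du" using eu(1) by blast
  obtain Dv where Dv: "bounded_supp Dv" "line_gradient v Dv" using ev(1) by blast
  have "line_gradient (\<lambda>x. 1 * u x + (-1) * v x) (\<lambda>x. 1 *\<^sub>R Du x + (-1) *\<^sub>R Dv x)"
    by (intro line_gradient_combination bounded_supp_loc_bounded Du Dv)
  then have lf: "line_gradient ?f (\<lambda>x. Du x - Dv x)" by simp
  have Df: "bounded_supp (\<lambda>x. Du x - Dv x)" by (rule bounded_supp_diff[OF Du(1) Dv(1)])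
  have "stationary_solution U V \<epsilon> u v ?\<psi>"
    unfolding stationary_solution_def
  proof (intro conjI)
    show "\<exists>w. has_weak_grad (\<lambda>x. 2 * u x + U x + \<epsilon> * ?\<psi> x) w \<and> has_weak_div (\<lambda>x. u x *\<^sub>R w x) (\<lambda>x. 0)"
      by (rule eu(4))
    show "\<exists>w. has_weak_grad (\<lambda>x. 2 * v x + V x - \<epsilon> * ?\<psi> x) w \<and> has_weak_div (\<lambda>x. v x *\<^sub>R w x) (\<lambda>x. 0)"
      using ev(4) by simp
    show "\<exists>w. has_weak_grad ?\<psi> w \<and> has_weak_div w (\<lambda>x. - (u x - v x))"
      unfolding \<psi>
      by (intro exI[of _ "newton_field ?f"] conjI has_weak_grad_newton_conv[OF f12] has_weak_div_newton_field[OF f12])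
  qed
  moreover have "?\<psi> \<in> Linf"
  proof -
    have "?\<psi> \<in> borel_measurable borel" unfolding \<psi> using L12_measurable[OF f12] by measurable
    moreover have "AE x in lborel. norm (?\<psi> x) \<le> M" using M by simp
    ultimately show ?thesis by (auto simp: Linf_def)
  qed
  moreover have "(LINT x|lborel. \<bar>u x\<bar>) = 1" "(LINT x|lborel. \<bar>v x\<bar>) = 1"
  proof -
    have "0 \<le> u x" "0 \<le> v x" for x by (subst u', simp) (subst v', simp)
    then show "(LINT x|lborel. \<bar>u x\<bar>) = 1" "(LINT x|lborel. \<bar>v x\<bar>) = 1" using AdmD(3)[OF uA] AdmD(3)[OF vA] by simp_all
  qed
  moreover have "\<forall>\<alpha>::real. 0 < \<alpha> \<and> \<alpha> < 1 \<longrightarrow> Holder 0 \<alpha> u \<and> Holder 0 \<alpha> v \<and> Holder 2 \<alpha> ?\<psi>"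
  proof (intro allI impI)
    fix \<alpha> :: real assume "0 < \<alpha> \<and> \<alpha> < 1"
    then have \<alpha>: "0 < \<alpha>" "\<alpha> < 1" by auto
    show "Holder 0 \<alpha> u \<and> Holder 0 \<alpha> v \<and> Holder 2 \<alpha> ?\<psi>"
      unfolding \<psi> by (intro conjI eu(3)[OF \<alpha>] ev(3)[OF \<alpha>] newton_conv_Holder_2[OF bf Df lf \<alpha>])
  qed
  moreover have "(u, v) \<in> X \<inter> (W12 \<times> W12)" using Adm_X[OF uA vA] eu(2) ev(2) by simp
  moreover have "\<forall>u' v'. is_arg_min (energy U V \<epsilon>) (\<lambda>p. p \<in> X) (u', v') \<longrightarrow>
      (AE x in lborel. u' x = u x) \<and> (AE x in lborel. v' x = v x)"
    using is_arg_min_unique[OF m] by (intro allI impI)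
  moreover note minimizer_is_arg_min[OF m] u v bounded_supp_compact_support[OF bu] bounded_supp_compact_support[OF bv]
  ultimately show ?thesis
    by (intro exI[of _ u] exI[of _ v] exI[of _ c] exI[of _ d] conjI) assumption+
qed

end
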